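(* Let $E$ be a real separable Banach space with norm $\|\cdot\|$, let $\mathbf{X}=(X_1,X_2,\dots)$ be a sequence of $E$-valued random variables on a probability space $(\Omega,\mathcal{F},P)$ with partial sums $S_n:=X_1+X_2+\dots+X_n$, let $(a_n)_{n\ge 1}$ be a sequence of real numbers and $(b_n)_{n\ge 1}$ a sequence of elements of $E$. Suppose that: (i) $\alpha(\mathbf{X};n)\to 0$ as $n\to\infty$, i.e. the sequence $\mathbf{X}$ is strongly mixing; (ii) $a_n>0$ for all $n$, and the triangular array $(a_nX_j,\ 1\le j\le n,\ n\ge 1)$ is infinitesimal, i.e. for every $\epsilon>0$, $\lim_{n\to\infty}\max_{1\le k\le n}P(a_n\|X_k\|>\epsilon)=0$; (iii) $a_nS_n+b_n\Rightarrow\mu$ as $n\to\infty$ for some non-degenerate Borel probability measure $\mu$ on $E$. Then the limit distribution $\mu$ is selfdecomposable.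
   Context: $\mathcal{P}(E)$ denotes the set of Borel probability measures on the real separable Banach space $E$; $E$-valued random variables are Borel measurable maps $\Omega\to E$; $\Rightarrow$ denotes weak convergence of probability measures (for random variables, convergence in distribution); $\ast$ denotes convolution. A measure is non-degenerate if it is not a point mass $\delta_x$. For $c\in\mathbb{R}\setminus\{0\}$ and $\mu\in\mathcal{P}(E)$, $T_c\mu$ is the image of $\mu$ under the map $x\mapsto cx$. For sub-$\sigma$-fields $\mathcal{A},\mathcal{B}\subset\mathcal{F}$ put $\alpha(\mathcal{A},\mathcal{B}):=\sup_{A\in\mathcal{A},B\in\mathcal{B}}|P(A\cap B)-P(A)P(B)|$. For a sequence $\mathbf{X}=(X_1,X_2,\dots)$ of $E$-valued random variables (no stationarity assumed) and each positive integer $n$, $$\alpha(\mathbf{X};n):=\sup_{j\in\mathbb{N}}\alpha\big(\sigma(X_k,\,1\le k\le j),\ \sigma(X_k,\,k\ge j+n)\big),$$ where $\sigma(\dots)$ is the generated $\sigma$-field. The sequence $\mathbf{X}$ is strongly mixing if $\alpha(\mathbf{X};n)\to 0$ as $n\to\infty$. A measure $\nu\in\mathcal{P}(E)$ is called selfdecomposable (a Lévy class $L$ distribution) if there exist stochastically independent (not necessarily identically distributed) $E$-valued random variables $\xi_1,\xi_2,\dots$, real numbers $a_n>0$ and vectors $b_n\in E$ such that for every $\epsilon>0$, $\lim_{n\to\infty}\max_{1\le k\le n}P(a_n\|\xi_k\|>\epsilon)=0$, and $a_n(\xi_1+\dots+\xi_n)+b_n\Rightarrow\nu$ as $n\to\infty$.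 By a known characterization (Jurek and Mason 1993, Theorem 3.9.2), $\nu$ is selfdecomposable if and only if for every $0<c<1$ there exists $\nu_c\in\mathcal{P}(E)$ such that $\nu=T_c\nu\ast\nu_c$. *)

theory Defs
  imports "HOL-Probability.Probability"
begin

definition sigma_gen :: "'w measure \<Rightarrow> (nat \<Rightarrow> 'w \<Rightarrow> 'a::topological_space) \<Rightarrow> nat set \<Rightarrow> 'w set set" where
  "sigma_gen M X K =
     sigma_sets (space M) (\<Union>k\<in>K. {X k -` B \<inter> space M | B. B \<in> sets borel})"

definition alpha_coeff :: "'w measure \<Rightarrow> 'w set set \<Rightarrow> 'w set set \<Rightarrow> real" where
  "alpha_coeff M \<A> \<B> =
     (SUP (A, B)\<in>\<A> \<times> \<B>. \<bar>measure M (A \<inter> B) - measure M A * measure M B\<bar>)"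

text \<open>Sequences are indexed by the positive integers; the value at index 0 is never used.\<close>

definition alpha_mix :: "'w measure \<Rightarrow> (nat \<Rightarrow> 'w \<Rightarrow> 'a::topological_space) \<Rightarrow> nat \<Rightarrow> real" where
  "alpha_mix M X n = (SUP j\<in>{1..}. alpha_coeff M (sigma_gen M X {1..j}) (sigma_gen M X {j + n..}))"

definition strongly_mixing :: "'w measure \<Rightarrow> (nat \<Rightarrow> 'w \<Rightarrow> 'a::topological_space) \<Rightarrow> bool" where
  "strongly_mixing M X \<longleftrightarrow> alpha_mix M X \<longlonglongrightarrow> 0"

definition infinitesimal_array ::
    "'w measure \<Rightarrow> (nat \<Rightarrow> real) \<Rightarrow> (nat \<Rightarrow> 'w \<Rightarrow> 'a::real_normed_vector) \<Rightarrow> bool" where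
  "infinitesimal_array M a X \<longleftrightarrow>
     (\<forall>\<epsilon>>0. (\<lambda>n. MAX k\<in>{1..n}. measure M {\<omega> \<in> space M. a n * norm (X k \<omega>) > \<epsilon>}) \<longlonglongrightarrow> 0)"

text \<open>The library's \<open>weak_conv_m\<close> is stated through distribution functions and only covers
  measures on the real line.\<close>

definition weak_conv_borel :: "(nat \<Rightarrow> 'a::topological_space measure) \<Rightarrow> 'a measure \<Rightarrow> bool" where
  "weak_conv_borel \<mu>s \<mu> \<longleftrightarrow>
     (\<forall>f::'a \<Rightarrow> real. continuous_on UNIV f \<and> bounded (range f) \<longrightarrow>
        (\<lambda>n. integral\<^sup>L (\<mu>s n) f) \<longlonglongrightarrow> integral\<^sup>L \<mu> f)"

definition borel_prob :: "'a::topological_space measure \<Rightarrow> bool" where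
  "borel_prob \<mu> \<longleftrightarrow> prob_space \<mu> \<and> sets \<mu> = sets borel"

definition nondegenerate :: "'a::topological_space measure \<Rightarrow> bool" where
  "nondegenerate \<mu> \<longleftrightarrow> (\<nexists>x. \<mu> = return borel x)"

text \<open>A definition cannot quantify over the type of the sample space. The type \<open>nat \<Rightarrow> 'a\<close> is used,
  which carries the product of the laws of any independent sequence;
  \<open>selfdecomposableI\<close> below shows that this is no restriction.\<close>

definition selfdecomposable :: "'a::{banach, second_countable_topology} measure \<Rightarrow> bool" where
  "selfdecomposable \<nu> \<longleftrightarrow> borel_prob \<nu> \<and>
     (\<exists>(M :: (nat \<Rightarrow> 'a) measure) \<xi> a b.
        prob_space M \<and>
        prob_space.indep_vars M (\<lambda>_. borel) \<xi> {1..} \<and>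
        (\<forall>n\<ge>1. a n > 0) \<and>
        infinitesimal_array M a \<xi> \<and>
        weak_conv_borel (\<lambda>n. distr M borel (\<lambda>\<omega>. a n *\<^sub>R (\<Sum>k=1..n. \<xi> k \<omega>) + b n)) \<nu>)"

lemma selfdecomposableI:
  fixes \<nu> :: "'a::{banach, second_countable_topology} measure"
    and M :: "'w measure" and \<xi> :: "nat \<Rightarrow> 'w \<Rightarrow> 'a"
  assumes \<nu>: "borel_prob \<nu>"
    and M: "prob_space M"
    and ind: "prob_space.indep_vars M (\<lambda>_. borel) \<xi> {1..}"
    and a: "\<And>n. n \<ge> 1 \<Longrightarrow> a n > 0"
    and inf: "infinitesimal_array M a \<xi>"
    and lim: "weak_conv_borel (\<lambda>n. distr M borel (\<lambda>\<omega>. a n *\<^sub>R (\<Sum>k=1..n. \<xi> k \<omega>) + b n)) \<nu>"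
  shows "selfdecomposable \<nu>"
proof -
  interpret M: prob_space M by (rule M)
  define P where "P = PiM {1::nat..} (\<lambda>_. borel :: 'a measure)"
  define T where "T = (\<lambda>\<omega>. \<lambda>k\<in>{1::nat..}. \<xi> k \<omega>)"
  define N where "N = distr M P T"
  define \<eta> where "\<eta> = (\<lambda>k (f::nat \<Rightarrow> 'a). f k)"
  have rv: "\<xi> k \<in> borel_measurable M" if "k \<ge> 1" for k
    using ind that unfolding M.indep_vars_def by auto
  have T: "T \<in> measurable M P"
    unfolding T_def P_def by (intro measurable_restrict) (auto intro: rv)
  interpret N: prob_space N
    unfolding N_def by (rule M.prob_space_distr[OF T])
  have \<eta>P: "\<eta> k \<in> borel_measurable P" if "k \<ge> 1" for k
    unfolding \<eta>_def P_def using that by (intro measurable_component_singleton) auto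
  have \<eta>: "\<eta> k \<in> borel_measurable N" if "k \<ge> 1" for k
    using \<eta>P[OF that] by (simp add: N_def)
  have \<eta>T: "\<eta> k (T \<omega>) = \<xi> k \<omega>" if "k \<ge> 1" for k \<omega>
    using that by (simp add: \<eta>_def T_def)
  have marg: "distr N borel (\<eta> k) = distr M borel (\<xi> k)" if "k \<ge> 1" for k
    unfolding N_def using that
    by (subst distr_distr[OF \<eta>P T]) (auto intro!: distr_cong simp: \<eta>T)
  have joint: "distr N P (\<lambda>f. \<lambda>k\<in>{1..}. \<eta> k f) = distr M P T"
  proof -
    have id: "(\<lambda>f. \<lambda>k\<in>{1..}. \<eta> k f) \<in> measurable P P"
      unfolding P_def by (intro measurable_restrict \<eta>P[unfolded P_def]) auto
    show ?thesis
      unfolding N_def by (subst distr_distr[OF id T]) (auto intro!: distr_cong simp: T_def \<eta>_def)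
  qed
  have ne: "{1::nat..} \<noteq> {}" by auto
  have "distr M P T = PiM {1..} (\<lambda>k. distr M borel (\<xi> k))"
    using ind M.indep_vars_iff_distr_eq_PiM'[OF ne, of \<xi> "\<lambda>_. borel"] rv
    by (simp add: P_def T_def)
  also have "\<dots> = PiM {1..} (\<lambda>k. distr N borel (\<eta> k))"
    by (intro PiM_cong) (auto simp: marg)
  finally have indN: "N.indep_vars (\<lambda>_. borel) \<eta> {1..}"
    using N.indep_vars_iff_distr_eq_PiM'[OF ne, of \<eta> "\<lambda>_. borel"] \<eta> joint
    by (simp add: P_def)
  have tail: "measure N {f \<in> space N. a n * norm (\<eta> k f) > \<epsilon>} =
      measure M {\<omega> \<in> space M. a n * norm (\<xi> k \<omega>) > \<epsilon>}" if "k \<ge> 1" for n k \<epsilon>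
  proof -
    have [measurable]: "\<eta> k \<in> borel_measurable P" by (rule \<eta>P[OF that])
    have S: "{f \<in> space P. a n * norm (\<eta> k f) > \<epsilon>} \<in> sets P" by measurable
    have "T -` {f \<in> space P. a n * norm (\<eta> k f) > \<epsilon>} \<inter> space M =
        {\<omega> \<in> space M. a n * norm (\<xi> k \<omega>) > \<epsilon>}"
      using measurable_space[OF T] \<eta>T[OF that] by auto
    then show ?thesis
      using measure_distr[OF T S] by (simp add: N_def)
  qed
  have "(MAX k\<in>{1..n}. measure N {f \<in> space N. a n * norm (\<eta> k f) > \<epsilon>}) =
      (MAX k\<in>{1..n}. measure M {\<omega> \<in> space M. a n * norm (\<xi> k \<omega>) > \<epsilon>})" for n \<epsilon>
    by (intro arg_cong[where f = Max] image_cong refl tail) auto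
  then have infN: "infinitesimal_array N a \<eta>"
    using inf by (simp add: infinitesimal_array_def)
  have sums: "distr N borel (\<lambda>f. a n *\<^sub>R (\<Sum>k=1..n. \<eta> k f) + b n) =
      distr M borel (\<lambda>\<omega>. a n *\<^sub>R (\<Sum>k=1..n. \<xi> k \<omega>) + b n)" for n
  proof -
    have S: "(\<lambda>f. a n *\<^sub>R (\<Sum>k=1..n. \<eta> k f) + b n) \<in> borel_measurable P"
      by (intro borel_measurable_add borel_measurable_scaleR borel_measurable_sum
          borel_measurable_const \<eta>P) auto
    show ?thesis
      unfolding N_def by (subst distr_distr[OF S T]) (auto intro!: distr_cong simp: \<eta>T)
  qed
  have limN: "weak_conv_borel (\<lambda>n. distr N borel (\<lambda>f. a n *\<^sub>R (\<Sum>k=1..n. \<eta> k f) + b n)) \<nu>"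
    unfolding sums by (rule lim)
  show ?thesis
    unfolding selfdecomposable_def using \<nu> N.prob_space_axioms indN a infN limN by blast
qed

end

theory Submission imports Defs begin

text \<open>
  As \<open>\<mu>\<close> is non-degenerate and the array infinitesimal, \<open>a n \<longlonglongrightarrow> 0\<close> and \<open>a (n + 1)\<close> is eventually at
  least \<open>\<rho> * a n\<close> for each \<open>\<rho> < 1\<close>. Hence for \<open>0 < c < 1\<close> and each gap length \<open>q\<close> there are arbitrarily
  large \<open>m\<close> and \<open>n \<ge> m + q\<close> with \<open>a n / a m \<approx> c\<close>. Up to a negligible gap of length \<open>q\<close>, the normed
  sum at \<open>n\<close> is \<open>c\<close> times the normed sum at \<open>m\<close> plus a variable \<open>V\<close> which is almost independent of it by
  strong mixing. So \<open>\<mu>\<close> is within any \<open>\<epsilon> > 0\<close>, in the bounded Lipschitz metric, of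
  the convolution of \<open>T\<^sub>c \<mu>\<close> with the law of \<open>V\<close>.

  This approximate decomposability suffices. Choose \<open>\<nu>\<^sub>k\<close> for \<open>c = (k - 1) / k\<close> and \<open>\<epsilon> = 2\<^sup>-\<^sup>k\<close>, and let
  \<open>\<xi>\<^sub>k\<close> be independent, distributed as \<open>T\<^sub>k \<nu>\<^sub>k\<close>. The errors are summable and old ones are damped by the
  contraction, so \<open>(\<xi>\<^sub>1 + \<dots> + \<xi>\<^sub>n) / n\<close> converges weakly to \<open>\<mu>\<close>. The array is infinitesimal since
  \<open>\<nu>\<^sub>k\<close> converges to the point mass at 0: otherwise \<open>\<mu>\<close> would be nearly invariant under a shift that
  is not small.
\<close>

section \<open>Bounded Lipschitz functions\<close>

text \<open>An exact factor would have to come from a weak limit of the laws of \<open>V\<close>,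
  which calls for a tightness argument in an infinite-dimensional space. Approximate factors avoid
  this, since selfdecomposability only asks for some independent sequence. The price is that
  infinitesimality of the new array must follow from approximate identities alone; an L2 estimate
  for nearly harmonic functions takes the place of dividing characteristic functionals. Mixing
  controls the covariance of one pair of functions at a time, while closeness must be uniform over
  functions \<open>F (c u + v)\<close> that couple both arguments. Discretising \<open>u\<close> by
  finitely many weights leaves finitely many covariances. Their number has to be known before the
  gap length is chosen, so the weights are built from \<open>\<mu>\<close> and not from the law of a
  normed sum. The factors \<open>(k - 1) / k\<close> are used because their product from
  \<open>K + 1\<close> to \<open>N\<close> is \<open>K / N\<close>: plain averages then solve the
  recursion.\<close>

definition BL :: "real \<Rightarrow> ('a::metric_space \<Rightarrow> real) \<Rightarrow> bool" where
  "BL L f \<longleftrightarrow> (\<forall>x. \<bar>f x\<bar> \<le> 1) \<and> (\<forall>x y. \<bar>f x - f y\<bar> \<le> L * dist x y)"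

definition bl_close :: "'a::metric_space measure \<Rightarrow> 'a measure \<Rightarrow> real \<Rightarrow> bool" where
  "bl_close \<mu> \<nu> \<epsilon> \<longleftrightarrow> (\<forall>f. BL 1 f \<longrightarrow> \<bar>integral\<^sup>L \<mu> f - integral\<^sup>L \<nu> f\<bar> \<le> \<epsilon>)"

lemma BL_abs: "BL L f \<Longrightarrow> \<bar>f x\<bar> \<le> 1"
  and BL_lip: "BL L f \<Longrightarrow> \<bar>f x - f y\<bar> \<le> L * dist x y"
  by (auto simp: BL_def)

lemma BL_mono: "BL L f \<Longrightarrow> L \<le> L' \<Longrightarrow> BL L' f"
  unfolding BL_def by (meson mult_right_mono order_trans zero_le_dist)

lemma BL_continuous:
  assumes "BL L f" shows "continuous_on UNIV f"
proof -
  have "BL (max 0 L) f" using assms by (rule BL_mono) simp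
  then have "(max 0 L)-lipschitz_on UNIV f"
    by (intro lipschitz_onI) (auto simp: BL_def dist_real_def)
  then show ?thesis by (rule lipschitz_on_continuous_on)
qed

lemma BL_measurable:
  assumes "BL L f" "sets M = sets borel" shows "f \<in> borel_measurable M"
  using borel_measurable_continuous_onI[OF BL_continuous[OF assms(1)]] assms(2)
  by (metis measurable_cong_sets)

lemma borel_probD:
  assumes "borel_prob \<mu>"
  shows "prob_space \<mu>" "sets \<mu> = sets borel" "space \<mu> = UNIV"
  using assms sets_eq_imp_space_eq[of \<mu> borel] by (auto simp: borel_prob_def)

lemma borel_prob_distr:
  assumes "prob_space M" "f \<in> borel_measurable M"
  shows "borel_prob (distr M borel f)"
  using assms by (simp add: borel_prob_def prob_space.prob_space_distr)

lemma integrable_bounded_prob: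
  fixes f :: "'b \<Rightarrow> real"
  assumes "prob_space M" "f \<in> borel_measurable M" "\<And>x. \<bar>f x\<bar> \<le> B"
  shows "integrable M f"
proof -
  interpret prob_space M by fact
  show ?thesis by (rule integrable_const_bound[of _ B]) (use assms in auto)
qed

lemma abs_integral_prob_le:
  fixes f :: "'b \<Rightarrow> real"
  assumes "prob_space M" "f \<in> borel_measurable M" "\<And>x. \<bar>f x\<bar> \<le> B"
  shows "\<bar>integral\<^sup>L M f\<bar> \<le> B"
proof -
  interpret prob_space M by fact
  have i: "integrable M f" using assms by (rule integrable_bounded_prob)
  have "integral\<^sup>L M f \<le> B" using assms(3) i by (intro integral_le_const) (auto simp: abs_le_iff)
  moreover have "- B \<le> integral\<^sup>L M f" using assms(3) i
    by (intro integral_ge_const AE_I2) (auto simp: abs_le_iff minus_le_iff)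
  ultimately show ?thesis by auto
qed

lemma BL_integrable: "BL L f \<Longrightarrow> borel_prob \<mu> \<Longrightarrow> integrable \<mu> f"
  by (rule integrable_bounded_prob[OF borel_probD(1) BL_measurable[OF _ borel_probD(2)] BL_abs])

lemma BL_mult:
  assumes "BL L f" "BL K g" shows "BL (L + K) (\<lambda>x. f x * g x)"
  unfolding BL_def
proof (intro conjI allI)
  fix x y
  show "\<bar>f x * g x\<bar> \<le> 1"
    using mult_mono[OF BL_abs[OF assms(1)] BL_abs[OF assms(2)], of x x] by (simp add: abs_mult)
  have "f x * g x - f y * g y = (f x - f y) * g x + f y * (g x - g y)" by (simp add: algebra_simps)
  then have "\<bar>f x * g x - f y * g y\<bar> \<le> \<bar>f x - f y\<bar> * \<bar>g x\<bar> + \<bar>f y\<bar> * \<bar>g x - g y\<bar>"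
    by (metis abs_mult abs_triangle_ineq)
  also have "\<dots> \<le> \<bar>f x - f y\<bar> * 1 + 1 * \<bar>g x - g y\<bar>"
    using assms by (intro add_mono mult_mono) (auto simp: BL_def)
  also have "\<dots> \<le> (L + K) * dist x y"
    using BL_lip[OF assms(1), of x y] BL_lip[OF assms(2), of x y] by (simp add: algebra_simps)
  finally show "\<bar>f x * g x - f y * g y\<bar> \<le> (L + K) * dist x y" .
qed

lemma BL_prod:
  assumes "\<And>j. BL L (f j)" "0 \<le> L" shows "BL (real i * L) (\<lambda>x. \<Prod>j<i. f j x)"
proof (induction i)
  case 0 show ?case by (auto simp: BL_def)
next
  case (Suc i)
  show ?case using BL_mult[OF Suc assms(1)[of i]] by (simp add: algebra_simps)
qed

text \<open>Dividing by \<open>L\<close> turns \<open>f\<close> into a \<open>BL 1\<close> function;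
  \<open>1 \<le> L\<close> keeps its supremum bound at 1.\<close>

lemma bl_close_BL:
  assumes c: "bl_close \<mu> \<nu> \<epsilon>" and f: "BL L f" and L: "1 \<le> L"
  shows "\<bar>integral\<^sup>L \<mu> f - integral\<^sup>L \<nu> f\<bar> \<le> L * \<epsilon>"
proof -
  have "BL 1 (\<lambda>x. f x / L)"
    unfolding BL_def
  proof (intro conjI allI)
    fix x y
    show "\<bar>f x / L\<bar> \<le> 1" using BL_abs[OF f, of x] L by simp
    have "f x / L - f y / L = (f x - f y) / L" by (simp add: diff_divide_distrib)
    then show "\<bar>f x / L - f y / L\<bar> \<le> 1 * dist x y"
      using BL_lip[OF f, of x y] L by (simp add: divide_simps mult.commute)
  qed
  then have "\<bar>(\<integral>x. f x / L \<partial>\<mu>) - (\<integral>x. f x / L \<partial>\<nu>)\<bar> \<le> \<epsilon>"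
    using c unfolding bl_close_def by blast
  then have "\<bar>(integral\<^sup>L \<mu> f - integral\<^sup>L \<nu> f) / L\<bar> \<le> \<epsilon>" by (simp add: diff_divide_distrib)
  then show ?thesis using L by (simp add: divide_simps mult.commute)
qed

lemma bl_close_mono: "bl_close \<mu> \<nu> \<epsilon> \<Longrightarrow> \<epsilon> \<le> \<epsilon>' \<Longrightarrow> bl_close \<mu> \<nu> \<epsilon>'"
  unfolding bl_close_def by force

lemma bl_close_sym: "bl_close \<mu> \<nu> \<epsilon> \<Longrightarrow> bl_close \<nu> \<mu> \<epsilon>"
  unfolding bl_close_def by (simp add: abs_minus_commute)

lemma bl_close_trans: "bl_close \<mu> \<nu> \<epsilon> \<Longrightarrow> bl_close \<nu> \<rho> \<delta> \<Longrightarrow> bl_close \<mu> \<rho> (\<epsilon> + \<delta>)"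
  unfolding bl_close_def by (smt (verit))

text \<open>A trapezoid of height \<open>t\<close> lies between \<open>t\<close> times the
  indicators of the two balls. Slope 1 over a collar of width \<open>t\<close> forces this height,
  and undoing it divides the error by \<open>t\<close>; \<open>t \<le> 1\<close> keeps the trapezoid
  in \<open>BL 1\<close>.\<close>

lemma bl_close_cball:
  fixes \<mu> \<nu> :: "'a::metric_space measure"
  assumes \<mu>: "borel_prob \<mu>" and \<nu>: "borel_prob \<nu>" and c: "bl_close \<mu> \<nu> \<epsilon>" and t: "0 < t" "t \<le> 1"
  shows "measure \<mu> (cball x s) - \<epsilon> / t \<le> measure \<nu> (cball x (s + t))"
proof -
  interpret \<mu>: prob_space \<mu> using borel_probD[OF \<mu>] by auto
  interpret \<nu>: prob_space \<nu> using borel_probD[OF \<nu>] by auto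
  define f where "f = (\<lambda>y. max 0 (min t (s + t - dist x y)))"
  have BLf: "BL 1 f"
    unfolding BL_def
  proof (intro conjI allI)
    fix y z
    show "\<bar>f y\<bar> \<le> 1" using t by (auto simp: f_def)
    show "\<bar>f y - f z\<bar> \<le> 1 * dist y z"
      using dist_triangle[of x y z] dist_triangle[of x z y] by (auto simp: f_def dist_commute max_def min_def)
  qed
  have sm: "A \<in> sets \<mu>" "A \<in> sets \<nu>" if "closed A" for A
    using that borel_probD[OF \<mu>] borel_probD[OF \<nu>] by auto
  have "t * measure \<mu> (cball x s) = (\<integral>y. t * indicator (cball x s) y \<partial>\<mu>)"
    using sm[of "cball x s"] by simp
  also have "\<dots> \<le> integral\<^sup>L \<mu> f"
    using sm[of "cball x s"] t
    by (intro integral_mono BL_integrable[OF BLf \<mu>] integrable_mult_right integrable_real_indicator)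
       (auto simp: f_def indicator_def \<mu>.emeasure_finite less_top[symmetric])
  also have "\<dots> \<le> integral\<^sup>L \<nu> f + \<epsilon>"
    using c BLf unfolding bl_close_def by (smt (verit))
  also have "integral\<^sup>L \<nu> f \<le> (\<integral>y. t * indicator (cball x (s + t)) y \<partial>\<nu>)"
    using sm[of "cball x (s+t)"] t
    by (intro integral_mono BL_integrable[OF BLf \<nu>] integrable_mult_right integrable_real_indicator)
       (auto simp: f_def indicator_def \<nu>.emeasure_finite less_top[symmetric])
  also have "\<dots> = t * measure \<nu> (cball x (s + t))"
    using sm[of "cball x (s+t)"] by simp
  finally have "t * (measure \<mu> (cball x s) - \<epsilon> / t) \<le> t * measure \<nu> (cball x (s + t))"
    using t by (simp add: algebra_simps)
  then show ?thesis using t by simp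
qed

section \<open>Concentration on balls and point masses\<close>

lemma measure_cball_tendsto_1:
  fixes \<mu> :: "'a::metric_space measure"
  assumes "borel_prob \<mu>" "p < 1"
  shows "\<exists>R>0. p < measure \<mu> (cball x R)"
proof -
  interpret prob_space \<mu> using borel_probD[OF assms(1)] by auto
  have "(\<lambda>n. measure \<mu> (cball x (real n))) \<longlonglongrightarrow> measure \<mu> (\<Union>n. cball x (real n))"
    by (rule finite_Lim_measure_incseq) (use borel_probD[OF assms(1)] in \<open>auto simp: incseq_def\<close>)
  moreover have "(\<Union>n. cball x (real n)) = UNIV"
    using real_arch_simple by (auto simp: set_eq_iff)
  ultimately have "(\<lambda>n. measure \<mu> (cball x (real n))) \<longlonglongrightarrow> 1"
    using prob_space borel_probD[OF assms(1)] by simp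
  then have "eventually (\<lambda>n. p < measure \<mu> (cball x (real n))) sequentially"
    using assms(2) by (rule order_tendstoD)
  then have "eventually (\<lambda>n. p < measure \<mu> (cball x (real n)) \<and> n > 0) sequentially"
    using eventually_gt_at_top by eventually_elim auto
  then obtain n where "p < measure \<mu> (cball x (real n))" "n > 0"
    using eventually_happens'[OF sequentially_bot] by blast
  then show ?thesis by (intro exI[of _ "real n"]) auto
qed

text \<open>Two balls that each carry more than half of the mass must meet. Hence the centres of
  balls of shrinking radius and growing mass form a Cauchy sequence, and completeness supplies the
  atom.\<close>

lemma point_mass_criterion:
  fixes \<mu> :: "'a::{complete_space, second_countable_topology} measure"
  assumes \<mu>: "borel_prob \<mu>"
    and conc: "\<And>t p. 0 < t \<Longrightarrow> p < 1 \<Longrightarrow> \<exists>y. p < measure \<mu> (cball y t)"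
  shows "\<exists>x. \<mu> = return borel x"
proof -
  interpret prob_space \<mu> using borel_probD[OF \<mu>] by auto
  have cl: "closed A \<Longrightarrow> A \<in> events" for A using borel_probD[OF \<mu>] by auto
  define t where "t = (\<lambda>n::nat. 1 / real (Suc n))"
  have tpos: "t n > 0" for n by (simp add: t_def)
  have tl: "t \<longlonglongrightarrow> 0" unfolding t_def by real_asymp
  \<comment> \<open>With \<open>t n \<le> 1/2\<close> the ball masses exceed 1/2; index 0 is
    excluded since \<open>t 0 = 1\<close>.\<close>
  have tl2: "t n \<le> 1/2" if "n \<ge> 1" for n using that by (simp add: t_def field_simps)
  have tdec: "t n \<le> t m" if "m \<le> n" for m n using that by (simp add: t_def field_simps)
  have "\<exists>y. 1 - t n < measure \<mu> (cball y (t n))" for n by (rule conc) (use tpos[of n] in auto)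
  then obtain y where y: "\<And>n. 1 - t n < measure \<mu> (cball (y n) (t n))" by metis
  have dy: "dist (y m) (y n) \<le> t m + t n" if "m \<ge> 1" "n \<ge> 1" for m n
  proof (rule ccontr)
    assume "\<not> ?thesis"
    then have dis: "cball (y m) (t m) \<inter> cball (y n) (t n) = {}"
      by (auto simp: disjoint_iff) (metis add_mono dist_commute dist_triangle2 order_trans)
    have "measure \<mu> (cball (y m) (t m)) + measure \<mu> (cball (y n) (t n)) =
       measure \<mu> (cball (y m) (t m) \<union> cball (y n) (t n))"
      by (rule finite_measure_Union[symmetric]) (use dis cl in auto)
    also have "\<dots> \<le> 1" by (rule prob_le_1)
    finally show False using y[of m] y[of n] tl2[OF that(1)] tl2[OF that(2)] by linarith
  qed
  have "Cauchy y"
    unfolding Cauchy_def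
  proof (intro allI impI)
    fix e :: real assume e: "e > 0"
    have "eventually (\<lambda>n. t n < e/2) sequentially" using e by (intro order_tendstoD(2)[OF tl]) simp
    then obtain N where N: "\<And>n. n \<ge> N \<Longrightarrow> t n < e/2" unfolding eventually_sequentially by auto
    have "dist (y m) (y n) < e" if "m \<ge> Suc N" "n \<ge> Suc N" for m n
      using N[of m] N[of n] dy[of m n] that by auto
    then show "\<exists>M. \<forall>m\<ge>M. \<forall>n\<ge>M. dist (y m) (y n) < e" by blast
  qed
  then obtain x where x: "y \<longlonglongrightarrow> x" using Cauchy_convergent convergent_def by blast
  have dx: "dist (y m) x \<le> 2 * t m" if "m \<ge> 1" for m
  proof (rule tendsto_upperbound)
    show "(\<lambda>n. dist (y m) (y n)) \<longlonglongrightarrow> dist (y m) x" by (intro tendsto_intros x)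
    show "eventually (\<lambda>n. dist (y m) (y n) \<le> 2 * t m) sequentially"
      using eventually_ge_at_top[of m]
    proof eventually_elim
      case (elim n)
      then show ?case using dy[of m n] tdec[of m n] that by auto
    qed
  qed simp
  have "measure \<mu> (cball x (3 * t m)) \<ge> 1 - t m" if "m \<ge> 1" for m
  proof -
    have "cball (y m) (t m) \<subseteq> cball x (3 * t m)"
    proof
      fix z assume "z \<in> cball (y m) (t m)"
      then show "z \<in> cball x (3 * t m)"
        using dx[OF that] dist_triangle[of x z "y m"] by (simp add: dist_commute)
    qed
    then have "measure \<mu> (cball (y m) (t m)) \<le> measure \<mu> (cball x (3 * t m))"
      by (intro finite_measure_mono cl) auto
    then show ?thesis using y[of m] by linarith
  qed
  then have ev: "eventually (\<lambda>m. 1 - t m \<le> measure \<mu> (cball x (3 * t m))) sequentially"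
    by (auto simp: eventually_sequentially)
  have "(\<lambda>m. measure \<mu> (cball x (3 * t m))) \<longlonglongrightarrow> measure \<mu> (\<Inter>m. cball x (3 * t m))"
  proof (rule finite_Lim_measure_decseq)
    show "decseq (\<lambda>m. cball x (3 * t m))"
      unfolding decseq_def
    proof (intro allI impI subsetI)
      fix m n z assume "m \<le> n" "z \<in> cball x (3 * t n)"
      then show "z \<in> cball x (3 * t m)" using tdec[of m n] by simp
    qed
  qed (use cl in auto)
  moreover have "(\<Inter>m. cball x (3 * t m)) = {x}"
  proof (intro set_eqI iffI)
    fix z assume "z \<in> (\<Inter>m. cball x (3 * t m))"
    then have z: "dist x z \<le> 3 * t m" for m by auto
    have "(\<lambda>m. 3 * t m) \<longlonglongrightarrow> 3 * 0" by (intro tendsto_intros tl)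
    then have "dist x z \<le> 3 * 0" by (rule tendsto_lowerbound) (use z in auto)
    then show "z \<in> {x}" by simp
  qed (use tpos in \<open>auto simp: less_imp_le\<close>)
  ultimately have "(\<lambda>m. measure \<mu> (cball x (3 * t m))) \<longlonglongrightarrow> measure \<mu> {x}" by simp
  moreover have "(\<lambda>m. 1 - t m) \<longlonglongrightarrow> 1 - 0" by (intro tendsto_intros tl)
  ultimately have "measure \<mu> {x} \<ge> 1 - 0" using ev by (rule tendsto_le[OF sequentially_bot])
  then have m1: "measure \<mu> {x} = 1" using prob_le_1[of "{x}"] by linarith
  have ae: "AE z in \<mu>. z = x"
    using m1 prob_Collect_eq_1[of "\<lambda>z. z = x"] cl[of "{x}"] borel_probD(3)[OF \<mu>] by simp
  have "\<mu> = return borel x"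
  proof (rule measure_eqI)
    show "sets \<mu> = sets (return borel x)" using borel_probD[OF \<mu>] by simp
    fix A assume A: "A \<in> events"
    have "emeasure \<mu> A = emeasure \<mu> (if x \<in> A then space \<mu> else {})"
      by (rule emeasure_eq_AE) (use ae A borel_probD[OF \<mu>] in auto)
    then show "emeasure \<mu> A = emeasure (return borel x) A"
      using A borel_probD[OF \<mu>] emeasure_space_1 by (auto simp: indicator_def)
  qed
  then show ?thesis ..
qed

section \<open>Finitely many test functions and weak convergence\<close>

text \<open>Used in place of compactness: a probability measure on a separable metric space is
  described, up to a small error and uniformly over \<open>BL 1\<close>, by finitely many Lipschitz weights.\<close>

lemma lipschitz_partition:
  fixes \<mu> :: "'a::{metric_space, second_countable_topology} measure"
  assumes \<mu>: "borel_prob \<mu>" and \<delta>: "0 < \<delta>"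
  obtains N :: nat and x :: "nat \<Rightarrow> 'a" and w L where "1 \<le> L" "\<And>i. BL L (w i)" "\<And>i y. 0 \<le> w i y"
    "\<And>y. (\<Sum>i<N. w i y) \<le> 1" "\<And>i y. w i y \<noteq> 0 \<Longrightarrow> dist y (x i) \<le> \<delta>"
    "1 - \<delta> \<le> (\<integral>y. (\<Sum>i<N. w i y) \<partial>\<mu>)"
proof -
  interpret prob_space \<mu> using borel_probD[OF \<mu>] by auto
  obtain D :: "'a set" where D: "countable D" "\<And>X. open X \<Longrightarrow> X \<noteq> {} \<Longrightarrow> \<exists>d\<in>D. d \<in> X"
    using countable_dense_exists by blast
  have "D \<noteq> {}" using D(2)[OF open_UNIV] by auto
  define x where "x = from_nat_into D"
  have dense: "\<exists>i. dist y (x i) < \<delta> / 2" for y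
  proof -
    have "\<exists>d\<in>D. d \<in> ball y (\<delta>/2)" by (rule D(2)) (use \<delta> in auto)
    then show ?thesis using from_nat_into_surj[OF D(1)] unfolding x_def by (metis mem_ball)
  qed
  \<comment> \<open>A bump around \<open>x i\<close>: 1 up to distance \<open>\<delta> / 2\<close>,
    0 from distance \<open>\<delta>\<close> on, hence of slope \<open>2 / \<delta>\<close>.\<close>
  define \<theta> where "\<theta> i y = max 0 (min 1 (2 - 2 * dist y (x i) / \<delta>))" for i y
  have \<theta>01: "0 \<le> \<theta> i y" "\<theta> i y \<le> 1" for i y by (auto simp: \<theta>_def)
  have \<theta>BL: "BL (2 / \<delta>) (\<theta> i)" for i
    unfolding BL_def
  proof (intro conjI allI)
    fix y z
    show "\<bar>\<theta> i y\<bar> \<le> 1" using \<theta>01[of i y] by simp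
    have "\<bar>\<theta> i y - \<theta> i z\<bar> \<le> \<bar>2 * dist y (x i) / \<delta> - 2 * dist z (x i) / \<delta>\<bar>"
      by (auto simp: \<theta>_def max_def min_def)
    also have "2 * dist y (x i) / \<delta> - 2 * dist z (x i) / \<delta> = 2 / \<delta> * (dist y (x i) - dist z (x i))"
      by (simp add: algebra_simps)
    also have "\<bar>\<dots>\<bar> = 2 / \<delta> * \<bar>dist y (x i) - dist z (x i)\<bar>"
      using \<delta> by (simp only: abs_mult) simp
    also have "\<dots> \<le> 2 / \<delta> * dist y z"
      using \<delta> dist_triangle[of y "x i" z] dist_triangle[of z "x i" y]
      by (intro mult_left_mono) (auto simp: dist_commute)
    finally show "\<bar>\<theta> i y - \<theta> i z\<bar> \<le> 2 / \<delta> * dist y z" .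
  qed
  have \<theta>'BL: "BL (2 / \<delta>) (\<lambda>y. 1 - \<theta> i y)" for i
    using \<theta>BL[of i] \<theta>01[of i] by (auto simp: BL_def abs_minus_commute)
  define C where "C N = (\<Union>i<N. ball (x i) (\<delta>/2))" for N :: nat
  have "(\<lambda>N. measure \<mu> (C N)) \<longlonglongrightarrow> measure \<mu> (\<Union>N. C N)"
    by (rule finite_Lim_measure_incseq)
       (use borel_probD[OF \<mu>] in \<open>auto simp: incseq_def C_def intro: less_le_trans\<close>)
  moreover have "(\<Union>N. C N) = UNIV"
    using dense by (auto simp: C_def dist_commute set_eq_iff) blast
  ultimately have "(\<lambda>N. measure \<mu> (C N)) \<longlonglongrightarrow> 1"
    using prob_space borel_probD[OF \<mu>] by simp
  then have "eventually (\<lambda>N. 1 - \<delta> < measure \<mu> (C N)) sequentially"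
    using \<delta> by (intro order_tendstoD(1)) auto
  then obtain N where N: "1 - \<delta> < measure \<mu> (C N)"
    using eventually_happens'[OF sequentially_bot] by blast
  \<comment> \<open>Each weight takes its bump's share of what the earlier bumps left over, so the
    partial sums telescope and never exceed 1.\<close>
  define v where "v i y = \<theta> i y * (\<Prod>j<i. 1 - \<theta> j y)" for i y
  have v_sum: "(\<Sum>i<n. v i y) = 1 - (\<Prod>j<n. 1 - \<theta> j y)" for n y
    by (induction n) (auto simp: v_def algebra_simps)
  have v_sum_le: "(\<Sum>i<n. v i y) \<le> 1" for n y
    using prod_nonneg[of "{..<n}" "\<lambda>j. 1 - \<theta> j y"] \<theta>01 by (simp add: v_sum)
  have v_nonneg: "0 \<le> v i y" for i y
    using \<theta>01 by (auto simp: v_def intro!: mult_nonneg_nonneg prod_nonneg)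
  have v_BL: "BL (2/\<delta> + real i * (2/\<delta>)) (v i)" for i
    unfolding v_def using \<delta> by (intro BL_mult \<theta>BL BL_prod \<theta>'BL) auto
  \<comment> \<open>Cutting off at \<open>N\<close> lets one Lipschitz constant serve all
    weights.\<close>
  define w where "w i = (if i < N then v i else (\<lambda>_. 0))" for i
  have w_sum: "(\<Sum>i<N. w i y) = (\<Sum>i<N. v i y)" for y
    by (intro sum.cong) (auto simp: w_def)
  define L where "L = max 1 (2/\<delta> + real N * (2/\<delta>))"
  have L1: "1 \<le> L" by (simp add: L_def)
  have w_BL: "BL L (w i)" for i
  proof (cases "i < N")
    case True
    then have "2/\<delta> + real i * (2/\<delta>) \<le> L"
      unfolding L_def using \<delta> by (intro max.coboundedI2 add_left_mono mult_right_mono) auto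
    then show ?thesis using True v_BL[of i] BL_mono by (auto simp: w_def)
  qed (use L1 in \<open>auto simp: w_def BL_def\<close>)
  have w_supp: "dist y (x i) \<le> \<delta>" if "w i y \<noteq> 0" for i y
  proof (rule ccontr)
    assume "\<not> ?thesis"
    then have "2 - 2 * dist y (x i) / \<delta> < 0" using \<delta> by (simp add: field_simps)
    then have "\<theta> i y = 0" by (simp add: \<theta>_def)
    then show False using that by (auto simp: w_def v_def split: if_splits)
  qed
  \<comment> \<open>On \<open>C N\<close> some bump equals 1, which kills the leftover
    product.\<close>
  have w_ge: "indicator (C N) y \<le> (\<Sum>i<N. w i y)" for y
  proof (cases "y \<in> C N")
    case True
    then obtain i where i: "i < N" "dist (x i) y < \<delta>/2" by (auto simp: C_def)
    then have "2 * dist y (x i) / \<delta> \<le> 1" using \<delta> by (simp add: field_simps dist_commute)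
    then have "\<theta> i y = 1" by (simp add: \<theta>_def)
    then have p: "(\<Prod>j<N. 1 - \<theta> j y) = 0" using i by auto
    show ?thesis unfolding w_sum v_sum p by (simp add: indicator_def)
  qed (simp add: w_sum sum_nonneg v_nonneg)
  have Cs: "C N \<in> sets \<mu>" unfolding C_def using borel_probD(2)[OF \<mu>] by auto
  have "measure \<mu> (C N) = (\<integral>y. indicator (C N) y \<partial>\<mu>)" using Cs by simp
  also have "\<dots> \<le> (\<integral>y. (\<Sum>i<N. w i y) \<partial>\<mu>)"
    using Cs by (intro integral_mono Bochner_Integration.integrable_sum BL_integrable[OF w_BL \<mu>] w_ge integrable_real_indicator)
      (auto simp: emeasure_finite less_top[symmetric])
  finally have "1 - \<delta> \<le> (\<integral>y. (\<Sum>i<N. w i y) \<partial>\<mu>)" using N by linarith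
  show thesis
  proof (rule that[OF L1 w_BL])
    show "0 \<le> w i y" for i y using v_nonneg by (simp add: w_def)
    show "(\<Sum>i<N. w i y) \<le> 1" for y using v_sum_le by (simp add: w_sum)
  qed (erule w_supp, fact)
qed

text \<open>Where \<open>w i\<close> is nonzero, replacing \<open>F y\<close> by
  \<open>F (x i)\<close> costs at most \<open>\<delta>\<close>; the part of 1 not covered by the
  weights is charged with \<open>\<bar>F y\<bar> \<le> 1\<close>. The bound is the same for every
  \<open>F\<close>.\<close>

lemma lipschitz_partition_approx:
  fixes w :: "nat \<Rightarrow> 'a::metric_space \<Rightarrow> real"
  assumes F: "BL 1 F" and w: "\<And>i. 0 \<le> w i y" "(\<Sum>i<N. w i y) \<le> 1"
    "\<And>i. w i y \<noteq> 0 \<Longrightarrow> dist y (x i) \<le> \<delta>" and \<delta>: "0 \<le> \<delta>"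
  shows "\<bar>F y - (\<Sum>i<N. w i y * F (x i))\<bar> \<le> \<delta> + (1 - (\<Sum>i<N. w i y))"
proof -
  have "F y - (\<Sum>i<N. w i y * F (x i)) = (\<Sum>i<N. w i y * (F y - F (x i))) + (1 - (\<Sum>i<N. w i y)) * F y"
    by (simp add: algebra_simps sum_subtractf sum_distrib_left)
  then have "\<bar>F y - (\<Sum>i<N. w i y * F (x i))\<bar> \<le>
      (\<Sum>i<N. \<bar>w i y * (F y - F (x i))\<bar>) + \<bar>(1 - (\<Sum>i<N. w i y)) * F y\<bar>"
    using sum_abs[of "\<lambda>i. w i y * (F y - F (x i))" "{..<N}"] by linarith
  also have "\<bar>(1 - (\<Sum>i<N. w i y)) * F y\<bar> \<le> 1 - (\<Sum>i<N. w i y)"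
    using w(2) BL_abs[OF F, of y] by (simp add: abs_mult mult_left_le)
  also have "(\<Sum>i<N. \<bar>w i y * (F y - F (x i))\<bar>) \<le> (\<Sum>i<N. w i y * \<delta>)"
  proof (intro sum_mono)
    fix i
    show "\<bar>w i y * (F y - F (x i))\<bar> \<le> w i y * \<delta>"
    proof (cases "w i y = 0")
      case False
      have "\<bar>F y - F (x i)\<bar> \<le> \<delta>" using BL_lip[OF F, of y "x i"] w(3)[OF False] by simp
      then show ?thesis using w(1)[of i] by (simp add: abs_mult mult_left_mono)
    qed simp
  qed
  also have "(\<Sum>i<N. w i y * \<delta>) \<le> 1 * \<delta>"
    unfolding sum_distrib_right[symmetric] using w(2) \<delta> by (intro mult_right_mono) auto
  finally show ?thesis by simp
qed

lemma abs_integral_diff_le: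
  fixes f g h :: "'b \<Rightarrow> real"
  assumes "integrable M f" "integrable M g" "integrable M h" "\<And>x. x \<in> space M \<Longrightarrow> \<bar>f x - g x\<bar> \<le> h x"
  shows "\<bar>integral\<^sup>L M f - integral\<^sup>L M g\<bar> \<le> integral\<^sup>L M h"
proof -
  have "integral\<^sup>L M f - integral\<^sup>L M g = (\<integral>x. f x - g x \<partial>M)" using assms by simp
  also have "\<bar>\<dots>\<bar> \<le> (\<integral>x. \<bar>f x - g x\<bar> \<partial>M)" by (rule integral_abs_bound)
  also have "\<dots> \<le> integral\<^sup>L M h" using assms by (intro integral_mono) auto
  finally show ?thesis .
qed

text \<open>The integrals of the weights determine the discretised integral of every
  \<open>F\<close>, and also the mass that the partition misses under \<open>\<nu>\<close>; so no
  tightness of \<open>\<nu>\<close> is presupposed, and the tests depend only on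
  \<open>\<mu>\<close> and \<open>\<epsilon>\<close>.\<close>

lemma bl_close_finite_tests:
  fixes \<mu> :: "'a::{metric_space, second_countable_topology} measure"
  assumes \<mu>: "borel_prob \<mu>" and \<epsilon>: "0 < \<epsilon>"
  shows "\<exists>(N::nat) (w :: nat \<Rightarrow> 'a \<Rightarrow> real) L \<eta>. 1 \<le> L \<and> (\<forall>i. BL L (w i)) \<and> 0 < \<eta> \<and>
    (\<forall>\<nu>. borel_prob \<nu> \<longrightarrow> (\<forall>i<N. \<bar>integral\<^sup>L \<mu> (w i) - integral\<^sup>L \<nu> (w i)\<bar> \<le> \<eta>) \<longrightarrow> bl_close \<mu> \<nu> \<epsilon>)"
proof -
  \<comment> \<open>Discretising costs \<open>2 * \<delta>\<close> under \<open>\<mu>\<close> and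
    \<open>3 * \<delta>\<close> under \<open>\<nu>\<close>, the tests cost another
    \<open>\<delta>\<close>: six in all, with some room.\<close>
  define \<delta> where "\<delta> = \<epsilon> / 8"
  have \<delta>: "0 < \<delta>" using \<epsilon> by (simp add: \<delta>_def)
  obtain N :: nat and x w L where L: "1 \<le> L" and BLw: "\<And>i. BL L (w i)" and w0: "\<And>i y. 0 \<le> w i y"
    and w1: "\<And>y. (\<Sum>i<N. w i y) \<le> 1" and ws: "\<And>i y. w i y \<noteq> 0 \<Longrightarrow> dist y (x i) \<le> \<delta>"
    and wi: "1 - \<delta> \<le> (\<integral>y. (\<Sum>i<N. w i y) \<partial>\<mu>)"
    by (rule lipschitz_partition[OF \<mu> \<delta>], rule that, assumption+)
  define \<eta> where "\<eta> = \<delta> / real (Suc N)"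
  have \<eta>: "0 < \<eta>" "real N * \<eta> \<le> \<delta>" using \<delta> by (auto simp: \<eta>_def field_simps)
  have "bl_close \<mu> \<nu> \<epsilon>"
    if \<nu>: "borel_prob \<nu>" and c: "\<And>i. i < N \<Longrightarrow> \<bar>integral\<^sup>L \<mu> (w i) - integral\<^sup>L \<nu> (w i)\<bar> \<le> \<eta>" for \<nu>
    unfolding bl_close_def
  proof (intro allI impI)
    fix F :: "'a \<Rightarrow> real" assume F: "BL 1 F"
    let ?G = "\<lambda>y. \<Sum>i<N. w i y * F (x i)"
    have int: "integrable \<rho> (w i)" if "borel_prob \<rho>" for \<rho> i using BL_integrable[OF BLw that] .
    have appr: "\<bar>integral\<^sup>L \<rho> F - integral\<^sup>L \<rho> ?G\<bar> \<le> \<delta> + (1 - (\<integral>y. (\<Sum>i<N. w i y) \<partial>\<rho>))"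
      if \<rho>: "borel_prob \<rho>" for \<rho>
    proof -
      interpret \<rho>: prob_space \<rho> using borel_probD[OF \<rho>] by auto
      have "\<bar>integral\<^sup>L \<rho> F - integral\<^sup>L \<rho> ?G\<bar> \<le> (\<integral>y. \<delta> + (1 - (\<Sum>i<N. w i y)) \<partial>\<rho>)"
        using lipschitz_partition_approx[OF F w0 w1 ws] \<delta>
        by (intro abs_integral_diff_le BL_integrable[OF F \<rho>] Bochner_Integration.integrable_sum
              Bochner_Integration.integrable_add Bochner_Integration.integrable_diff
              integrable_mult_left int[OF \<rho>] \<rho>.integrable_const) auto
      also have "\<dots> = \<delta> + (1 - (\<integral>y. (\<Sum>i<N. w i y) \<partial>\<rho>))"
        using int[OF \<rho>] by (simp add: \<rho>.prob_space)
      finally show ?thesis .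
    qed
    have sums: "(\<integral>y. (\<Sum>i<N. w i y * F (x i)) \<partial>\<rho>) = (\<Sum>i<N. integral\<^sup>L \<rho> (w i) * F (x i))"
      "(\<integral>y. (\<Sum>i<N. w i y) \<partial>\<rho>) = (\<Sum>i<N. integral\<^sup>L \<rho> (w i))" if "borel_prob \<rho>" for \<rho>
      using int[OF that] by auto
    have "\<bar>integral\<^sup>L \<mu> ?G - integral\<^sup>L \<nu> ?G\<bar> =
        \<bar>\<Sum>i<N. (integral\<^sup>L \<mu> (w i) - integral\<^sup>L \<nu> (w i)) * F (x i)\<bar>"
      unfolding sums[OF \<mu>] sums[OF \<nu>] by (simp add: sum_subtractf left_diff_distrib)
    also have "\<dots> \<le> (\<Sum>i<N. \<eta> * 1)"
    proof (intro order_trans[OF sum_abs] sum_mono)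
      fix i assume "i \<in> {..<N}"
      then show "\<bar>(integral\<^sup>L \<mu> (w i) - integral\<^sup>L \<nu> (w i)) * F (x i)\<bar> \<le> \<eta> * 1"
        unfolding abs_mult using c BL_abs[OF F] \<eta> by (intro mult_mono) auto
    qed
    also have "\<dots> \<le> \<delta>" using \<eta> by simp
    finally have mid: "\<bar>integral\<^sup>L \<mu> ?G - integral\<^sup>L \<nu> ?G\<bar> \<le> \<delta>" .
    have "\<bar>(\<integral>y. (\<Sum>i<N. w i y) \<partial>\<mu>) - (\<integral>y. (\<Sum>i<N. w i y) \<partial>\<nu>)\<bar> =
        \<bar>\<Sum>i<N. (integral\<^sup>L \<mu> (w i) - integral\<^sup>L \<nu> (w i))\<bar>"
      unfolding sums[OF \<mu>] sums[OF \<nu>] by (simp add: sum_subtractf)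
    also have "\<dots> \<le> (\<Sum>i<N. \<eta>)"
      using c by (intro order_trans[OF sum_abs] sum_mono) auto
    also have "\<dots> \<le> \<delta>" using \<eta> by simp
    finally show "\<bar>integral\<^sup>L \<mu> F - integral\<^sup>L \<nu> F\<bar> \<le> \<epsilon>"
      using appr[OF \<mu>] appr[OF \<nu>] mid wi unfolding \<delta>_def by linarith
  qed
  then show ?thesis using L BLw \<eta>(1) by blast
qed

section \<open>Weak convergence and the bounded Lipschitz metric\<close>

lemma weak_conv_borel_imp_bl_close:
  fixes \<mu> :: "'a::{metric_space, second_countable_topology} measure"
  assumes \<mu>: "borel_prob \<mu>" and \<nu>: "\<And>n. borel_prob (\<nu> n)" and w: "weak_conv_borel \<nu> \<mu>" and \<epsilon>: "0 < \<epsilon>"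
  shows "eventually (\<lambda>n. bl_close \<mu> (\<nu> n) \<epsilon>) sequentially"
proof -
  obtain N :: nat and w L \<eta> where L: "1 \<le> L" and BLw: "\<And>i. BL L (w i)" and \<eta>: "0 < \<eta>"
    and c: "\<And>\<nu>. borel_prob \<nu> \<Longrightarrow> \<forall>i<N. \<bar>integral\<^sup>L \<mu> (w i) - integral\<^sup>L \<nu> (w i)\<bar> \<le> \<eta> \<Longrightarrow> bl_close \<mu> \<nu> \<epsilon>"
    using bl_close_finite_tests[OF \<mu> \<epsilon>] by blast
  have "eventually (\<lambda>n. \<bar>integral\<^sup>L \<mu> (w i) - integral\<^sup>L (\<nu> n) (w i)\<bar> \<le> \<eta>) sequentially" for i
  proof -
    have "bounded (range (w i))" using BL_abs[OF BLw[of i]] by (auto simp: bounded_iff)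
    then have "(\<lambda>n. integral\<^sup>L (\<nu> n) (w i)) \<longlonglongrightarrow> integral\<^sup>L \<mu> (w i)"
      using w BL_continuous[OF BLw[of i]] by (auto simp: weak_conv_borel_def)
    then have "eventually (\<lambda>n. dist (integral\<^sup>L (\<nu> n) (w i)) (integral\<^sup>L \<mu> (w i)) < \<eta>) sequentially"
      using \<eta> by (rule tendstoD)
    then show ?thesis by eventually_elim (auto simp: dist_real_def)
  qed
  then have "eventually (\<lambda>n. \<forall>i\<in>{..<N}. \<bar>integral\<^sup>L \<mu> (w i) - integral\<^sup>L (\<nu> n) (w i)\<bar> \<le> \<eta>) sequentially"
    by (intro eventually_ball_finite) auto
  then show ?thesis by eventually_elim (rule c[OF \<nu>], blast)
qed

text \<open>A bounded continuous function is an increasing limit of Lipschitz functions, which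
  bounds the limit inferior of its integrals from below; the same bound for \<open>- f\<close>
  handles the limit superior.\<close>

lemma weak_conv_borel_if_BL:
  fixes \<mu> :: "'a::metric_space measure"
  assumes \<mu>: "borel_prob \<mu>" and \<nu>: "\<And>n. borel_prob (\<nu> n)"
    and c: "\<And>f. BL 1 f \<Longrightarrow> (\<lambda>n. integral\<^sup>L (\<nu> n) f) \<longlonglongrightarrow> integral\<^sup>L \<mu> f"
  shows "weak_conv_borel \<nu> \<mu>"
proof -
  interpret \<mu>: prob_space \<mu> using borel_probD[OF \<mu>] by auto
  have cL: "(\<lambda>n. integral\<^sup>L (\<nu> n) f) \<longlonglongrightarrow> integral\<^sup>L \<mu> f"
    if f: "\<And>x. \<bar>f x\<bar> \<le> K" "\<And>x y. \<bar>f x - f y\<bar> \<le> K * dist x y" and K: "0 < K" for f :: "'a \<Rightarrow> real" and K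
  proof -
    have "BL 1 (\<lambda>x. f x / K)"
      unfolding BL_def
    proof (intro conjI allI)
      fix x y
      show "\<bar>f x / K\<bar> \<le> 1" using f(1)[of x] K by simp
      have "f x / K - f y / K = (f x - f y) / K" by (simp add: diff_divide_distrib)
      then show "\<bar>f x / K - f y / K\<bar> \<le> 1 * dist x y"
        using f(2)[of x y] K by (simp add: divide_simps mult.commute)
    qed
    from tendsto_mult_left[OF c[OF this], of K] show ?thesis using K by simp
  qed
  have lower: "\<exists>g. (\<forall>x. g x \<le> f x) \<and> (\<lambda>n. integral\<^sup>L (\<nu> n) g) \<longlonglongrightarrow> integral\<^sup>L \<mu> g
      \<and> (\<forall>x. \<bar>g x\<bar> \<le> B) \<and> g \<in> borel_measurable borel \<and> integral\<^sup>L \<mu> f - \<epsilon> < integral\<^sup>L \<mu> g"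
    if f: "continuous_on UNIV f" "\<And>x. \<bar>f x\<bar> \<le> B" and \<epsilon>: "0 < \<epsilon>" for f :: "'a \<Rightarrow> real" and B \<epsilon>
  proof -
    have B0: "0 \<le> B" using f(2)[of undefined] by linarith
    \<comment> \<open>The inf-convolutions of \<open>f\<close> with \<open>k * dist\<close> are Lipschitz and increase to \<open>f\<close>.\<close>
    define g where "g k x = (INF y. f y + real k * dist x y)" for k x
    have bdd: "bdd_below (range (\<lambda>y. f y + real k * dist x y))" for k x
    proof (rule bdd_belowI2)
      fix y show "- B \<le> f y + real k * dist x y"
        using f(2)[of y] mult_nonneg_nonneg[OF of_nat_0_le_iff zero_le_dist, of k x y] by linarith
    qed
    have g_le: "g k x \<le> f y + real k * dist x y" for k x y
      unfolding g_def by (rule cINF_lower[OF bdd]) auto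
    have g_ge: "z \<le> g k x" if "\<And>y. z \<le> f y + real k * dist x y" for z k x
      unfolding g_def by (rule cINF_greatest) (use that in auto)
    have gf: "g k x \<le> f x" for k x using g_le[of k x x] by simp
    have gB: "\<bar>g k x\<bar> \<le> B" for k x
    proof -
      have "- B \<le> g k x"
      proof (rule g_ge)
        fix y show "- B \<le> f y + real k * dist x y"
          using f(2)[of y] mult_nonneg_nonneg[OF of_nat_0_le_iff zero_le_dist, of k x y] by linarith
      qed
      then show ?thesis using gf[of k x] f(2)[of x] by (auto simp: abs_le_iff)
    qed
    have g1: "g k x - real k * dist x y \<le> g k y" for k x y
    proof (rule g_ge)
      fix z
      have "real k * dist x z \<le> real k * dist x y + real k * dist y z"
        using dist_triangle[of x z y] by (metis distrib_left mult_left_mono of_nat_0_le_iff)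
      then show "g k x - real k * dist x y \<le> f z + real k * dist y z"
        using g_le[of k x z] by linarith
    qed
    have g_lip: "\<bar>g k x - g k y\<bar> \<le> real k * dist x y" for k x y
      using g1[of k x y] g1[of k y x] by (auto simp: dist_commute)
    have conv: "(\<lambda>k. g k x) \<longlonglongrightarrow> f x" for x
    proof (rule tendstoI)
      fix e :: real assume e: "0 < e"
      have "isCont f x" using f(1) by (simp add: continuous_on_eq_continuous_at)
      then obtain d where d: "0 < d" "\<And>y. dist y x < d \<Longrightarrow> dist (f y) (f x) < e/2"
        using e unfolding continuous_at_eps_delta by (metis half_gt_zero)
      \<comment> \<open>From distance \<open>d\<close> on, the penalty is at least
        \<open>2 * B\<close>, the largest possible drop of \<open>f\<close>, so only points near
        \<open>x\<close> can lower the infimum.\<close>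
      obtain K where K: "real K > 2 * B / d" using reals_Archimedean2 by blast
      have "dist (g k x) (f x) < e" if "K \<le> k" for k
      proof -
        have "f x - e/2 \<le> g k x"
        proof (rule g_ge)
          fix y
          show "f x - e/2 \<le> f y + real k * dist x y"
          proof (cases "dist y x < d")
            case True
            then show ?thesis
              using d(2)[OF True] e mult_nonneg_nonneg[OF of_nat_0_le_iff zero_le_dist, of k x y]
              unfolding dist_real_def by linarith
          next
            case False
            have "2 * B \<le> real K * d" using K d(1) by (simp add: field_simps)
            also have "\<dots> \<le> real k * dist x y"
              using False that d(1) by (intro mult_mono) (auto simp: dist_commute)
            finally show ?thesis using f(2)[of x] f(2)[of y] e by (auto simp: abs_le_iff)
          qed
        qed
        then show ?thesis using gf[of k x] e by (simp add: dist_real_def abs_less_iff)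
      qed
      then show "eventually (\<lambda>k. dist (g k x) (f x) < e) sequentially"
        by (auto simp: eventually_sequentially)
    qed
    have gm: "g k \<in> borel_measurable borel" for k
    proof (rule borel_measurable_continuous_onI)
      have "(real k)-lipschitz_on UNIV (g k)" using g_lip by (intro lipschitz_onI) (auto simp: dist_real_def)
      then show "continuous_on UNIV (g k)" by (rule lipschitz_on_continuous_on)
    qed
    have fm: "f \<in> borel_measurable borel" using f(1) by (rule borel_measurable_continuous_onI)
    have m\<mu>: "measurable \<mu> borel = measurable borel borel"
      using borel_probD[OF \<mu>] by (intro measurable_cong_sets) auto
    have "(\<lambda>k. integral\<^sup>L \<mu> (g k)) \<longlonglongrightarrow> integral\<^sup>L \<mu> f"
      by (rule integral_dominated_convergence[where w = "\<lambda>_. B"]) (use conv gB gm fm m\<mu> in auto)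
    then have "eventually (\<lambda>k. integral\<^sup>L \<mu> f - \<epsilon> < integral\<^sup>L \<mu> (g k)) sequentially"
      using \<epsilon> by (intro order_tendstoD(1)) auto
    then obtain k where k: "integral\<^sup>L \<mu> f - \<epsilon> < integral\<^sup>L \<mu> (g k)"
      using eventually_happens'[OF sequentially_bot] by blast
    have "(\<lambda>n. integral\<^sup>L (\<nu> n) (g k)) \<longlonglongrightarrow> integral\<^sup>L \<mu> (g k)"
    proof (rule cL)
      show "\<bar>g k x\<bar> \<le> B + real k + 1" for x using gB[of k x] by linarith
      show "\<bar>g k x - g k y\<bar> \<le> (B + real k + 1) * dist x y" for x y
        using B0 by (intro order_trans[OF g_lip] mult_right_mono) auto
    qed (use B0 in auto)
    then show ?thesis using k gf gB gm by (intro exI[of _ "g k"]) blast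
  qed
  have ev_lower: "eventually (\<lambda>n. integral\<^sup>L \<mu> f - \<epsilon> < integral\<^sup>L (\<nu> n) f) sequentially"
    if f: "continuous_on UNIV f" "\<And>x. \<bar>f x\<bar> \<le> B" and \<epsilon>: "0 < \<epsilon>" for f :: "'a \<Rightarrow> real" and B \<epsilon>
  proof -
    obtain g where g: "\<And>x. g x \<le> f x" "(\<lambda>n. integral\<^sup>L (\<nu> n) g) \<longlonglongrightarrow> integral\<^sup>L \<mu> g"
      "\<And>x. \<bar>g x\<bar> \<le> B" "g \<in> borel_measurable borel" "integral\<^sup>L \<mu> f - \<epsilon> < integral\<^sup>L \<mu> g"
      using lower[OF f \<epsilon>] by blast
    have fm: "f \<in> borel_measurable borel" using f(1) by (rule borel_measurable_continuous_onI)
    have "eventually (\<lambda>n. integral\<^sup>L \<mu> f - \<epsilon> < integral\<^sup>L (\<nu> n) g) sequentially"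
      by (rule order_tendstoD(1)[OF g(2) g(5)])
    then show ?thesis
    proof eventually_elim
      case (elim n)
      have mn: "measurable (\<nu> n) borel = measurable borel borel"
        using borel_probD[OF \<nu>] by (intro measurable_cong_sets) auto
      have "integral\<^sup>L (\<nu> n) g \<le> integral\<^sup>L (\<nu> n) f"
        by (intro integral_mono integrable_bounded_prob[where B = B] borel_probD(1)[OF \<nu>])
           (use g f(2) fm mn in auto)
      then show ?case using elim by linarith
    qed
  qed
  show ?thesis
    unfolding weak_conv_borel_def
  proof (intro allI impI, elim conjE, rule tendstoI)
    fix f :: "'a \<Rightarrow> real" and \<epsilon> :: real
    assume f: "continuous_on UNIV f" "bounded (range f)" and \<epsilon>: "0 < \<epsilon>"
    obtain B where B: "\<And>x. \<bar>f x\<bar> \<le> B" using f(2) by (auto simp: bounded_iff)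
    have "eventually (\<lambda>n. integral\<^sup>L \<mu> f - \<epsilon> < integral\<^sup>L (\<nu> n) f) sequentially"
      by (rule ev_lower[OF f(1) B \<epsilon>])
    moreover have "eventually (\<lambda>n. integral\<^sup>L \<mu> (\<lambda>x. - f x) - \<epsilon> < integral\<^sup>L (\<nu> n) (\<lambda>x. - f x)) sequentially"
    proof (rule ev_lower)
      show "\<bar>- f x\<bar> \<le> B" for x using B by simp
    qed (use f(1) \<epsilon> in \<open>auto intro: continuous_intros\<close>)
    ultimately show "eventually (\<lambda>n. dist (integral\<^sup>L (\<nu> n) f) (integral\<^sup>L \<mu> f) < \<epsilon>) sequentially"
      by eventually_elim (auto simp: dist_real_def abs_less_iff)
  qed
qed

section \<open>Convolutions close to the identity\<close>

text \<open>This is \<open>T\<^sub>c \<mu> \<ast> \<nu>\<close>, formed in one step as the law of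
  \<open>c X + V\<close> with independent \<open>X\<close> and \<open>V\<close>;
  \<open>c = 1\<close> gives ordinary convolution.\<close>

definition conv :: "real \<Rightarrow> 'a::{real_normed_vector, second_countable_topology} measure \<Rightarrow> 'a measure \<Rightarrow> 'a measure" where
  "conv c \<mu> \<nu> = distr (\<mu> \<Otimes>\<^sub>M \<nu>) borel (\<lambda>(x, v). c *\<^sub>R x + v)"

context
  fixes \<mu> \<nu> :: "'a::{real_normed_vector, second_countable_topology} measure"
  assumes \<mu>: "borel_prob \<mu>" and \<nu>: "borel_prob \<nu>"
begin

lemma measurable_conv: "(\<lambda>(x, v). c *\<^sub>R x + v) \<in> borel_measurable (\<mu> \<Otimes>\<^sub>M \<nu>)"
proof -
  note [measurable_cong] = borel_probD(2)[OF \<mu>] borel_probD(2)[OF \<nu>]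
  show ?thesis by measurable
qed

lemma integral_conv:
  fixes F :: "'a \<Rightarrow> real"
  assumes F: "F \<in> borel_measurable borel" "\<And>x. \<bar>F x\<bar> \<le> B"
  shows "integral\<^sup>L (conv c \<mu> \<nu>) F = (\<integral>x. (\<integral>v. F (c *\<^sub>R x + v) \<partial>\<nu>) \<partial>\<mu>)"
    and "integral\<^sup>L (conv c \<mu> \<nu>) F = (\<integral>v. (\<integral>x. F (c *\<^sub>R x + v) \<partial>\<mu>) \<partial>\<nu>)"
proof -
  interpret \<mu>: prob_space \<mu> using borel_probD[OF \<mu>] by auto
  interpret \<nu>: prob_space \<nu> using borel_probD[OF \<nu>] by auto
  interpret P: pair_prob_space \<mu> \<nu> ..
  have m: "(\<lambda>(x, v). F (c *\<^sub>R x + v)) \<in> borel_measurable (\<mu> \<Otimes>\<^sub>M \<nu>)"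
    using measurable_compose[OF measurable_conv F(1)] by (simp add: split_def)
  have i: "integrable (\<mu> \<Otimes>\<^sub>M \<nu>) (\<lambda>(x, v). F (c *\<^sub>R x + v))"
    using m F(2) by (intro integrable_bounded_prob[where B = B] P.prob_space_axioms) auto
  have "integral\<^sup>L (conv c \<mu> \<nu>) F = (\<integral>z. (\<lambda>(x, v). F (c *\<^sub>R x + v)) z \<partial>(\<mu> \<Otimes>\<^sub>M \<nu>))"
    unfolding conv_def by (subst integral_distr[OF measurable_conv F(1)]) (simp add: split_def)
  then show "integral\<^sup>L (conv c \<mu> \<nu>) F = (\<integral>x. (\<integral>v. F (c *\<^sub>R x + v) \<partial>\<nu>) \<partial>\<mu>)"
    and "integral\<^sup>L (conv c \<mu> \<nu>) F = (\<integral>v. (\<integral>x. F (c *\<^sub>R x + v) \<partial>\<mu>) \<partial>\<nu>)"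
    using P.integral_fst[OF i] P.integral_snd[OF i] by simp_all
qed

end

lemma BL_shift:
  fixes f :: "'a::real_normed_vector \<Rightarrow> real"
  shows "BL L f \<Longrightarrow> BL L (\<lambda>y. f (z + y))"
  unfolding BL_def by (metis dist_add_cancel)

text \<open>Averaging multiplies the Lipschitz constant by \<open>\<bar>c\<bar>\<close> but leaves
  the supremum bound at 1, which is why \<open>BL\<close> keeps the two bounds apart. Iterating this
  contraction is what makes an initial law irrelevant.\<close>

lemma BL_averaged:
  fixes \<nu> :: "'a::{real_normed_vector, second_countable_topology} measure"
  assumes \<nu>: "borel_prob \<nu>" and F: "BL L F"
  shows "BL (L * \<bar>c\<bar>) (\<lambda>x. \<integral>v. F (c *\<^sub>R x + v) \<partial>\<nu>)"
  unfolding BL_def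
proof (intro conjI allI)
  fix x y
  interpret prob_space \<nu> using borel_probD[OF \<nu>] by auto
  have m: "(\<lambda>v. F (z + v)) \<in> borel_measurable \<nu>" for z
  proof -
    have "(\<lambda>v. z + v) \<in> measurable \<nu> borel"
      using borel_probD[OF \<nu>] by (simp cong: measurable_cong_sets)
    then show ?thesis using measurable_compose[OF _ BL_measurable[OF F]] by (metis (no_types))
  qed
  have i: "integrable \<nu> (\<lambda>v. F (z + v))" for z
    by (rule integrable_bounded_prob[OF prob_space_axioms m BL_abs[OF F]])
  show "\<bar>\<integral>v. F (c *\<^sub>R x + v) \<partial>\<nu>\<bar> \<le> 1"
    by (rule abs_integral_prob_le[OF prob_space_axioms m BL_abs[OF F]])
  have "\<bar>(\<integral>v. F (c *\<^sub>R x + v) \<partial>\<nu>) - (\<integral>v. F (c *\<^sub>R y + v) \<partial>\<nu>)\<bar> \<le> (\<integral>v. L * \<bar>c\<bar> * dist x y \<partial>\<nu>)"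
  proof (rule abs_integral_diff_le[OF i i])
    fix v
    have "dist (c *\<^sub>R x + v) (c *\<^sub>R y + v) = \<bar>c\<bar> * dist x y"
      by (simp add: dist_norm scaleR_diff_right[symmetric])
    then show "\<bar>F (c *\<^sub>R x + v) - F (c *\<^sub>R y + v)\<bar> \<le> L * \<bar>c\<bar> * dist x y"
      using BL_lip[OF F, of "c *\<^sub>R x + v" "c *\<^sub>R y + v"] by (simp add: mult.assoc)
  qed simp
  then show "\<bar>(\<integral>v. F (c *\<^sub>R x + v) \<partial>\<nu>) - (\<integral>v. F (c *\<^sub>R y + v) \<partial>\<nu>)\<bar> \<le> L * \<bar>c\<bar> * dist x y"
    by (simp add: prob_space)
qed

lemma integral_conv_BL:
  fixes \<mu> \<nu> :: "'a::{real_normed_vector, second_countable_topology} measure"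
  assumes "borel_prob \<mu>" "borel_prob \<nu>" "BL L F"
  shows "integral\<^sup>L (conv c \<mu> \<nu>) F = (\<integral>x. (\<integral>v. F (c *\<^sub>R x + v) \<partial>\<nu>) \<partial>\<mu>)"
    and "integral\<^sup>L (conv c \<mu> \<nu>) F = (\<integral>v. (\<integral>x. F (c *\<^sub>R x + v) \<partial>\<mu>) \<partial>\<nu>)"
  using integral_conv[OF assms(1,2) BL_measurable[OF assms(3) refl] BL_abs[OF assms(3)]] by auto

lemma bl_close_conv_left:
  fixes \<mu> \<mu>' \<nu> :: "'a::{real_normed_vector, second_countable_topology} measure"
  assumes "borel_prob \<mu>" "borel_prob \<mu>'" "borel_prob \<nu>" "bl_close \<mu> \<mu>' \<epsilon>" "\<bar>c\<bar> \<le> 1"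
  shows "bl_close (conv c \<mu> \<nu>) (conv c \<mu>' \<nu>) \<epsilon>"
  unfolding bl_close_def
proof (intro allI impI)
  fix F :: "'a \<Rightarrow> real" assume F: "BL 1 F"
  have "BL 1 (\<lambda>x. \<integral>v. F (c *\<^sub>R x + v) \<partial>\<nu>)"
    using BL_averaged[OF assms(3) F] BL_mono assms(5) by fastforce
  then show "\<bar>integral\<^sup>L (conv c \<mu> \<nu>) F - integral\<^sup>L (conv c \<mu>' \<nu>) F\<bar> \<le> \<epsilon>"
    using assms(4) unfolding integral_conv_BL(1)[OF assms(1,3) F] integral_conv_BL(1)[OF assms(2,3) F]
      bl_close_def by blast
qed

text \<open>The integrand bounds the change of a \<open>BL 1\<close> function when its argument
  moves by \<open>t * norm x\<close>. The truncation keeps the integral finite without any moment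
  assumption.\<close>

definition trunc_moment :: "'a::real_normed_vector measure \<Rightarrow> real \<Rightarrow> real" where
  "trunc_moment \<mu> t = (\<integral>x. min 2 (t * norm x) \<partial>\<mu>)"

lemma integrable_trunc:
  fixes \<mu> :: "'a::real_normed_vector measure"
  assumes "borel_prob \<mu>" "0 \<le> t" shows "integrable \<mu> (\<lambda>x. min 2 (t * norm x))"
proof (rule integrable_bounded_prob[where B = 2])
  note [measurable_cong] = borel_probD(2)[OF assms(1)]
  show "(\<lambda>x. min 2 (t * norm x)) \<in> borel_measurable \<mu>" by measurable
qed (use assms borel_probD in auto)

lemma trunc_moment_tendsto_0:
  fixes \<mu> :: "'a::real_normed_vector measure"
  assumes \<mu>: "borel_prob \<mu>" and t: "t \<longlonglongrightarrow> 0" "\<And>n. 0 \<le> t n"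
  shows "(\<lambda>n. trunc_moment \<mu> (t n)) \<longlonglongrightarrow> 0"
proof -
  interpret prob_space \<mu> using borel_probD[OF \<mu>] by auto
  have "(\<lambda>n. \<integral>x. min 2 (t n * norm x) \<partial>\<mu>) \<longlonglongrightarrow> (\<integral>x. 0 \<partial>\<mu>)"
  proof (rule integral_dominated_convergence[where w = "\<lambda>_. 2"])
    show "AE x in \<mu>. (\<lambda>n. min 2 (t n * norm x)) \<longlonglongrightarrow> 0"
    proof (rule AE_I2)
      fix x
      have "(\<lambda>n. min 2 (t n * norm x)) \<longlonglongrightarrow> min 2 (0 * norm x)" by (intro tendsto_intros t)
      then show "(\<lambda>n. min 2 (t n * norm x)) \<longlonglongrightarrow> 0" by simp
    qed
    show "(\<lambda>x. min 2 (t n * norm x)) \<in> borel_measurable \<mu>" for n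
      using integrable_trunc[OF \<mu> t(2)] by (rule borel_measurable_integrable)
  qed (use t in auto)
  then show ?thesis by (simp add: trunc_moment_def)
qed

lemma BL_diff_trunc:
  assumes "BL L F" "L * dist x y \<le> s" shows "\<bar>F x - F y\<bar> \<le> min 2 s"
  using BL_lip[OF assms(1), of x y] BL_abs[OF assms(1), of x] BL_abs[OF assms(1), of y] assms(2) by auto

lemma bl_close_conv_scale:
  fixes \<mu> \<nu> :: "'a::{real_normed_vector, second_countable_topology} measure"
  assumes \<mu>: "borel_prob \<mu>" and \<nu>: "borel_prob \<nu>"
  shows "bl_close (conv c \<mu> \<nu>) (conv c' \<mu> \<nu>) (trunc_moment \<mu> \<bar>c - c'\<bar>)"
  unfolding bl_close_def
proof (intro allI impI)
  fix F :: "'a \<Rightarrow> real" assume F: "BL 1 F"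
  define A where "A d x = (\<integral>v. F (d *\<^sub>R x + v) \<partial>\<nu>)" for d x
  have BA: "BL (1 * \<bar>d\<bar>) (A d)" for d unfolding A_def by (rule BL_averaged[OF \<nu> F])
  \<comment> \<open>Seen as an average at scale 1 evaluated at \<open>d x\<close>, so that the
    Lipschitz constant does not depend on \<open>d\<close>.\<close>
  have A1: "A d x = (\<integral>v. F (1 *\<^sub>R (d *\<^sub>R x) + v) \<partial>\<nu>)" for d x by (simp add: A_def)
  show "\<bar>integral\<^sup>L (conv c \<mu> \<nu>) F - integral\<^sup>L (conv c' \<mu> \<nu>) F\<bar> \<le> trunc_moment \<mu> \<bar>c - c'\<bar>"
    unfolding integral_conv_BL(1)[OF \<mu> \<nu> F] trunc_moment_def A_def[symmetric]
  proof (rule abs_integral_diff_le[OF BL_integrable[OF BA \<mu>] BL_integrable[OF BA \<mu>] integrable_trunc[OF \<mu>]])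
    fix x :: 'a
    have "dist (c *\<^sub>R x) (c' *\<^sub>R x) = \<bar>c - c'\<bar> * norm x"
      by (simp add: dist_norm scaleR_diff_left[symmetric])
    then show "\<bar>A c x - A c' x\<bar> \<le> min 2 (\<bar>c - c'\<bar> * norm x)"
      unfolding A1 using BL_averaged[OF \<nu> F, of 1] by (intro BL_diff_trunc) auto
  qed simp
qed

text \<open>A quantitative Choquet--Deny argument. With \<open>Q f x = (\<integral>w. f (x + w) \<partial>\<nu>)\<close> and \<open>G x\<close> the integral
  in the conclusion, \<open>h\<^sup>2 + G \<le> Q (h\<^sup>2) + 2 * \<epsilon>\<close> (conditional variance) and \<open>G \<le> Q G + 8 * \<epsilon>\<close>
  (Jensen, as the increments of \<open>h\<close> are nearly harmonic themselves), so that \<open>h\<^sup>2 + j * G\<close> stays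
  bounded for every \<open>j\<close>.\<close>

lemma near_harmonic_increments:
  fixes \<nu> :: "'a::{real_normed_vector, second_countable_topology} measure"
  assumes \<nu>: "borel_prob \<nu>" and h: "BL L h"
    and harm: "\<And>x. \<bar>h x - (\<integral>w. h (x + w) \<partial>\<nu>)\<bar> \<le> \<epsilon>"
  shows "real m * (\<integral>w. (h (x + w) - h x)\<^sup>2 \<partial>\<nu>) \<le> 1 + 10 * (real m)\<^sup>2 * \<epsilon>"
proof -
  interpret prob_space \<nu> using borel_probD[OF \<nu>] by auto
  interpret P: pair_prob_space \<nu> \<nu> ..
  have \<epsilon>: "0 \<le> \<epsilon>" using harm[of 0] by linarith
  note [measurable_cong] = borel_probD(2)[OF \<nu>]
  have [measurable]: "h \<in> borel_measurable borel" using BL_measurable[OF h] by simp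
  have hb: "\<bar>h x\<bar> \<le> 1" for x using BL_abs[OF h] .
  have hb2: "\<bar>h x - h y\<bar> \<le> 2" for x y using hb[of x] hb[of y] by linarith
  have sq4: "\<bar>(h x - h y)\<^sup>2\<bar> \<le> 4" for x y
    using power_mono[OF hb2[of x y], of 2] by simp
  have hsq: "\<bar>(h x)\<^sup>2\<bar> \<le> 1" for x using hb[of x] abs_square_le_1[of "h x"] by simp
  define G where "G x = (\<integral>w. (h (x + w) - h x)\<^sup>2 \<partial>\<nu>)" for x
  define u where "u x = (h x)\<^sup>2" for x
  have [measurable]: "u \<in> borel_measurable borel" "G \<in> borel_measurable borel"
    unfolding u_def G_def by measurable
  have G4: "\<bar>G x\<bar> \<le> 4" for x
    unfolding G_def by (rule abs_integral_prob_le[OF prob_space_axioms _ sq4]) measurable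
  have int_h: "integrable \<nu> (\<lambda>w. h (x + w))" for x
    by (rule integrable_bounded_prob[OF prob_space_axioms _ hb]) measurable
  have int_u: "integrable \<nu> (\<lambda>w. u (x + w))" for x
    unfolding u_def by (rule integrable_bounded_prob[OF prob_space_axioms _ hsq]) measurable
  have int_G: "integrable \<nu> (\<lambda>w. G (x + w))" for x
    by (rule integrable_bounded_prob[OF prob_space_axioms _ G4]) measurable
  have one: "u x + G x \<le> (\<integral>w. u (x + w) \<partial>\<nu>) + 2 * \<epsilon>" for x
  proof -
    have "G x = (\<integral>w. u (x + w) - 2 * h x * h (x + w) + u x \<partial>\<nu>)"
      unfolding G_def u_def by (simp add: power2_diff algebra_simps)
    also have "\<dots> = (\<integral>w. u (x + w) \<partial>\<nu>) - 2 * h x * (\<integral>w. h (x + w) \<partial>\<nu>) + u x"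
      using int_u int_h by (simp add: prob_space)
    also have "\<dots> = (\<integral>w. u (x + w) \<partial>\<nu>) + 2 * (h x * (h x - (\<integral>w. h (x + w) \<partial>\<nu>))) - u x"
      by (simp add: u_def power2_eq_square algebra_simps)
    also have "h x * (h x - (\<integral>w. h (x + w) \<partial>\<nu>)) \<le> 1 * \<epsilon>"
      by (rule order_trans[OF abs_ge_self], unfold abs_mult, rule mult_mono[OF hb harm]) auto
    finally show ?thesis by linarith
  qed
  have two: "G x \<le> (\<integral>v. G (x + v) \<partial>\<nu>) + 8 * \<epsilon>" for x
  proof -
    have pw: "(h (x + w) - h x)\<^sup>2 \<le> (\<integral>v. (h (x + v + w) - h (x + v))\<^sup>2 \<partial>\<nu>) + 8 * \<epsilon>" for w
    proof -
      \<comment> \<open>The increment of \<open>h\<close> by the fixed \<open>w\<close>, averaged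
        over the base point. Near harmonicity at \<open>x\<close> and at \<open>x + w\<close> puts
        it within \<open>2 * \<epsilon>\<close> of \<open>D\<close>, and
        \<open>\<bar>D + p\<bar> \<le> 4\<close> turns this into \<open>8 * \<epsilon>\<close> for
        the squares.\<close>
      define p where "p = (\<integral>v. h (x + v + w) - h (x + v) \<partial>\<nu>)"
      define D where "D = h (x + w) - h x"
      have i1: "integrable \<nu> (\<lambda>v. h (x + v + w))"
        by (rule integrable_bounded_prob[OF prob_space_axioms _ hb]) measurable
      have "p = (\<integral>v. h (x + v + w) \<partial>\<nu>) - (\<integral>v. h (x + v) \<partial>\<nu>)"
        unfolding p_def by (rule Bochner_Integration.integral_diff[OF i1 int_h])
      also have "(\<integral>v. h (x + v + w) \<partial>\<nu>) = (\<integral>v. h (x + w + v) \<partial>\<nu>)"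
        by (simp add: ac_simps)
      finally have "p = (\<integral>v. h (x + w + v) \<partial>\<nu>) - (\<integral>v. h (x + v) \<partial>\<nu>)" .
      then have Dp: "\<bar>D - p\<bar> \<le> 2 * \<epsilon>" using harm[of x] harm[of "x + w"] unfolding D_def by linarith
      have p2: "\<bar>p\<bar> \<le> 2"
        unfolding p_def by (rule abs_integral_prob_le[OF prob_space_axioms _ hb2]) measurable
      have D2: "\<bar>D\<bar> \<le> 2" unfolding D_def by (rule hb2)
      have "D\<^sup>2 - p\<^sup>2 = (D - p) * (D + p)" by (simp add: power2_eq_square algebra_simps)
      also have "\<dots> \<le> \<bar>D - p\<bar> * \<bar>D + p\<bar>" by (metis abs_ge_self abs_mult)
      also have "\<dots> \<le> (2 * \<epsilon>) * 4" using Dp p2 D2 by (intro mult_mono) auto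
      finally have "D\<^sup>2 \<le> p\<^sup>2 + 8 * \<epsilon>" by linarith
      also have "p\<^sup>2 \<le> (\<integral>v. (h (x + v + w) - h (x + v))\<^sup>2 \<partial>\<nu>)"
      proof -
        have i2: "integrable \<nu> (\<lambda>v. (h (x + v + w) - h (x + v))\<^sup>2)"
          by (rule integrable_bounded_prob[OF prob_space_axioms _ sq4]) measurable
        have i3: "integrable \<nu> (\<lambda>v. h (x + v + w) - h (x + v))" using i1 int_h by simp
        \<comment> \<open>Jensen's inequality for the square, obtained as nonnegativity of the
          variance.\<close>
        have "0 \<le> (\<integral>v. ((h (x + v + w) - h (x + v)) - p)\<^sup>2 \<partial>\<nu>)" by simp
        also have "\<dots> = (\<integral>v. (h (x + v + w) - h (x + v))\<^sup>2 - 2 * p * (h (x + v + w) - h (x + v)) + p\<^sup>2 \<partial>\<nu>)"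
          by (intro Bochner_Integration.integral_cong refl) (simp add: power2_eq_square algebra_simps)
        also have "\<dots> = (\<integral>v. (h (x + v + w) - h (x + v))\<^sup>2 \<partial>\<nu>) - 2 * p * p + p\<^sup>2"
          using i2 i3 by (simp add: prob_space p_def[symmetric] del: Bochner_Integration.integral_diff)
            (simp add: prob_space p_def[symmetric])
        finally show ?thesis by (simp add: power2_eq_square)
      qed
      finally show ?thesis by (simp add: D_def)
    qed
    have m2: "(\<lambda>(v, w). (h (x + v + w) - h (x + v))\<^sup>2) \<in> borel_measurable (\<nu> \<Otimes>\<^sub>M \<nu>)"
      by measurable
    have I: "integrable (\<nu> \<Otimes>\<^sub>M \<nu>) (\<lambda>(v, w). (h (x + v + w) - h (x + v))\<^sup>2)"
      by (rule integrable_bounded_prob[OF P.prob_space_axioms m2, where B = 4]) (use sq4 in auto)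
    have "G x \<le> (\<integral>w. (\<integral>v. (h (x + v + w) - h (x + v))\<^sup>2 \<partial>\<nu>) + 8 * \<epsilon> \<partial>\<nu>)"
      unfolding G_def
    proof (rule integral_mono[OF _ _ pw])
      show "integrable \<nu> (\<lambda>w. (h (x + w) - h x)\<^sup>2)"
        by (rule integrable_bounded_prob[OF prob_space_axioms _ sq4]) measurable
      show "integrable \<nu> (\<lambda>w. (\<integral>v. (h (x + v + w) - h (x + v))\<^sup>2 \<partial>\<nu>) + 8 * \<epsilon>)"
        using P.integrable_snd[OF I] by simp
    qed
    also have "\<dots> = (\<integral>w. (\<integral>v. (h (x + v + w) - h (x + v))\<^sup>2 \<partial>\<nu>) \<partial>\<nu>) + 8 * \<epsilon>"
      using P.integrable_snd[OF I] by (simp add: prob_space)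
    also have "(\<integral>w. (\<integral>v. (h (x + v + w) - h (x + v))\<^sup>2 \<partial>\<nu>) \<partial>\<nu>) = (\<integral>v. G (x + v) \<partial>\<nu>)"
      unfolding G_def by (rule P.Fubini_integral[OF I])
    finally show ?thesis .
  qed
  \<comment> \<open>The step from \<open>j\<close> to \<open>j + 1\<close> adds an error
    \<open>(2 + 8 * j) * \<epsilon>\<close>, below the growth
    \<open>(10 + 20 * j) * \<epsilon>\<close> of the bound. The point \<open>x\<close> varies
    because the induction hypothesis is integrated over \<open>x + w\<close>.\<close>
  have ind: "u x + real j * G x \<le> 1 + 10 * (real j)\<^sup>2 * \<epsilon>" for j x
  proof (induction j arbitrary: x)
    case 0 show ?case using hsq[of x] by (simp add: u_def)
  next
    case (Suc j)
    have "u x + real (Suc j) * G x = (u x + G x) + real j * G x" by (simp add: algebra_simps)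
    also have "\<dots> \<le> ((\<integral>w. u (x + w) \<partial>\<nu>) + 2 * \<epsilon>) + real j * ((\<integral>v. G (x + v) \<partial>\<nu>) + 8 * \<epsilon>)"
      by (rule add_mono[OF one mult_left_mono[OF two]]) simp
    also have "\<dots> = (\<integral>w. u (x + w) + real j * G (x + w) \<partial>\<nu>) + (2 + 8 * real j) * \<epsilon>"
      unfolding Bochner_Integration.integral_add[OF int_u integrable_mult_right[OF int_G]]
      by (simp add: algebra_simps)
    also have "(\<integral>w. u (x + w) + real j * G (x + w) \<partial>\<nu>) \<le> 1 + 10 * (real j)\<^sup>2 * \<epsilon>"
      using int_u int_G by (intro integral_le_const Bochner_Integration.integrable_add integrable_mult_right AE_I2 Suc) auto
    also have "1 + 10 * (real j)\<^sup>2 * \<epsilon> + (2 + 8 * real j) * \<epsilon> \<le> 1 + 10 * (real (Suc j))\<^sup>2 * \<epsilon>"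
    proof -
      have "(2 + 8 * real j) * \<epsilon> \<le> (10 + 20 * real j) * \<epsilon>" using \<epsilon> by (intro mult_right_mono) auto
      then show ?thesis by (simp add: power2_eq_square algebra_simps)
    qed
    finally show ?case by simp
  qed
  have "0 \<le> u x" by (simp add: u_def)
  then show ?thesis using ind[of x m] unfolding G_def by linarith
qed

section \<open>Shifts that nearly preserve a measure\<close>

lemma bl_close_shift_iterate:
  fixes \<mu> :: "'a::{real_normed_vector, second_countable_topology} measure"
  assumes \<mu>: "borel_prob \<mu>" and c: "bl_close \<mu> (distr \<mu> borel ((+) w)) \<kappa>"
  shows "bl_close \<mu> (distr \<mu> borel ((+) (real j *\<^sub>R w))) (real j * \<kappa>)"
proof (induction j)
  case 0
  have "integral\<^sup>L (distr \<mu> borel ((+) (real 0 *\<^sub>R w))) F = integral\<^sup>L \<mu> F" if "BL 1 F" for F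
    using borel_probD[OF \<mu>] BL_measurable[OF that]
    by (subst integral_distr) (auto cong: measurable_cong_sets)
  then show ?case unfolding bl_close_def by simp
next
  case (Suc j)
  have sm: "(+) z \<in> measurable \<mu> borel" for z :: 'a
    using borel_probD[OF \<mu>] by (simp cong: measurable_cong_sets)
  have shift: "integral\<^sup>L (distr \<mu> borel ((+) z)) F = (\<integral>y. F (z + y) \<partial>\<mu>)" if "BL 1 F" for F z
    by (rule integral_distr[OF sm]) (use BL_measurable[OF that] in simp)
  show ?case
    unfolding bl_close_def
  proof (intro allI impI)
    fix F :: "'a \<Rightarrow> real" assume F: "BL 1 F"
    have F': "BL 1 (\<lambda>y. F (real j *\<^sub>R w + y))" using F by (rule BL_shift)
    have "\<bar>integral\<^sup>L \<mu> F - (\<integral>y. F (real j *\<^sub>R w + y) \<partial>\<mu>)\<bar> \<le> real j * \<kappa>"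
      using Suc F unfolding bl_close_def shift[OF F, symmetric] by blast
    moreover have "\<bar>(\<integral>y. F (real j *\<^sub>R w + y) \<partial>\<mu>) - (\<integral>y. F (real j *\<^sub>R w + (w + y)) \<partial>\<mu>)\<bar> \<le> \<kappa>"
      using c F' unfolding bl_close_def shift[OF F', symmetric] by blast
    moreover have "(\<integral>y. F (real j *\<^sub>R w + (w + y)) \<partial>\<mu>) = integral\<^sup>L (distr \<mu> borel ((+) (real (Suc j) *\<^sub>R w))) F"
      unfolding shift[OF F] by (simp add: scaleR_left_distrib ac_simps)
    ultimately show "\<bar>integral\<^sup>L \<mu> F - integral\<^sup>L (distr \<mu> borel ((+) (real (Suc j) *\<^sub>R w))) F\<bar> \<le> real (Suc j) * \<kappa>"
      by (simp add: algebra_simps)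
  qed
qed

text \<open>A shift longer than \<open>\<eta>\<close>, repeated \<open>J\<close> times at total
  error 1/4, would put mass above 1/2 into a ball disjoint from one that carries more than
  3/4.\<close>

lemma small_if_shift_close:
  fixes \<mu> :: "'a::{real_normed_vector, second_countable_topology} measure"
  assumes \<mu>: "borel_prob \<mu>" and \<eta>: "0 < \<eta>"
  shows "\<exists>\<kappa>>0. \<forall>w. bl_close \<mu> (distr \<mu> borel ((+) w)) \<kappa> \<longrightarrow> norm w \<le> \<eta>"
proof -
  interpret prob_space \<mu> using borel_probD[OF \<mu>] by auto
  obtain R where R: "0 < R" "3/4 < measure \<mu> (cball 0 R)"
    using measure_cball_tendsto_1[OF \<mu>, of "3/4" 0] by auto
  \<comment> \<open>\<open>2 * R + 1\<close> is the sum of the radii \<open>R\<close> and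
    \<open>R + 1\<close> of the two balls to be separated; the extra 1 is the collar in
    \<open>bl_close_cball\<close>.\<close>
  obtain J :: nat where J: "(2 * R + 1) / \<eta> < real J" using reals_Archimedean2 by blast
  have J0: "0 < real J" using J R \<eta> by (smt (verit) divide_pos_pos)
  define \<kappa> where "\<kappa> = 1 / (4 * real J)"
  have "norm w \<le> \<eta>" if c: "bl_close \<mu> (distr \<mu> borel ((+) w)) \<kappa>" for w
  proof (rule ccontr)
    assume "\<not> ?thesis"
    then have w: "\<eta> < norm w" by simp
    let ?z = "real J *\<^sub>R w"
    have "2 * R + 1 < real J * \<eta>" using J \<eta> by (simp add: field_simps)
    also have "\<dots> \<le> norm ?z" using w J0 by simp
    finally have z: "2 * R + 1 < norm ?z" .
    have sm: "(+) ?z \<in> measurable \<mu> borel"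
      using borel_probD[OF \<mu>] by (simp cong: measurable_cong_sets)
    have "bl_close \<mu> (distr \<mu> borel ((+) ?z)) (1/4)"
      using bl_close_shift_iterate[OF \<mu> c, of J] J0 by (simp add: \<kappa>_def)
    from bl_close_cball[OF \<mu> borel_prob_distr[OF prob_space_axioms sm] this, of 1 0 R]
    have "1/2 < measure (distr \<mu> borel ((+) ?z)) (cball 0 (R + 1))" using R by simp
    also have "\<dots> = measure \<mu> ((+) ?z -` cball 0 (R + 1) \<inter> space \<mu>)"
      by (rule measure_distr[OF sm]) simp
    also have "(+) ?z -` cball 0 (R + 1) \<inter> space \<mu> = cball (- ?z) (R + 1)"
      using borel_probD[OF \<mu>] by (auto simp: dist_norm norm_minus_commute)
    finally have 1: "1/2 < measure \<mu> (cball (- ?z) (R + 1))" .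
    have dis: "cball 0 R \<inter> cball (- ?z) (R + 1) = {}"
    proof (rule ccontr)
      assume "\<not> ?thesis"
      then obtain y where "norm y \<le> R" "dist (- ?z) y \<le> R + 1" by (auto simp: dist_norm)
      then show False using z dist_triangle[of "- ?z" 0 y] by (simp add: dist_norm)
    qed
    have "measure \<mu> (cball 0 R) + measure \<mu> (cball (- ?z) (R + 1)) =
        measure \<mu> (cball 0 R \<union> cball (- ?z) (R + 1))"
      by (rule finite_measure_Union[symmetric]) (use dis borel_probD[OF \<mu>] in auto)
    also have "\<dots> \<le> 1" by (rule prob_le_1)
    finally show False using R 1 by linarith
  qed
  then show ?thesis using J0 by (intro exI[of _ \<kappa>]) (auto simp: \<kappa>_def)
qed

text \<open>If \<open>\<mu>\<close> is nearly equal to its convolution with \<open>\<nu>\<close>, then \<open>\<mu>\<close> is nearly invariant under most of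
  the shifts drawn from \<open>\<nu>\<close>; iterating a fixed shift moves the mass of \<open>\<mu>\<close> away, so these shifts are
  small.\<close>

lemma near_idempotent_concentrates:
  fixes \<mu> :: "'a::{real_normed_vector, second_countable_topology} measure"
  assumes \<mu>: "borel_prob \<mu>" and \<eta>: "0 < \<eta>"
  shows "\<exists>\<epsilon>>0. \<forall>\<nu>. borel_prob \<nu> \<longrightarrow> bl_close \<mu> (conv 1 \<mu> \<nu>) \<epsilon> \<longrightarrow> measure \<nu> {w. \<eta> < norm w} \<le> \<eta>"
proof -
  interpret \<mu>: prob_space \<mu> using borel_probD[OF \<mu>] by auto
  obtain \<kappa> where \<kappa>: "0 < \<kappa>" "\<And>w. bl_close \<mu> (distr \<mu> borel ((+) w)) \<kappa> \<Longrightarrow> norm w \<le> \<eta>"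
    using small_if_shift_close[OF \<mu> \<eta>] by blast
  obtain N :: nat and \<phi> :: "nat \<Rightarrow> 'a \<Rightarrow> real" and L \<zeta> where L: "1 \<le> L" and \<phi>: "\<And>i. BL L (\<phi> i)" and \<zeta>: "0 < \<zeta>"
    and test: "\<And>\<nu>. borel_prob \<nu> \<Longrightarrow> \<forall>i<N. \<bar>integral\<^sup>L \<mu> (\<phi> i) - integral\<^sup>L \<nu> (\<phi> i)\<bar> \<le> \<zeta> \<Longrightarrow> bl_close \<mu> \<nu> \<kappa>"
    using bl_close_finite_tests[OF \<mu> \<kappa>(1)] by blast
  have sm: "(+) z \<in> measurable \<mu> borel" for z :: 'a
    using borel_probD[OF \<mu>] by (simp cong: measurable_cong_sets)
  \<comment> \<open>\<open>h i z\<close> is the integral of the test \<open>\<phi> i\<close> against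
    \<open>\<mu>\<close> shifted by \<open>z\<close>, and \<open>h i 0\<close> the one against
    \<open>\<mu>\<close>. Near idempotence makes \<open>h i\<close> nearly harmonic for
    \<open>\<nu>\<close>.\<close>
  define h where "h i x = (\<integral>y. \<phi> i (x + y) \<partial>\<mu>)" for i x
  have h_alt: "h i = (\<lambda>x. \<integral>y. \<phi> i (1 *\<^sub>R x + y) \<partial>\<mu>)" for i by (simp add: h_def fun_eq_iff)
  have h: "BL L (h i)" for i
    using BL_averaged[OF \<mu> \<phi>[of i], of 1] by (simp add: h_alt)
  have shift: "integral\<^sup>L (distr \<mu> borel ((+) z)) (\<phi> i) = h i z" for z i
    unfolding h_def by (rule integral_distr[OF sm]) (use BL_measurable[OF \<phi>] in simp)
  \<comment> \<open>Makes \<open>N\<close> Markov bounds of size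
    \<open>2 / (m * \<zeta>\<^sup>2)\<close> add up to at most \<open>\<eta>\<close>.\<close>
  obtain m :: nat where m: "2 * real N / (\<eta> * \<zeta>\<^sup>2) < real m" using reals_Archimedean2 by blast
  have m0: "0 < real m" using m \<eta> by (smt (verit) divide_nonneg_nonneg of_nat_0_le_iff zero_le_mult_iff zero_le_power2)
  \<comment> \<open>Chosen so that the right-hand side in \<open>near_harmonic_increments\<close>,
    applied with error \<open>L * \<epsilon>\<close>, is exactly 2.\<close>
  define \<epsilon> where "\<epsilon> = 1 / (10 * (real m)\<^sup>2 * L)"
  have \<epsilon>: "0 < \<epsilon>" using m0 L by (simp add: \<epsilon>_def)
  have "measure \<nu> {w. \<eta> < norm w} \<le> \<eta>" if \<nu>: "borel_prob \<nu>" and c: "bl_close \<mu> (conv 1 \<mu> \<nu>) \<epsilon>" for \<nu>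
  proof -
    interpret \<nu>: prob_space \<nu> using borel_probD[OF \<nu>] by auto
    note [measurable_cong] = borel_probD(2)[OF \<nu>]
    have [measurable]: "h i \<in> borel_measurable borel" for i using BL_measurable[OF h] by simp
    have harm: "\<bar>h i x - (\<integral>w. h i (x + w) \<partial>\<nu>)\<bar> \<le> L * \<epsilon>" for i x
    proof -
      have B: "BL L (\<lambda>y. \<phi> i (x + y))" using \<phi>[of i] by (rule BL_shift)
      have "integral\<^sup>L (conv 1 \<mu> \<nu>) (\<lambda>y. \<phi> i (x + y)) = (\<integral>w. h i (x + w) \<partial>\<nu>)"
        unfolding integral_conv_BL(2)[OF \<mu> \<nu> B] h_def by (simp add: ac_simps)
      then show ?thesis using bl_close_BL[OF c B L] by (simp add: h_def)
    qed
    define B where "B i = {w. \<zeta>\<^sup>2 \<le> (h i w - h i 0)\<^sup>2}" for i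
    have sp: "space \<nu> = UNIV" by (rule borel_probD(3)[OF \<nu>])
    have Bs: "B i \<in> sets \<nu>" for i
    proof -
      have "{w \<in> space \<nu>. \<zeta>\<^sup>2 \<le> (h i w - h i 0)\<^sup>2} \<in> sets \<nu>" by measurable
      then show ?thesis by (simp add: B_def sp)
    qed
    have mB: "measure \<nu> (B i) \<le> 2 / (real m * \<zeta>\<^sup>2)" for i
    proof -
      have hb: "\<bar>(h i w - h i 0)\<^sup>2\<bar> \<le> 4" for w
        using power_mono[of "\<bar>h i w - h i 0\<bar>" 2 2] BL_abs[OF h, of i w] BL_abs[OF h, of i 0] by simp
      have int: "integrable \<nu> (\<lambda>w. (h i w - h i 0)\<^sup>2)"
        by (rule integrable_bounded_prob[OF \<nu>.prob_space_axioms _ hb]) measurable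
      have "real m * (\<integral>w. (h i (0 + w) - h i 0)\<^sup>2 \<partial>\<nu>) \<le> 1 + 10 * (real m)\<^sup>2 * (L * \<epsilon>)"
        by (rule near_harmonic_increments[OF \<nu> h harm])
      also have "\<dots> = 2" using m0 L by (simp add: \<epsilon>_def)
      finally have G: "(\<integral>w. (h i w - h i 0)\<^sup>2 \<partial>\<nu>) \<le> 2 / real m" using m0 by (simp add: field_simps)
      have "measure \<nu> (B i) \<le> (\<integral>w. (h i w - h i 0)\<^sup>2 \<partial>\<nu>) / \<zeta>\<^sup>2"
        using integral_Markov_inequality_measure[OF int, of "{}" "\<zeta>\<^sup>2"] \<zeta> Bs by (simp add: B_def sp)
      also have "\<dots> \<le> (2 / real m) / \<zeta>\<^sup>2" using G by (rule divide_right_mono) simp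
      finally show ?thesis by simp
    qed
    \<comment> \<open>A shift longer than \<open>\<eta>\<close> does not keep \<open>\<mu>\<close>
      within \<open>\<kappa>\<close>, so one of the finitely many tests detects it.\<close>
    have "{w. \<eta> < norm w} \<subseteq> (\<Union>i<N. B i)"
    proof
      fix w :: 'a assume w: "w \<in> {w. \<eta> < norm w}"
      then have "\<not> bl_close \<mu> (distr \<mu> borel ((+) w)) \<kappa>" using \<kappa>(2)[of w] by auto
      then obtain i where i: "i < N" "\<zeta> < \<bar>integral\<^sup>L \<mu> (\<phi> i) - h i w\<bar>"
        using test[OF borel_prob_distr[OF \<mu>.prob_space_axioms sm], of w] unfolding shift by (meson not_le)
      have "integral\<^sup>L \<mu> (\<phi> i) = h i 0" by (simp add: h_def)
      then have "\<zeta> \<le> \<bar>h i w - h i 0\<bar>" using i by (simp add: abs_minus_commute)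
      then have "\<zeta>\<^sup>2 \<le> (h i w - h i 0)\<^sup>2" using \<zeta> power_mono[of \<zeta> "\<bar>h i w - h i 0\<bar>" 2] by simp
      then show "w \<in> (\<Union>i<N. B i)" using i by (auto simp: B_def)
    qed
    then have "measure \<nu> {w. \<eta> < norm w} \<le> measure \<nu> (\<Union>i<N. B i)"
      using Bs by (intro \<nu>.finite_measure_mono) auto
    also have "\<dots> \<le> (\<Sum>i<N. measure \<nu> (B i))"
      using Bs by (intro \<nu>.finite_measure_subadditive_finite) auto
    also have "\<dots> \<le> (\<Sum>i<N. 2 / (real m * \<zeta>\<^sup>2))" by (intro sum_mono mB)
    also have "\<dots> \<le> \<eta>" using m m0 \<eta> \<zeta> by (simp add: field_simps)
    finally show ?thesis .
  qed
  then show ?thesis using \<epsilon> by blast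
qed

section \<open>Selfdecomposability from approximate decompositions\<close>

text \<open>The decompositions start at \<open>k = 2\<close> because \<open>k = 1\<close> would mean
  the scale 0; \<open>\<nu> 0\<close> and \<open>\<nu> 1\<close> may be any Borel probability
  measures.\<close>

locale approx_decomposition =
  fixes \<mu> :: "'a::{banach, second_countable_topology} measure" and \<nu> :: "nat \<Rightarrow> 'a measure"
  assumes \<mu>: "borel_prob \<mu>" and \<nu>: "\<And>k. borel_prob (\<nu> k)"
    and decomp: "\<And>k. 2 \<le> k \<Longrightarrow> bl_close \<mu> (conv (real (k - 1) / real k) \<mu> (\<nu> k)) (1 / 2 ^ k)"
begin

definition "P = PiM UNIV \<nu>"
definition \<xi> :: "nat \<Rightarrow> (nat \<Rightarrow> 'a) \<Rightarrow> 'a" where "\<xi> k \<omega> = real k *\<^sub>R \<omega> k"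
definition W :: "nat \<Rightarrow> (nat \<Rightarrow> 'a) \<Rightarrow> 'a" where "W n \<omega> = (1 / real n) *\<^sub>R (\<Sum>k=1..n. \<xi> k \<omega>)"
definition "law n = distr P borel (W n)"

sublocale P: prob_space P
  unfolding P_def using borel_probD[OF \<nu>] by (intro prob_space_PiM) auto

lemma sets_P: "sets P = sets (PiM UNIV (\<lambda>_. borel))"
  unfolding P_def by (intro sets_PiM_cong) (auto simp: borel_probD[OF \<nu>])

lemma component_measurable: "(\<lambda>\<omega>. \<omega> k) \<in> borel_measurable P"
  unfolding measurable_cong_sets[OF sets_P refl] by measurable

lemma distr_component: "distr P borel (\<lambda>\<omega>. \<omega> k) = \<nu> k"
proof -
  have "distr P borel (\<lambda>\<omega>. \<omega> k) = distr P (\<nu> k) (\<lambda>\<omega>. \<omega> k)"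
    by (intro distr_cong) (auto simp: borel_probD[OF \<nu>])
  also have "\<dots> = \<nu> k"
    unfolding P_def using borel_probD[OF \<nu>] by (intro distr_PiM_component) auto
  finally show ?thesis .
qed

lemma indep_components: "P.indep_vars (\<lambda>_. borel) (\<lambda>k \<omega>. \<omega> k) UNIV"
proof -
  have "distr P (PiM UNIV (\<lambda>_. borel)) (\<lambda>\<omega>. \<lambda>i\<in>UNIV. \<omega> i) = P"
    by (simp add: restrict_UNIV distr_id2 sets_P)
  also have "P = PiM UNIV (\<lambda>i. distr P borel (\<lambda>\<omega>. \<omega> i))"
    unfolding distr_component by (rule P_def)
  finally show ?thesis
    by (subst P.indep_vars_iff_distr_eq_PiM') (auto simp: component_measurable)
qed

lemma indep_\<xi>: "P.indep_vars (\<lambda>_. borel) \<xi> {1..}"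
  unfolding \<xi>_def
  by (rule P.indep_vars_compose2[OF P.indep_vars_subset[OF indep_components]]) auto

lemma \<xi>_measurable [measurable]: "\<xi> k \<in> borel_measurable P"
  unfolding \<xi>_def using component_measurable[of k] by measurable

lemma W_measurable [measurable]: "W n \<in> borel_measurable P"
  unfolding W_def by measurable

lemma borel_prob_law: "borel_prob (law n)"
  unfolding law_def by (rule borel_prob_distr[OF P.prob_space_axioms W_measurable])

text \<open>The factor \<open>k\<close> in \<open>\<xi> k\<close> cancels the new normalisation, so
  the coordinate \<open>\<omega> (Suc n)\<close> enters unscaled and is independent of the rescaled
  old average.\<close>

lemma law_Suc:
  assumes "1 \<le> n"
  shows "law (Suc n) = conv (real n / real (Suc n)) (law n) (\<nu> (Suc n))"
proof -
  let ?c = "real n / real (Suc n)"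
  have "P.indep_var
      borel ((\<lambda>f. (1 / real n) *\<^sub>R (\<Sum>k=1..n. real k *\<^sub>R f k)) \<circ> (\<lambda>\<omega>. restrict (\<lambda>i. \<omega> i) {1..n}))
      borel ((\<lambda>f. f (Suc n)) \<circ> (\<lambda>\<omega>. restrict (\<lambda>i. \<omega> i) {Suc n}))"
    by (intro P.indep_var_compose[OF P.indep_var_restrict[OF indep_components]]) auto
  also have "((\<lambda>f. (1 / real n) *\<^sub>R (\<Sum>k=1..n. real k *\<^sub>R f k)) \<circ> (\<lambda>\<omega>. restrict (\<lambda>i. \<omega> i) {1..n})) = W n"
    by (auto simp: fun_eq_iff W_def \<xi>_def intro!: sum.cong)
  also have "((\<lambda>f. f (Suc n)) \<circ> (\<lambda>\<omega>. restrict (\<lambda>i. \<omega> i) {Suc n})) = (\<lambda>\<omega>. \<omega> (Suc n))"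
    by (auto simp: fun_eq_iff)
  finally have joint: "distr P (borel \<Otimes>\<^sub>M borel) (\<lambda>\<omega>. (W n \<omega>, \<omega> (Suc n))) = law n \<Otimes>\<^sub>M \<nu> (Suc n)"
    unfolding P.indep_var_distribution_eq law_def distr_component by simp
  have [measurable]: "(\<lambda>\<omega>. \<omega> (Suc n)) \<in> borel_measurable P" by (rule component_measurable)
  have "W (Suc n) \<omega> = ?c *\<^sub>R W n \<omega> + \<omega> (Suc n)" for \<omega>
    using assms by (simp add: W_def \<xi>_def scaleR_add_right add.commute del: of_nat_Suc)
  then have "law (Suc n) = distr P borel ((\<lambda>(x, v). ?c *\<^sub>R x + v) \<circ> (\<lambda>\<omega>. (W n \<omega>, \<omega> (Suc n))))"
    unfolding law_def by (intro distr_cong) auto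
  also have "\<dots> = distr (distr P (borel \<Otimes>\<^sub>M borel) (\<lambda>\<omega>. (W n \<omega>, \<omega> (Suc n)))) borel (\<lambda>(x, v). ?c *\<^sub>R x + v)"
    by (rule distr_distr[symmetric]) measurable
  finally show ?thesis unfolding joint conv_def .
qed

text \<open>Each step of the recursion \<open>law_Suc\<close> contracts the test function by \<open>n / (n + 1)\<close> and adds an
  error \<open>1 / 2 ^ (n + 1)\<close>; the initial law is forgotten because constants integrate alike.\<close>

lemma law_close:
  assumes K: "1 \<le> K" and "K \<le> N"
  shows "0 \<le> L \<Longrightarrow> L \<le> 1 \<Longrightarrow> BL L F \<Longrightarrow>
    \<bar>integral\<^sup>L (law N) F - integral\<^sup>L \<mu> F\<bar> \<le>
      trunc_moment (law K) (L * (real K / real N)) + trunc_moment \<mu> (L * (real K / real N)) + (1 / 2 ^ K - 1 / 2 ^ N)"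
  using assms(2)
proof (induction N arbitrary: L F rule: dec_induct)
  case base
  \<comment> \<open>Comparing both integrals with the constant \<open>F 0\<close> leaves only the
    two truncated moments.\<close>
  have "\<bar>integral\<^sup>L \<rho> F - F 0\<bar> \<le> trunc_moment \<rho> L" if \<rho>: "borel_prob \<rho>" for \<rho>
  proof -
    interpret \<rho>: prob_space \<rho> using borel_probD[OF \<rho>] by auto
    have "\<bar>integral\<^sup>L \<rho> F - (\<integral>x. F 0 \<partial>\<rho>)\<bar> \<le> trunc_moment \<rho> L"
      unfolding trunc_moment_def
      by (rule abs_integral_diff_le[OF BL_integrable[OF base(3) \<rho>] \<rho>.integrable_const integrable_trunc[OF \<rho> base(1)]])
        (rule BL_diff_trunc[OF base(3)], simp)
    then show ?thesis by (simp add: \<rho>.prob_space)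
  qed
  from this[OF \<mu>] this[OF borel_prob_law[of K]] show ?case using K by simp
next
  case (step n)
  let ?c = "real n / real (Suc n)"
  have n: "1 \<le> n" using K step by simp
  \<comment> \<open>The last step of the recursion is absorbed into the test function, so that the
    induction hypothesis applies with the smaller constant \<open>L * ?c\<close>.\<close>
  define F' where "F' x = (\<integral>v. F (?c *\<^sub>R x + v) \<partial>\<nu> (Suc n))" for x
  have F': "BL (L * ?c) F'"
    using BL_averaged[OF \<nu>[of "Suc n"] step.prems(3), of ?c] by (simp add: F'_def[abs_def])
  have c: "0 \<le> ?c" "?c \<le> 1" by auto
  have "\<bar>integral\<^sup>L (law n) F' - integral\<^sup>L \<mu> F'\<bar> \<le>
      trunc_moment (law K) (L * ?c * (real K / real n)) + trunc_moment \<mu> (L * ?c * (real K / real n)) + (1 / 2 ^ K - 1 / 2 ^ n)"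
    using step.prems c by (intro step.IH F' mult_nonneg_nonneg mult_le_one)
  also have "L * ?c * (real K / real n) = L * (real K / real (Suc n))"
    using n by (simp del: of_nat_Suc)
  also have "integral\<^sup>L (law n) F' = integral\<^sup>L (law (Suc n)) F"
    unfolding law_Suc[OF n] F'_def by (rule integral_conv_BL(1)[OF borel_prob_law \<nu> step.prems(3), symmetric])
  also have "integral\<^sup>L \<mu> F' = integral\<^sup>L (conv ?c \<mu> (\<nu> (Suc n))) F"
    unfolding F'_def by (rule integral_conv_BL(1)[OF \<mu> \<nu> step.prems(3), symmetric])
  finally have 1: "\<bar>integral\<^sup>L (law (Suc n)) F - integral\<^sup>L (conv ?c \<mu> (\<nu> (Suc n))) F\<bar> \<le>
      trunc_moment (law K) (L * (real K / real (Suc n))) + trunc_moment \<mu> (L * (real K / real (Suc n))) + (1 / 2 ^ K - 1 / 2 ^ n)" .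
  \<comment> \<open>This new error equals \<open>1 / 2 ^ n - 1 / 2 ^ Suc n\<close>, so the bound
    telescopes.\<close>
  have "\<bar>integral\<^sup>L \<mu> F - integral\<^sup>L (conv ?c \<mu> (\<nu> (Suc n))) F\<bar> \<le> 1 / 2 ^ Suc n"
    using decomp[of "Suc n"] n BL_mono[OF step.prems(3,2)] unfolding bl_close_def by simp
  with 1 show ?case by simp
qed

text \<open>First \<open>K\<close> makes the tail of the errors small; with \<open>K\<close> fixed,
  \<open>K / N\<close> tends to 0 and with it both truncated moments.\<close>

lemma law_weak_conv: "weak_conv_borel law \<mu>"
proof (rule weak_conv_borel_if_BL[OF \<mu> borel_prob_law], rule tendstoI)
  fix F :: "'a \<Rightarrow> real" and \<epsilon> :: real assume F: "BL 1 F" and \<epsilon>: "0 < \<epsilon>"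
  obtain K0 :: nat where "(1/2) ^ K0 < \<epsilon> / 3" using real_arch_pow_inv[of "\<epsilon>/3" "1/2"] \<epsilon> by auto
  then have "(1/2) ^ Suc K0 < \<epsilon> / 3" by (smt (verit) power_Suc_le_self power_le_one_iff zero_le_power half_gt_zero_iff field_sum_of_halves power_decreasing le_add2 plus_1_eq_Suc)
  then obtain K where K: "1 \<le> K" "1 / 2 ^ K < \<epsilon> / 3"
    by (metis One_nat_def Suc_le_mono le0 power_one_over)
  have t: "(\<lambda>N. real K / real N) \<longlonglongrightarrow> 0" by real_asymp
  have tm: "eventually (\<lambda>N. trunc_moment \<rho> (real K / real N) < \<epsilon> / 3) sequentially" if "borel_prob \<rho>" for \<rho> :: "'a measure"
    using order_tendstoD(2)[OF trunc_moment_tendsto_0[OF that t], of "\<epsilon>/3"] \<epsilon> by simp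
  from tm[OF \<mu>] tm[OF borel_prob_law[of K]] eventually_ge_at_top[of K]
  show "eventually (\<lambda>N. dist (integral\<^sup>L (law N) F) (integral\<^sup>L \<mu> F) < \<epsilon>) sequentially"
  proof eventually_elim
    case (elim N)
    have "0 < 1 / (2::real) ^ N" by simp
    moreover have "\<bar>integral\<^sup>L (law N) F - integral\<^sup>L \<mu> F\<bar> \<le>
        trunc_moment (law K) (real K / real N) + trunc_moment \<mu> (real K / real N) + (1 / 2 ^ K - 1 / 2 ^ N)"
      using law_close[OF K(1) elim(3), of 1 F] F by simp
    ultimately show ?case unfolding dist_real_def using elim K(2) by linarith
  qed
qed

text \<open>As \<open>(k - 1) / k\<close> tends to 1, the scale can be replaced by 1 at vanishing
  cost, so \<open>\<mu>\<close> is nearly equal to its convolution with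
  \<open>\<nu> k\<close>.\<close>

lemma \<nu>_concentrates:
  assumes \<eta>: "0 < \<eta>" and \<delta>: "0 < \<delta>"
  shows "eventually (\<lambda>k. measure (\<nu> k) {x. \<eta> < norm x} \<le> \<delta>) sequentially"
proof -
  \<comment> \<open>\<open>near_idempotent_concentrates\<close> uses one number both as radius and
    as mass bound, hence the minimum.\<close>
  obtain \<epsilon> where \<epsilon>: "0 < \<epsilon>"
    "\<And>\<rho>. borel_prob \<rho> \<Longrightarrow> bl_close \<mu> (conv 1 \<mu> \<rho>) \<epsilon> \<Longrightarrow> measure \<rho> {w. min \<eta> \<delta> < norm w} \<le> min \<eta> \<delta>"
    using near_idempotent_concentrates[OF \<mu>, of "min \<eta> \<delta>"] \<eta> \<delta> by auto
  have "(\<lambda>k. trunc_moment \<mu> \<bar>real (k - 1) / real k - 1\<bar>) \<longlonglongrightarrow> 0"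
  proof (rule trunc_moment_tendsto_0[OF \<mu>])
    have "(\<lambda>k. \<bar>real (k - 1) / real k - 1\<bar>) \<longlonglongrightarrow> 0 \<longleftrightarrow> (\<lambda>k. 1 / real k) \<longlonglongrightarrow> 0"
      by (intro tendsto_cong eventually_mono[OF eventually_ge_at_top[of 1]]) (auto simp: field_simps of_nat_diff)
    moreover have "(\<lambda>k. 1 / real k) \<longlonglongrightarrow> 0" by real_asymp
    ultimately show "(\<lambda>k. \<bar>real (k - 1) / real k - 1\<bar>) \<longlonglongrightarrow> 0" by simp
  qed simp
  moreover have "(\<lambda>k. 1 / (2::real) ^ k) \<longlonglongrightarrow> 0" by real_asymp
  ultimately have "(\<lambda>k. 1 / 2 ^ k + trunc_moment \<mu> \<bar>real (k - 1) / real k - 1\<bar>) \<longlonglongrightarrow> 0 + 0"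
    by (intro tendsto_add)
  then have "eventually (\<lambda>k. 1 / 2 ^ k + trunc_moment \<mu> \<bar>real (k - 1) / real k - 1\<bar> < \<epsilon>) sequentially"
    using \<epsilon>(1) by (intro order_tendstoD(2)) auto
  with eventually_ge_at_top[of 2] show ?thesis
  proof eventually_elim
    case (elim k)
    interpret \<nu>: prob_space "\<nu> k" using borel_probD[OF \<nu>] by auto
    have "bl_close \<mu> (conv 1 \<mu> (\<nu> k)) \<epsilon>"
      using bl_close_mono[OF bl_close_trans[OF decomp bl_close_conv_scale[OF \<mu> \<nu>]]] elim by simp
    then have "measure (\<nu> k) {w. min \<eta> \<delta> < norm w} \<le> min \<eta> \<delta>" by (rule \<epsilon>(2)[OF \<nu>])
    moreover have "measure (\<nu> k) {x. \<eta> < norm x} \<le> measure (\<nu> k) {w. min \<eta> \<delta> < norm w}"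
    proof (rule \<nu>.finite_measure_mono)
      have "open {w::'a. min \<eta> \<delta> < norm w}" by (intro open_Collect_less continuous_intros)
      then show "{w. min \<eta> \<delta> < norm w} \<in> sets (\<nu> k)" using borel_probD(2)[OF \<nu>] by simp
    qed auto
    ultimately show ?case by simp
  qed
qed

text \<open>The variable \<open>\<xi> k / n\<close> is \<open>k / n\<close> times a variable with
  law \<open>\<nu> k\<close>. For late \<open>k\<close> the concentration of \<open>\<nu> k\<close>
  suffices, since \<open>k \<le> n\<close>; for the finitely many early \<open>k\<close> the factor
  \<open>k / n\<close> tends to 0.\<close>

lemma infinitesimal_\<xi>: "infinitesimal_array P (\<lambda>n. 1 / real n) \<xi>"
  unfolding infinitesimal_array_def
proof (intro allI impI, rule tendstoI)
  fix \<epsilon> \<delta>' :: real assume \<epsilon>: "0 < \<epsilon>" and "0 < \<delta>'"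
  define \<delta> where "\<delta> = \<delta>' / 2"
  have \<delta>: "0 < \<delta>" using \<open>0 < \<delta>'\<close> by (simp add: \<delta>_def)
  define p where "p n k = measure P {\<omega> \<in> space P. 1 / real n * norm (\<xi> k \<omega>) > \<epsilon>}" for n k
  have sP: "space P = UNIV" by (simp add: P_def space_PiM borel_probD[OF \<nu>])
  have op: "open {x::'a. s < norm x}" for s by (intro open_Collect_less continuous_intros)
  \<comment> \<open>The radius \<open>s\<close> is free: late indices use
    \<open>s = \<epsilon>\<close>, early ones a large radius \<open>R\<close>.\<close>
  have p_eq: "p n k \<le> measure (\<nu> k) {x. s < norm x}" if "1 \<le> n" "1 \<le> k" "real k * s \<le> real n * \<epsilon>" for n k s
  proof -
    have "measure (\<nu> k) {x. s < norm x} = measure P ((\<lambda>\<omega>. \<omega> k) -` {x. s < norm x} \<inter> space P)"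
      unfolding distr_component[of k, symmetric] by (rule measure_distr[OF component_measurable]) (simp add: op)
    moreover have "p n k \<le> \<dots>"
      unfolding p_def
    proof (rule P.finite_measure_mono)
      show "{\<omega> \<in> space P. 1 / real n * norm (\<xi> k \<omega>) > \<epsilon>} \<subseteq> (\<lambda>\<omega>. \<omega> k) -` {x. s < norm x} \<inter> space P"
      proof
        fix \<omega> assume "\<omega> \<in> {\<omega> \<in> space P. 1 / real n * norm (\<xi> k \<omega>) > \<epsilon>}"
        then have "real n * \<epsilon> < real k * norm (\<omega> k)" using that(1) by (simp add: \<xi>_def field_simps)
        then have "real k * s < real k * norm (\<omega> k)" using that(3) by linarith
        then show "\<omega> \<in> (\<lambda>\<omega>. \<omega> k) -` {x. s < norm x} \<inter> space P" using that(2) by (simp add: sP)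
      qed
      show "(\<lambda>\<omega>. \<omega> k) -` {x. s < norm x} \<inter> space P \<in> sets P"
        by (rule measurable_sets[OF component_measurable]) (simp add: op)
    qed
    ultimately show ?thesis by simp
  qed
  obtain K where K: "\<And>k. K \<le> k \<Longrightarrow> measure (\<nu> k) {x. \<epsilon> < norm x} \<le> \<delta>"
    using \<nu>_concentrates[OF \<epsilon> \<delta>] by (auto simp: eventually_sequentially)
  have "eventually (\<lambda>n. \<forall>k\<in>{1..<K}. p n k \<le> \<delta>) sequentially"
  proof (rule eventually_ball_finite)
    show "\<forall>k\<in>{1..<K}. eventually (\<lambda>n. p n k \<le> \<delta>) sequentially"
    proof
      fix k assume k: "k \<in> {1..<K}"
      interpret \<nu>: prob_space "\<nu> k" using borel_probD[OF \<nu>] by auto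
      obtain R where R: "0 < R" "1 - \<delta> < measure (\<nu> k) (cball 0 R)"
        using measure_cball_tendsto_1[OF \<nu>, of "1 - \<delta>" k 0] \<delta> by auto
      have "{x. R < norm x} = space (\<nu> k) - cball 0 R" using borel_probD(3)[OF \<nu>] by auto
      then have "measure (\<nu> k) {x. R < norm x} = 1 - measure (\<nu> k) (cball 0 R)"
        using \<nu>.prob_compl[of "cball 0 R"] borel_probD(2)[OF \<nu>] by simp
      then have small: "measure (\<nu> k) {x. R < norm x} \<le> \<delta>" using R by simp
      have "eventually (\<lambda>n. real k * R / \<epsilon> \<le> real n) sequentially"
        using filterlim_real_sequentially by (auto simp: filterlim_at_top)
      with eventually_ge_at_top[of 1] show "eventually (\<lambda>n. p n k \<le> \<delta>) sequentially"
      proof eventually_elim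
        case (elim n)
        then have "p n k \<le> measure (\<nu> k) {x. R < norm x}" using k \<epsilon> by (intro p_eq) (auto simp: field_simps)
        then show ?case using small by simp
      qed
    qed
  qed simp
  with eventually_ge_at_top[of 1]
  show "eventually (\<lambda>n. dist (MAX k\<in>{1..n}. measure P {\<omega> \<in> space P. 1 / real n * norm (\<xi> k \<omega>) > \<epsilon>}) 0 < \<delta>') sequentially"
    unfolding p_def[symmetric]
  proof eventually_elim
    case (elim n)
    have "p n k \<le> \<delta>" if "k \<in> {1..n}" for k
    proof (cases "k < K")
      case True then show ?thesis using elim that by auto
    next
      case False
      have "p n k \<le> measure (\<nu> k) {x. \<epsilon> < norm x}" using that \<epsilon> by (intro p_eq) auto
      then show ?thesis using K[of k] False by simp
    qed
    then have "(MAX k\<in>{1..n}. p n k) \<le> \<delta>" using elim by (subst Max_le_iff) auto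
    moreover have "0 \<le> (MAX k\<in>{1..n}. p n k)"
      using elim by (subst Max_ge_iff) (auto simp: p_def intro!: bexI[of _ 1])
    ultimately show ?case using \<delta> by (simp add: \<delta>_def)
  qed
qed

lemma selfdecomposable: "selfdecomposable \<mu>"
proof (rule selfdecomposableI[OF \<mu> P.prob_space_axioms indep_\<xi> _ infinitesimal_\<xi>])
  show "weak_conv_borel (\<lambda>n. distr P borel (\<lambda>\<omega>. (1 / real n) *\<^sub>R (\<Sum>k=1..n. \<xi> k \<omega>) + 0)) \<mu>"
    using law_weak_conv by (simp add: law_def[abs_def] W_def[abs_def])
qed simp

end

lemma selfdecomposable_if_approx_decomposable:
  fixes \<mu> :: "'a::{banach, second_countable_topology} measure"
  assumes \<mu>: "borel_prob \<mu>"
    and decomp: "\<And>c \<epsilon>. 0 < c \<Longrightarrow> c < 1 \<Longrightarrow> 0 < \<epsilon> \<Longrightarrow> \<exists>\<nu>. borel_prob \<nu> \<and> bl_close \<mu> (conv c \<mu> \<nu>) \<epsilon>"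
  shows "selfdecomposable \<mu>"
proof -
  \<comment> \<open>For \<open>k < 2\<close> the measure \<open>\<mu>\<close> itself serves as a
    placeholder.\<close>
  have "\<exists>\<nu>. borel_prob \<nu> \<and> (2 \<le> k \<longrightarrow> bl_close \<mu> (conv (real (k - 1) / real k) \<mu> \<nu>) (1 / 2 ^ k))" for k :: nat
    using decomp[of "real (k - 1) / real k" "1 / 2 ^ k"] \<mu> by (cases "2 \<le> k") auto
  then obtain \<nu> where "\<And>k::nat. borel_prob (\<nu> k)"
    "\<And>k. 2 \<le> k \<Longrightarrow> bl_close \<mu> (conv (real (k - 1) / real k) \<mu> (\<nu> k)) (1 / 2 ^ k)"
    by metis
  then interpret approx_decomposition \<mu> \<nu> using \<mu> by unfold_locales
  show ?thesis by (rule selfdecomposable)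
qed

section \<open>Covariance under mixing\<close>

text \<open>The sum counts the thresholds \<open>k \<le> K * x\<close> and therefore equals the
  floor of \<open>K * x\<close>.\<close>

lemma step_sum_approx:
  fixes x :: real
  assumes "0 \<le> x" "x \<le> 1" and K: "1 \<le> K"
  shows "\<bar>x - (\<Sum>k=1..K. indicator {real k / real K..} x) / real K\<bar> \<le> 1 / real K"
proof -
  define n where "n = nat \<lfloor>real K * x\<rfloor>"
  have Kx: "0 \<le> real K * x" using assms by simp
  have n: "real n \<le> real K * x" "real K * x < real n + 1"
    using Kx unfolding n_def by linarith+
  have "real K * x \<le> real K" using assms by (simp add: mult_left_le)
  then have nK: "n \<le> K" using n by linarith
  have "indicator {real k / real K..} x = (if k \<le> n then 1 else 0 :: real)" for k
  proof -
    have "real k / real K \<le> x \<longleftrightarrow> real k \<le> real K * x" using K by (simp add: field_simps)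
    also have "\<dots> \<longleftrightarrow> k \<le> n" using n by linarith
    finally show ?thesis by (simp add: indicator_def)
  qed
  then have "(\<Sum>k=1..K. indicator {real k / real K..} x) = (\<Sum>k\<in>{1..K}. if k \<le> n then 1 else 0 :: real)"
    by (intro sum.cong) auto
  also have "\<dots> = real (card {k\<in>{1..K}. k \<le> n})" by (simp add: sum.inter_filter[symmetric])
  also have "{k\<in>{1..K}. k \<le> n} = {1..n}" using nK by auto
  finally have "(\<Sum>k=1..K. indicator {real k / real K..} x) = real n" by simp
  moreover have "\<bar>x - real n / real K\<bar> \<le> 1 / real K"
  proof -
    have "x - real n / real K = (real K * x - real n) / real K" using K by (simp add: field_simps)
    then show ?thesis using n K by (simp add: divide_right_mono)
  qed
  ultimately show ?thesis by simp
qed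

text \<open>A discrete layer-cake argument: the covariance of two averages of \<open>K\<close>
  level-set indicators is an average of \<open>K\<^sup>2\<close> covariances of events, hence at
  most \<open>\<alpha>\<close>. Discretising costs \<open>2 / K\<close> for each of the two terms,
  and \<open>K\<close> tends to infinity.\<close>

lemma (in prob_space) covariance_le_mixing:
  fixes g h :: "'a \<Rightarrow> real"
  assumes [measurable]: "g \<in> borel_measurable M" "h \<in> borel_measurable M"
    and g: "\<And>x. 0 \<le> g x" "\<And>x. g x \<le> 1" and h: "\<And>x. 0 \<le> h x" "\<And>x. h x \<le> 1"
    and mix: "\<And>s t. \<bar>prob ({x\<in>space M. s \<le> g x} \<inter> {x\<in>space M. t \<le> h x}) -
       prob {x\<in>space M. s \<le> g x} * prob {x\<in>space M. t \<le> h x}\<bar> \<le> \<alpha>"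
  shows "\<bar>expectation (\<lambda>x. g x * h x) - expectation g * expectation h\<bar> \<le> \<alpha>"
proof -
  have bound: "\<bar>expectation (\<lambda>x. g x * h x) - expectation g * expectation h\<bar> \<le> \<alpha> + 4 / real K"
    if K: "1 \<le> K" for K :: nat
  proof -
    define st where "st f x = (\<Sum>k=1..K. indicator {real k / real K..} (f x :: real)) / real K" for f and x :: 'a
    have st_ap: "\<bar>f x - st f x\<bar> \<le> 1 / real K" if "0 \<le> f x" "f x \<le> 1" for f x
      unfolding st_def by (rule step_sum_approx[OF that K])
    have st_b: "\<bar>st f x\<bar> \<le> 1" for f x
    proof -
      have "0 \<le> st f x" by (auto simp: st_def intro!: sum_nonneg divide_nonneg_nonneg)
      moreover have "(\<Sum>k=1..K. indicator {real k / real K..} (f x)) \<le> (\<Sum>k=1..K. 1 :: real)"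
        by (intro sum_mono) (auto simp: indicator_def)
      then have "st f x \<le> 1" using K by (simp add: st_def)
      ultimately show ?thesis by simp
    qed
    have st_m: "st f \<in> borel_measurable M" if "f \<in> borel_measurable M" for f
      using that unfolding st_def by measurable
    have ind_int: "integrable M (\<lambda>x. indicator {s..} (f x) :: real)" if "f \<in> borel_measurable M" for f and s :: real
      by (rule integrable_bounded_prob[OF prob_space_axioms, where B = 1]) (use that in \<open>auto simp: indicator_def\<close>)
    have ind_E: "expectation (\<lambda>x. indicator {s..} (f x) :: real) = prob {x\<in>space M. s \<le> f x}"
      if [measurable]: "f \<in> borel_measurable M" for f and s :: real
    proof -
      have "expectation (\<lambda>x. indicator {s..} (f x) :: real) = expectation (indicator {x\<in>space M. s \<le> f x})"
        by (intro Bochner_Integration.integral_cong) (auto simp: indicator_def)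
      then show ?thesis by simp
    qed
    have E_st: "expectation (st f) = (\<Sum>k=1..K. prob {x\<in>space M. real k / real K \<le> f x}) / real K"
      if f: "f \<in> borel_measurable M" for f
      unfolding st_def using ind_int[OF f] by (simp add: ind_E[OF f])
    let ?A = "\<lambda>k. {x\<in>space M. real k / real K \<le> g x}" and ?B = "\<lambda>k. {x\<in>space M. real k / real K \<le> h x}"
    have ii: "integrable M (\<lambda>x. indicator {s..} (g x) * indicator {t..} (h x) :: real)" for s t :: real
      by (rule integrable_bounded_prob[OF prob_space_axioms, where B = 1]) (auto simp: indicator_def)
    have E_ii: "expectation (\<lambda>x. indicator {s..} (g x) * indicator {t..} (h x) :: real) =
        prob ({x\<in>space M. s \<le> g x} \<inter> {x\<in>space M. t \<le> h x})" for s t :: real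
    proof -
      have "expectation (\<lambda>x. indicator {s..} (g x) * indicator {t..} (h x) :: real) =
          expectation (indicator ({x\<in>space M. s \<le> g x} \<inter> {x\<in>space M. t \<le> h x}))"
        by (intro Bochner_Integration.integral_cong) (auto simp: indicator_def)
      then show ?thesis by simp
    qed
    define J where "J k l x = (indicator {real k / real K..} (g x) * indicator {real l / real K..} (h x) :: real)" for k l x
    have iJ: "integrable M (J k l)" and EJ: "expectation (J k l) = prob (?A k \<inter> ?B l)" for k l
      unfolding J_def by (rule ii, rule E_ii)
    have "st g x * st h x = (\<Sum>k=1..K. \<Sum>l=1..K. J k l x) / (real K)\<^sup>2" for x
      by (simp only: st_def J_def sum_product power2_eq_square times_divide_times_eq)
    then have "expectation (\<lambda>x. st g x * st h x) = (\<Sum>k=1..K. \<Sum>l=1..K. prob (?A k \<inter> ?B l)) / (real K)\<^sup>2"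
      using iJ by (simp add: EJ)
    moreover have "expectation (st g) * expectation (st h) = (\<Sum>k=1..K. \<Sum>l=1..K. prob (?A k) * prob (?B l)) / (real K)\<^sup>2"
      by (simp add: E_st sum_product power2_eq_square)
    ultimately have "expectation (\<lambda>x. st g x * st h x) - expectation (st g) * expectation (st h) =
        (\<Sum>k=1..K. \<Sum>l=1..K. prob (?A k \<inter> ?B l) - prob (?A k) * prob (?B l)) / (real K)\<^sup>2"
      by (simp add: sum_subtractf diff_divide_distrib)
    also have "\<bar>\<dots>\<bar> \<le> (\<Sum>k=1..K. \<Sum>l=1..K. \<alpha>) / (real K)\<^sup>2"
      unfolding abs_divide abs_power2
      by (intro divide_right_mono order_trans[OF sum_abs] sum_mono mix) auto
    also have "\<dots> = \<alpha>" using K by (simp add: power2_eq_square)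
    finally have 1: "\<bar>expectation (\<lambda>x. st g x * st h x) - expectation (st g) * expectation (st h)\<bar> \<le> \<alpha>" .
    have gb: "\<bar>g x\<bar> \<le> 1" and hb: "\<bar>h x\<bar> \<le> 1" for x using g[of x] h[of x] by auto
    have ig: "integrable M g" "integrable M h" "integrable M (st g)" "integrable M (st h)"
      by (intro integrable_bounded_prob[OF prob_space_axioms, where B = 1] gb hb st_b st_m assms(1,2))+
    have prod_ap: "\<bar>p * q - r * s\<bar> \<le> 2 / real K"
      if "\<bar>p - r\<bar> \<le> 1 / real K" "\<bar>q - s\<bar> \<le> 1 / real K" "\<bar>q\<bar> \<le> 1" "\<bar>r\<bar> \<le> 1" for p q r s :: real
    proof -
      have "p * q - r * s = (p - r) * q + r * (q - s)" by (simp add: algebra_simps)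
      then have "\<bar>p * q - r * s\<bar> \<le> \<bar>p - r\<bar> * \<bar>q\<bar> + \<bar>r\<bar> * \<bar>q - s\<bar>"
        by (metis abs_mult abs_triangle_ineq)
      also have "\<dots> \<le> 1 / real K * 1 + 1 * (1 / real K)" using that by (intro add_mono mult_mono) auto
      finally show ?thesis by simp
    qed
    have "\<bar>expectation (\<lambda>x. g x * h x) - expectation (\<lambda>x. st g x * st h x)\<bar> \<le> expectation (\<lambda>x. 2 / real K)"
    proof (rule abs_integral_diff_le)
      show "integrable M (\<lambda>x. g x * h x)"
        by (rule integrable_bounded_prob[OF prob_space_axioms, where B = 1])
          (use gb hb in \<open>auto simp: abs_mult intro!: mult_le_one\<close>)
      show "integrable M (\<lambda>x. st g x * st h x)"
        by (rule integrable_bounded_prob[OF prob_space_axioms borel_measurable_times[OF st_m st_m], where B = 1])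
          (use st_b in \<open>auto simp: abs_mult intro!: mult_le_one\<close>)
    qed (use st_ap g h hb st_b in \<open>auto intro!: prod_ap\<close>)
    then have 2: "\<bar>expectation (\<lambda>x. g x * h x) - expectation (\<lambda>x. st g x * st h x)\<bar> \<le> 2 / real K"
      by (simp add: prob_space)
    have E_ap: "\<bar>expectation f - expectation (st f)\<bar> \<le> 1 / real K"
      if "integrable M f" "integrable M (st f)" "\<And>x. 0 \<le> f x" "\<And>x. f x \<le> 1" for f
      using abs_integral_diff_le[OF that(1,2), of "\<lambda>_. 1 / real K"] st_ap that by (simp add: prob_space)
    have 3: "\<bar>expectation g * expectation h - expectation (st g) * expectation (st h)\<bar> \<le> 2 / real K"
      by (intro prod_ap E_ap ig g h abs_integral_prob_le[OF prob_space_axioms] assms(1,2) hb st_b st_m)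
    have "4 / real K = 2 / real K + 2 / real K" by simp
    then show ?thesis using 1 2 3 by linarith
  qed
  have "(\<lambda>K. \<alpha> + 4 / real K) \<longlonglongrightarrow> \<alpha> + 0"
    by (intro tendsto_add tendsto_const) real_asymp
  then have "\<bar>expectation (\<lambda>x. g x * h x) - expectation g * expectation h\<bar> \<le> \<alpha> + 0"
    by (rule tendsto_lowerbound) (auto intro!: eventually_mono[OF eventually_ge_at_top[of 1]] bound)
  then show ?thesis by simp
qed

text \<open>Replacing \<open>U\<close> by the nodes \<open>x i\<close> turns
  \<open>F (c U + V)\<close> into a sum of products \<open>w i (U) * H i (V)\<close>, to which
  covariance bounds apply. The same discretisation is made for independent copies, whence twice
  \<open>\<delta> + \<gamma>\<close>.\<close>

lemma (in prob_space) conv_approx_mixing: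
  fixes U V :: "'a \<Rightarrow> 'b::{real_normed_vector, second_countable_topology}"
  assumes U: "U \<in> borel_measurable M" and V: "V \<in> borel_measurable M"
    and w: "\<And>i. w i \<in> borel_measurable borel" "\<And>i y. 0 \<le> w i y" "\<And>y. (\<Sum>i<N. w i y) \<le> 1"
      "\<And>i y. w i y \<le> 1" "\<And>i y. w i y \<noteq> 0 \<Longrightarrow> dist y (x i) \<le> \<delta>" and \<delta>: "0 \<le> \<delta>"
    and tail: "1 - \<gamma> \<le> expectation (\<lambda>\<omega>. \<Sum>i<N. w i (U \<omega>))"
    and cov: "\<And>i h. h \<in> borel_measurable borel \<Longrightarrow> (\<And>y. 0 \<le> h y) \<Longrightarrow> (\<And>y. h y \<le> 1) \<Longrightarrow>
      \<bar>expectation (\<lambda>\<omega>. w i (U \<omega>) * h (V \<omega>)) - expectation (\<lambda>\<omega>. w i (U \<omega>)) * expectation (\<lambda>\<omega>. h (V \<omega>))\<bar> \<le> \<alpha>"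
    and c: "\<bar>c\<bar> \<le> 1" and F: "BL 1 F"
  shows "\<bar>expectation (\<lambda>\<omega>. F (c *\<^sub>R U \<omega> + V \<omega>)) - integral\<^sup>L (conv c (distr M borel U) (distr M borel V)) F\<bar>
      \<le> 2 * (\<delta> + \<gamma>) + 2 * real N * \<alpha>"
proof -
  note [measurable] = U V w(1) BL_measurable[OF F, of borel, simplified]
  define H where "H i v = F (c *\<^sub>R x i + v)" for i v
  have [measurable]: "H i \<in> borel_measurable borel" for i unfolding H_def by measurable
  have Hb: "\<bar>H i v\<bar> \<le> 1" for i v unfolding H_def by (rule BL_abs[OF F])
  have wb: "\<bar>w i y\<bar> \<le> 1" for i y using w(2)[of i y] w(4)[of i y] by simp
  have approx: "\<bar>F (c *\<^sub>R y + v) - (\<Sum>i<N. w i y * H i v)\<bar> \<le> \<delta> + (1 - (\<Sum>i<N. w i y))" for y v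
  proof -
    have "BL 1 (\<lambda>y. F (c *\<^sub>R y + v))"
      unfolding BL_def
    proof (intro conjI allI)
      fix y z
      have "dist (c *\<^sub>R y + v) (c *\<^sub>R z + v) = \<bar>c\<bar> * dist y z"
        by (simp add: dist_norm scaleR_diff_right[symmetric])
      also have "\<dots> \<le> 1 * dist y z" using c by (intro mult_right_mono) auto
      finally show "\<bar>F (c *\<^sub>R y + v) - F (c *\<^sub>R z + v)\<bar> \<le> 1 * dist y z"
        using BL_lip[OF F, of "c *\<^sub>R y + v" "c *\<^sub>R z + v"] by simp
    qed (rule BL_abs[OF F])
    from lipschitz_partition_approx[where w = w, OF this w(2,3,5) \<delta>] show ?thesis by (simp add: H_def)
  qed
  have iw: "integrable M (\<lambda>\<omega>. w i (U \<omega>))" for i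
    by (rule integrable_bounded_prob[OF prob_space_axioms _ wb]) measurable
  have iS: "integrable M (\<lambda>\<omega>. \<delta> + (1 - (\<Sum>i<N. w i (U \<omega>))))"
    by (intro Bochner_Integration.integrable_add Bochner_Integration.integrable_diff
        Bochner_Integration.integrable_sum iw integrable_const)
  have ES: "expectation (\<lambda>\<omega>. \<delta> + (1 - (\<Sum>i<N. w i (U \<omega>)))) \<le> \<delta> + \<gamma>"
    using tail iw by (simp add: prob_space)
  have iwH: "integrable M (\<lambda>\<omega>. w i (U \<omega>) * H i (V \<omega>))" for i
    by (rule integrable_bounded_prob[OF prob_space_axioms, where B = 1])
      (use wb Hb in \<open>auto simp: abs_mult intro!: mult_le_one\<close>)
  have iF: "integrable M (\<lambda>\<omega>. F (c *\<^sub>R U \<omega> + V \<omega>))" and iFv: "integrable M (\<lambda>\<omega>. F (c *\<^sub>R U \<omega> + v))" for v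
    by (rule integrable_bounded_prob[OF prob_space_axioms _ BL_abs[OF F]], measurable)+
  have iH: "integrable M (\<lambda>\<omega>. H i (V \<omega>))" for i
    by (rule integrable_bounded_prob[OF prob_space_axioms _ Hb]) measurable
  \<comment> \<open>The discretised value under independence, through which both sides are
    compared.\<close>
  define S where "S = (\<Sum>i<N. expectation (\<lambda>\<omega>. w i (U \<omega>)) * expectation (\<lambda>\<omega>. H i (V \<omega>)))"
  have "\<bar>expectation (\<lambda>\<omega>. F (c *\<^sub>R U \<omega> + V \<omega>)) - expectation (\<lambda>\<omega>. \<Sum>i<N. w i (U \<omega>) * H i (V \<omega>))\<bar>
      \<le> expectation (\<lambda>\<omega>. \<delta> + (1 - (\<Sum>i<N. w i (U \<omega>))))"
    by (rule abs_integral_diff_le[OF iF Bochner_Integration.integrable_sum[OF iwH] iS approx])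
  then have 1: "\<bar>expectation (\<lambda>\<omega>. F (c *\<^sub>R U \<omega> + V \<omega>)) - (\<Sum>i<N. expectation (\<lambda>\<omega>. w i (U \<omega>) * H i (V \<omega>)))\<bar> \<le> \<delta> + \<gamma>"
    using ES iwH by simp
  have covH: "\<bar>expectation (\<lambda>\<omega>. w i (U \<omega>) * H i (V \<omega>)) - expectation (\<lambda>\<omega>. w i (U \<omega>)) * expectation (\<lambda>\<omega>. H i (V \<omega>))\<bar> \<le> 2 * \<alpha>" for i
  proof -
    \<comment> \<open>Moves the values from between -1 and 1 to between 0 and 1, as
      \<open>cov\<close> demands; this doubles \<open>\<alpha>\<close>.\<close>
    define h where "h v = (1 + H i v) / 2" for v
    have "\<bar>expectation (\<lambda>\<omega>. w i (U \<omega>) * h (V \<omega>)) - expectation (\<lambda>\<omega>. w i (U \<omega>)) * expectation (\<lambda>\<omega>. h (V \<omega>))\<bar> \<le> \<alpha>"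
    proof (rule cov)
      show "h \<in> borel_measurable borel" unfolding h_def by measurable
      show "0 \<le> h y" "h y \<le> 1" for y using Hb[of i y] by (auto simp: h_def abs_le_iff)
    qed
    moreover have "expectation (\<lambda>\<omega>. w i (U \<omega>) * h (V \<omega>)) =
        (expectation (\<lambda>\<omega>. w i (U \<omega>)) + expectation (\<lambda>\<omega>. w i (U \<omega>) * H i (V \<omega>))) / 2"
      using iw iwH by (simp add: h_def distrib_left)
    moreover have "expectation (\<lambda>\<omega>. h (V \<omega>)) = (1 + expectation (\<lambda>\<omega>. H i (V \<omega>))) / 2"
      using iH by (simp add: h_def prob_space)
    ultimately show ?thesis by (simp add: field_simps)
  qed
  have "(\<Sum>i<N. expectation (\<lambda>\<omega>. w i (U \<omega>) * H i (V \<omega>))) - S =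
      (\<Sum>i<N. expectation (\<lambda>\<omega>. w i (U \<omega>) * H i (V \<omega>)) - expectation (\<lambda>\<omega>. w i (U \<omega>)) * expectation (\<lambda>\<omega>. H i (V \<omega>)))"
    by (simp add: S_def sum_subtractf)
  also have "\<bar>\<dots>\<bar> \<le> (\<Sum>i<N. 2 * \<alpha>)"
    by (intro order_trans[OF sum_abs] sum_mono covH)
  finally have 2: "\<bar>(\<Sum>i<N. expectation (\<lambda>\<omega>. w i (U \<omega>) * H i (V \<omega>))) - S\<bar> \<le> 2 * real N * \<alpha>" by simp
  define A where "A v = expectation (\<lambda>\<omega>. F (c *\<^sub>R U \<omega> + v))" for v
  have A_m [measurable]: "A \<in> borel_measurable borel" unfolding A_def by measurable
  have Ab: "\<bar>A v\<bar> \<le> 1" for v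
    unfolding A_def by (rule abs_integral_prob_le[OF prob_space_axioms _ BL_abs[OF F]]) measurable
  have "integral\<^sup>L (conv c (distr M borel U) (distr M borel V)) F =
      (\<integral>v. (\<integral>y. F (c *\<^sub>R y + v) \<partial>distr M borel U) \<partial>distr M borel V)"
    by (rule integral_conv_BL(2)[OF borel_prob_distr[OF prob_space_axioms U] borel_prob_distr[OF prob_space_axioms V] F])
  also have "(\<lambda>v. \<integral>y. F (c *\<^sub>R y + v) \<partial>distr M borel U) = A"
    unfolding A_def by (intro ext integral_distr[OF U]) measurable
  also have "(\<integral>v. A v \<partial>distr M borel V) = expectation (\<lambda>\<omega>. A (V \<omega>))"
    by (rule integral_distr[OF V A_m])
  finally have conv_eq: "integral\<^sup>L (conv c (distr M borel U) (distr M borel V)) F = expectation (\<lambda>\<omega>. A (V \<omega>))" .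
  have A_ap: "\<bar>A v - (\<Sum>i<N. expectation (\<lambda>\<omega>. w i (U \<omega>)) * H i v)\<bar> \<le> \<delta> + \<gamma>" for v
  proof -
    have "\<bar>A v - expectation (\<lambda>\<omega>. \<Sum>i<N. w i (U \<omega>) * H i v)\<bar> \<le> expectation (\<lambda>\<omega>. \<delta> + (1 - (\<Sum>i<N. w i (U \<omega>))))"
      unfolding A_def
      by (rule abs_integral_diff_le[OF iFv Bochner_Integration.integrable_sum[OF integrable_mult_left[OF iw]] iS approx])
    then show ?thesis using ES iw by simp
  qed
  have "\<bar>expectation (\<lambda>\<omega>. A (V \<omega>)) - expectation (\<lambda>\<omega>. \<Sum>i<N. expectation (\<lambda>\<omega>. w i (U \<omega>)) * H i (V \<omega>))\<bar> \<le> expectation (\<lambda>\<omega>. \<delta> + \<gamma>)"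
  proof (rule abs_integral_diff_le[OF _ _ _ A_ap])
    show "integrable M (\<lambda>\<omega>. A (V \<omega>))"
      by (rule integrable_bounded_prob[OF prob_space_axioms _ Ab]) measurable
  qed (use iH in auto)
  then have 3: "\<bar>expectation (\<lambda>\<omega>. A (V \<omega>)) - S\<bar> \<le> \<delta> + \<gamma>"
    using iH by (simp add: S_def prob_space)
  have tri: "\<bar>p - q\<bar> \<le> 2 * d + e" if "\<bar>p - r\<bar> \<le> d" "\<bar>r - s\<bar> \<le> e" "\<bar>q - s\<bar> \<le> d" for p q r s d e :: real
    using that by linarith
  show ?thesis unfolding conv_eq by (rule tri[OF 1 2 3])
qed

section \<open>Normed sums of strongly mixing sequences\<close>

text \<open>A real supremum dominates its terms only for a family bounded above, so both nested
  suprema first need the bound 1.\<close>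

lemma (in prob_space) alpha_mix_bound:
  assumes X: "\<And>k. 1 \<le> k \<Longrightarrow> X k \<in> borel_measurable M"
    and j: "1 \<le> j" and n: "1 \<le> n"
    and A: "A \<in> sigma_gen M X {1..j}" and B: "B \<in> sigma_gen M X {j + n..}"
  shows "\<bar>prob (A \<inter> B) - prob A * prob B\<bar> \<le> alpha_mix M X n"
proof -
  have le1: "\<bar>prob C - prob D * prob E\<bar> \<le> 1" for C D E
  proof -
    have "0 \<le> prob D * prob E" "prob D * prob E \<le> 1"
      using mult_le_one[of "prob D" "prob E"] by auto
    then show ?thesis using prob_le_1[of C] measure_nonneg[of M C] by linarith
  qed
  have ne: "sigma_gen M X K \<noteq> {}" for K
    unfolding sigma_gen_def by (auto intro: sigma_sets.Empty)
  have bdd1: "bdd_above ((\<lambda>(A, B). \<bar>prob (A \<inter> B) - prob A * prob B\<bar>) ` (\<A> \<times> \<B>))" for \<A> \<B>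
    using le1 by (auto intro!: bdd_aboveI2[where M = 1])
  have "alpha_coeff M \<A> \<B> \<le> 1" if "\<A> \<noteq> {}" "\<B> \<noteq> {}" for \<A> \<B>
    unfolding alpha_coeff_def using that le1 by (intro cSUP_least) auto
  then have bdd2: "bdd_above ((\<lambda>j. alpha_coeff M (sigma_gen M X {1..j}) (sigma_gen M X {j + n..})) ` {1..})"
    using ne by (intro bdd_aboveI2[where M = 1]) auto
  have "\<bar>prob (A \<inter> B) - prob A * prob B\<bar> \<le> alpha_coeff M (sigma_gen M X {1..j}) (sigma_gen M X {j + n..})"
    unfolding alpha_coeff_def using cSUP_upper[OF _ bdd1, of "(A, B)"] A B by auto
  also have "\<dots> \<le> alpha_mix M X n"
    unfolding alpha_mix_def using j by (intro cSUP_upper[OF _ bdd2]) auto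
  finally show ?thesis .
qed

text \<open>\<open>sigma_gen\<close> is a bare family of sets; passing to the measure space it
  generates makes measurability of composed functions available for the mixing bound.\<close>

lemma sigma_gen_measurable:
  assumes "f \<in> borel_measurable (sigma (space M) (\<Union>k\<in>K. {X k -` B \<inter> space M | B. B \<in> sets borel}))"
  shows "{x \<in> space M. (s::real) \<le> f x} \<in> sigma_gen M X K"
proof -
  let ?G = "\<Union>k\<in>K. {X k -` B \<inter> space M | B. B \<in> sets borel}"
  have "f -` {s..} \<inter> space (sigma (space M) ?G) \<in> sets (sigma (space M) ?G)"
    by (rule measurable_sets[OF assms]) simp
  also have "f -` {s..} \<inter> space (sigma (space M) ?G) = {x \<in> space M. s \<le> f x}"
    by (auto simp: space_measure_of_conv)
  also have "sets (sigma (space M) ?G) = sigma_gen M X K"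
    unfolding sigma_gen_def by (rule sets_measure_of) auto
  finally show ?thesis .
qed

lemma measurable_sigma_generator:
  assumes "k \<in> K"
  shows "X k \<in> borel_measurable (sigma (space M) (\<Union>k\<in>K. {X k -` B \<inter> space M | B. B \<in> sets borel}))"
  by (rule measurableI) (use assms in \<open>auto simp: space_measure_of_conv intro!: in_measure_of\<close>)

locale normed_sums = prob_space M for M :: "'w measure" +
  fixes X :: "nat \<Rightarrow> 'w \<Rightarrow> 'a::{banach, second_countable_topology}"
    and a :: "nat \<Rightarrow> real" and b :: "nat \<Rightarrow> 'a" and \<mu> :: "'a measure"
  assumes X: "\<And>k. 1 \<le> k \<Longrightarrow> X k \<in> borel_measurable M"
    and a_pos: "\<And>n. 1 \<le> n \<Longrightarrow> 0 < a n"
    and inf: "infinitesimal_array M a X"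
    and \<mu>: "borel_prob \<mu>"
    and nondeg: "nondegenerate \<mu>"
    and lim: "weak_conv_borel (\<lambda>n. distr M borel (\<lambda>\<omega>. a n *\<^sub>R (\<Sum>k=1..n. X k \<omega>) + b n)) \<mu>"
begin

definition U :: "nat \<Rightarrow> 'w \<Rightarrow> 'a" where "U n \<omega> = a n *\<^sub>R (\<Sum>k=1..n. X k \<omega>) + b n"
definition law where "law n = distr M borel (U n)"

lemma U_measurable [measurable]: "U n \<in> borel_measurable M"
  unfolding U_def by (intro borel_measurable_add borel_measurable_scaleR borel_measurable_sum
      borel_measurable_const X) auto

lemma borel_prob_law: "borel_prob (law n)"
  unfolding law_def by (rule borel_prob_distr[OF prob_space_axioms U_measurable])

lemma law_weak_conv: "weak_conv_borel law \<mu>"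
  using lim by (simp add: law_def[abs_def] U_def[abs_def])

lemmas law_close = weak_conv_borel_imp_bl_close[OF \<mu> borel_prob_law law_weak_conv]

lemma measure_law: "B \<in> sets borel \<Longrightarrow> measure (law n) B = prob {\<omega>\<in>space M. U n \<omega> \<in> B}"
  unfolding law_def by (subst measure_distr) (auto intro!: arg_cong[where f = prob])

lemma small_terms:
  assumes "0 < \<epsilon>" "0 < \<delta>"
  shows "eventually (\<lambda>n. \<forall>k\<in>{1..n}. prob {\<omega>\<in>space M. \<epsilon> < a n * norm (X k \<omega>)} \<le> \<delta>) sequentially"
proof -
  have "(\<lambda>n. MAX k\<in>{1..n}. prob {\<omega>\<in>space M. a n * norm (X k \<omega>) > \<epsilon>}) \<longlonglongrightarrow> 0"
    using inf assms(1) by (auto simp: infinitesimal_array_def)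
  then have "eventually (\<lambda>n. (MAX k\<in>{1..n}. prob {\<omega>\<in>space M. a n * norm (X k \<omega>) > \<epsilon>}) < \<delta>) sequentially"
    using assms(2) by (rule order_tendstoD)
  then show ?thesis
  proof eventually_elim
    case (elim n)
    show ?case
    proof
      fix k assume "k \<in> {1..n}"
      then have "prob {\<omega>\<in>space M. \<epsilon> < a n * norm (X k \<omega>)} \<le> (MAX k\<in>{1..n}. prob {\<omega>\<in>space M. a n * norm (X k \<omega>) > \<epsilon>})"
        by (intro Max_ge) auto
      then show "prob {\<omega>\<in>space M. \<epsilon> < a n * norm (X k \<omega>)} \<le> \<delta>" using elim by linarith
    qed
  qed
qed

section \<open>Behaviour of the norming constants\<close>

lemma not_concentrated: "\<exists>t p. 0 < t \<and> t \<le> 1 \<and> p < 1 \<and> (\<forall>y. measure \<mu> (cball y t) \<le> p)"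
proof (rule ccontr)
  assume no: "\<not> ?thesis"
  interpret \<mu>: prob_space \<mu> using borel_probD[OF \<mu>] by auto
  have "\<exists>y. p < measure \<mu> (cball y t)" if t: "0 < t" and p: "p < 1" for t p
  proof -
    \<comment> \<open>Radii are capped at 1 to meet the condition \<open>t \<le> 1\<close> of
      \<open>bl_close_cball\<close>.\<close>
    have "0 < min t 1" "min t 1 \<le> 1" using t by auto
    then obtain y where y: "p < measure \<mu> (cball y (min t 1))" using no p by (meson not_le)
    have "measure \<mu> (cball y (min t 1)) \<le> measure \<mu> (cball y t)"
      using borel_probD[OF \<mu>] by (intro \<mu>.finite_measure_mono) auto
    then show ?thesis using y by (intro exI[of _ y]) linarith
  qed
  then show False using point_mass_criterion[OF \<mu>] nondeg by (auto simp: nondegenerate_def)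
qed

text \<open>Infinitesimality, read along the infinitely many \<open>n\<close> with
  \<open>\<delta> \<le> a n\<close> for the fixed index \<open>k\<close>, bounds every tail of
  \<open>X k\<close> by arbitrarily small numbers.\<close>

lemma terms_null_if_norming_large:
  assumes fr: "frequently (\<lambda>n. \<delta> \<le> a n) sequentially" and \<delta>: "0 < \<delta>" and k: "1 \<le> k"
  shows "AE \<omega> in M. X k \<omega> = 0"
proof -
  have [measurable]: "X k \<in> borel_measurable M" by (rule X[OF k])
  have "prob {\<omega>\<in>space M. \<epsilon> < norm (X k \<omega>)} = 0" if \<epsilon>: "0 < \<epsilon>" for \<epsilon>
  proof -
    have "prob {\<omega>\<in>space M. \<epsilon> < norm (X k \<omega>)} \<le> 0 + e" if e: "0 < e" for e
    proof -
      have "eventually (\<lambda>n. k \<le> n \<and> (\<forall>j\<in>{1..n}. prob {\<omega>\<in>space M. \<delta> * \<epsilon> < a n * norm (X j \<omega>)} \<le> e)) sequentially"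
        using small_terms[of "\<delta> * \<epsilon>" e] \<delta> \<epsilon> e eventually_ge_at_top[of k] by (auto intro: eventually_conj)
      from frequently_eventually_frequently[OF fr this]
      obtain n where n: "\<delta> \<le> a n" "k \<le> n" "\<forall>j\<in>{1..n}. prob {\<omega>\<in>space M. \<delta> * \<epsilon> < a n * norm (X j \<omega>)} \<le> e"
        by (auto dest: frequently_ex)
      have "\<delta> * \<epsilon> < a n * norm (X k \<omega>)" if "\<epsilon> < norm (X k \<omega>)" for \<omega>
        using mult_le_less_imp_less[OF n(1) that \<delta>] \<epsilon> by simp
      then have "prob {\<omega>\<in>space M. \<epsilon> < norm (X k \<omega>)} \<le> prob {\<omega>\<in>space M. \<delta> * \<epsilon> < a n * norm (X k \<omega>)}"
        by (intro finite_measure_mono) auto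
      also have "\<dots> \<le> e" using n k by auto
      finally show ?thesis by simp
    qed
    then have "prob {\<omega>\<in>space M. \<epsilon> < norm (X k \<omega>)} \<le> 0" by (rule field_le_epsilon)
    then show ?thesis using measure_nonneg[of M] by (simp add: order_antisym)
  qed
  then have "AE \<omega> in M. \<not> \<epsilon> < norm (X k \<omega>)" if "0 < \<epsilon>" for \<epsilon>
    using that by (subst prob_Collect_eq_0[symmetric]) auto
  then have "AE \<omega> in M. \<forall>m. \<not> 1 / real (Suc m) < norm (X k \<omega>)"
    by (subst AE_all_countable) simp
  then show ?thesis
  proof (rule AE_mp, intro AE_I2 impI)
    fix \<omega> assume "\<forall>m. \<not> 1 / real (Suc m) < norm (X k \<omega>)"
    then show "X k \<omega> = 0" by (metis nat_approx_posE zero_less_norm_iff)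
  qed
qed

text \<open>Otherwise all \<open>X k\<close> vanish almost surely, \<open>U n\<close> is the
  constant \<open>b n\<close>, and \<open>\<mu>\<close> would have too much mass in a small ball
  around \<open>b n\<close>.\<close>

lemma a_tendsto_0: "a \<longlonglongrightarrow> 0"
proof (rule tendstoI, rule ccontr)
  fix \<delta> :: real assume \<delta>: "0 < \<delta>" and "\<not> eventually (\<lambda>n. dist (a n) 0 < \<delta>) sequentially"
  then have "frequently (\<lambda>n. \<delta> \<le> \<bar>a n\<bar>) sequentially" by (simp add: frequently_def not_le)
  from frequently_eventually_frequently[OF this eventually_ge_at_top[of 1]]
  have fr: "frequently (\<lambda>n. \<delta> \<le> a n) sequentially"
    by (rule frequently_elim1) (use a_pos in force)
  have "AE \<omega> in M. \<forall>k. 1 \<le> k \<longrightarrow> X k \<omega> = 0"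
    using terms_null_if_norming_large[OF fr \<delta>] by (subst AE_all_countable) (auto intro: AE_I2)
  then have U_b: "AE \<omega> in M. U n \<omega> = b n" for n
    by (rule AE_mp) (auto simp: U_def)
  obtain t p where t: "0 < t" "t \<le> 1" and p: "p < 1" and tp: "\<And>y. measure \<mu> (cball y t) \<le> p"
    using not_concentrated by blast
  \<comment> \<open>With a collar of width \<open>t / 2\<close> the loss is
    \<open>(1 - p) / 2\<close>, too little to bring mass 1 down to \<open>p\<close>.\<close>
  have "eventually (\<lambda>n. bl_close \<mu> (law n) ((1 - p) * t / 4)) sequentially"
    using t p by (intro law_close) auto
  then obtain n where "bl_close \<mu> (law n) ((1 - p) * t / 4)"
    using eventually_happens'[OF sequentially_bot] by blast
  from bl_close_cball[OF borel_prob_law \<mu> bl_close_sym[OF this], of "t/2" "b n" "t/2"]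
  have "measure (law n) (cball (b n) (t/2)) - (1 - p) / 2 \<le> p" using t tp[of "b n"] by simp
  moreover have "measure (law n) (cball (b n) (t/2)) = 1"
  proof -
    have "AE \<omega> in M. U n \<omega> \<in> cball (b n) (t/2)" using U_b[of n] t by (auto elim!: AE_mp)
    then show ?thesis by (subst measure_law) (auto simp: prob_Collect_eq_1)
  qed
  ultimately show False using p by (simp add: field_simps)
qed

text \<open>Up to a small term, \<open>U (Suc n)\<close> is an affine image of \<open>U n\<close>
  with factor \<open>a (Suc n) / a n \<le> \<rho>\<close>. Both laws are close to
  \<open>\<mu>\<close>, so a heavy ball yields a heavy ball of smaller radius.\<close>

lemma contraction_of_concentration:
  assumes fr: "frequently (\<lambda>n. a (Suc n) \<le> \<rho> * a n) sequentially" and \<rho>: "0 < \<rho>" "\<rho> < \<rho>'"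
    and s: "0 < s" and x: "p < measure \<mu> (cball x s)"
  shows "\<exists>y. p < measure \<mu> (cball y (\<rho>' * s))"
proof -
  interpret \<mu>: prob_space \<mu> using borel_probD[OF \<mu>] by auto
  define \<kappa> where "\<kappa> = measure \<mu> (cball x s) - p"
  \<comment> \<open>The radius grows by \<open>\<tau>\<close> on passing from \<open>\<mu>\<close>
    to \<open>law n\<close>, by the new term, and on returning to \<open>\<mu>\<close>; the gap
    between \<open>\<rho>\<close> and \<open>\<rho>'\<close> absorbs all three. Each of the three
    also loses mass at most \<open>\<kappa> / 4\<close>, which leaves more than
    \<open>p\<close>.\<close>
  define \<tau> where "\<tau> = min 1 (s * (\<rho>' - \<rho>) / (\<rho> + 2))"
  have \<kappa>: "0 < \<kappa>" using x by (simp add: \<kappa>_def)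
  have \<tau>: "0 < \<tau>" "\<tau> \<le> 1" using s \<rho> by (auto simp: \<tau>_def)
  have "\<tau> \<le> s * (\<rho>' - \<rho>) / (\<rho> + 2)" by (simp add: \<tau>_def)
  then have "\<tau> * (\<rho> + 2) \<le> s * (\<rho>' - \<rho>)" using \<rho> by (simp add: pos_le_divide_eq)
  then have rad: "\<rho> * (s + \<tau>) + \<tau> + \<tau> \<le> \<rho>' * s" by (simp add: algebra_simps)
  define \<epsilon> where "\<epsilon> = \<tau> * (\<kappa> / 4)"
  have \<epsilon>: "0 < \<epsilon>" using \<tau> \<kappa> by (simp add: \<epsilon>_def)
  have ev: "eventually (\<lambda>n. bl_close \<mu> (law n) \<epsilon> \<and> (\<forall>k\<in>{1..n}. prob {\<omega>\<in>space M. \<tau> < a n * norm (X k \<omega>)} \<le> \<kappa> / 4)) sequentially"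
    using law_close[OF \<epsilon>] small_terms[of \<tau> "\<kappa>/4"] \<tau> \<kappa> by (auto intro: eventually_conj)
  have "eventually (\<lambda>n. 1 \<le> n \<and> bl_close \<mu> (law n) \<epsilon> \<and> bl_close \<mu> (law (Suc n)) \<epsilon> \<and>
      prob {\<omega>\<in>space M. \<tau> < a (Suc n) * norm (X (Suc n) \<omega>)} \<le> \<kappa> / 4) sequentially"
    using ev eventually_sequentially_Suc[THEN iffD2, OF ev] eventually_ge_at_top[of 1]
    by eventually_elim auto
  from frequently_eventually_frequently[OF fr this]
  obtain n where n: "a (Suc n) \<le> \<rho> * a n" "1 \<le> n" "bl_close \<mu> (law n) \<epsilon>" "bl_close \<mu> (law (Suc n)) \<epsilon>"
    "prob {\<omega>\<in>space M. \<tau> < a (Suc n) * norm (X (Suc n) \<omega>)} \<le> \<kappa> / 4"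
    by (auto dest: frequently_ex)
  define r where "r = a (Suc n) / a n"
  define y where "y = r *\<^sub>R x + (b (Suc n) - r *\<^sub>R b n)"
  have an: "0 < a n" "0 < a (Suc n)" using a_pos n(2) by auto
  have r: "0 < r" "r \<le> \<rho>" using n(1) an by (auto simp: r_def field_simps)
  have U_Suc: "U (Suc n) \<omega> = r *\<^sub>R U n \<omega> + (b (Suc n) - r *\<^sub>R b n) + a (Suc n) *\<^sub>R X (Suc n) \<omega>" for \<omega>
    using an by (simp add: U_def r_def scaleR_add_right algebra_simps)
  have [measurable]: "X (Suc n) \<in> borel_measurable M" by (rule X) simp
  have S1: "{\<omega>\<in>space M. U k \<omega> \<in> cball z t} \<in> events" for k z t
    using measurable_sets[OF U_measurable, of "cball z t" k] by (simp add: vimage_def Int_def conj_commute)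
  have S2: "{\<omega>\<in>space M. \<tau> < a (Suc n) * norm (X (Suc n) \<omega>)} \<in> events" by measurable
  have "measure \<mu> (cball x s) - \<kappa> / 4 \<le> measure (law n) (cball x (s + \<tau>))"
    using bl_close_cball[OF \<mu> borel_prob_law n(3) \<tau>, of x s] \<tau> by (simp add: \<epsilon>_def)
  also have "\<dots> = prob {\<omega>\<in>space M. U n \<omega> \<in> cball x (s + \<tau>)}" by (rule measure_law) simp
  also have "\<dots> \<le> prob ({\<omega>\<in>space M. U (Suc n) \<omega> \<in> cball y (\<rho> * (s + \<tau>) + \<tau>)} \<union>
      {\<omega>\<in>space M. \<tau> < a (Suc n) * norm (X (Suc n) \<omega>)})"
  proof (rule finite_measure_mono)
    show "{\<omega>\<in>space M. U n \<omega> \<in> cball x (s + \<tau>)} \<subseteq> {\<omega>\<in>space M. U (Suc n) \<omega> \<in> cball y (\<rho> * (s + \<tau>) + \<tau>)} \<union>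
        {\<omega>\<in>space M. \<tau> < a (Suc n) * norm (X (Suc n) \<omega>)}"
    proof
      fix \<omega> assume "\<omega> \<in> {\<omega>\<in>space M. U n \<omega> \<in> cball x (s + \<tau>)}"
      then have \<omega>: "\<omega> \<in> space M" "norm (x - U n \<omega>) \<le> s + \<tau>" by (auto simp: dist_norm)
      have "y - U (Suc n) \<omega> = r *\<^sub>R (x - U n \<omega>) - a (Suc n) *\<^sub>R X (Suc n) \<omega>"
        by (simp add: y_def U_Suc algebra_simps)
      then have "norm (y - U (Suc n) \<omega>) \<le> norm (r *\<^sub>R (x - U n \<omega>)) + norm (a (Suc n) *\<^sub>R X (Suc n) \<omega>)"
        by (simp only: norm_triangle_ineq4)
      also have "\<dots> = r * norm (x - U n \<omega>) + a (Suc n) * norm (X (Suc n) \<omega>)" using r an by simp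
      also have "r * norm (x - U n \<omega>) \<le> \<rho> * (s + \<tau>)" using r \<omega>(2) by (intro mult_mono) auto
      finally show "\<omega> \<in> {\<omega>\<in>space M. U (Suc n) \<omega> \<in> cball y (\<rho> * (s + \<tau>) + \<tau>)} \<union>
          {\<omega>\<in>space M. \<tau> < a (Suc n) * norm (X (Suc n) \<omega>)}"
        using \<omega>(1) by (auto simp: dist_norm)
    qed
  qed (intro sets.Un S1 S2)
  also have "\<dots> \<le> prob {\<omega>\<in>space M. U (Suc n) \<omega> \<in> cball y (\<rho> * (s + \<tau>) + \<tau>)} +
      prob {\<omega>\<in>space M. \<tau> < a (Suc n) * norm (X (Suc n) \<omega>)}"
    by (rule measure_Un_le[OF S1 S2])
  finally have 1: "measure \<mu> (cball x s) - \<kappa> / 4 \<le>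
      prob {\<omega>\<in>space M. U (Suc n) \<omega> \<in> cball y (\<rho> * (s + \<tau>) + \<tau>)} +
      prob {\<omega>\<in>space M. \<tau> < a (Suc n) * norm (X (Suc n) \<omega>)}" .
  have "prob {\<omega>\<in>space M. U (Suc n) \<omega> \<in> cball y (\<rho> * (s + \<tau>) + \<tau>)} =
      measure (law (Suc n)) (cball y (\<rho> * (s + \<tau>) + \<tau>))"
    by (rule measure_law[symmetric]) simp
  also have "\<dots> \<le> measure \<mu> (cball y (\<rho> * (s + \<tau>) + \<tau> + \<tau>)) + \<kappa> / 4"
    using bl_close_cball[OF borel_prob_law \<mu> bl_close_sym[OF n(4)] \<tau>, of y "\<rho> * (s + \<tau>) + \<tau>"] \<tau>
    by (simp add: \<epsilon>_def)
  also have "measure \<mu> (cball y (\<rho> * (s + \<tau>) + \<tau> + \<tau>)) \<le> measure \<mu> (cball y (\<rho>' * s))"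
    using rad borel_probD[OF \<mu>] by (intro \<mu>.finite_measure_mono) auto
  finally have 2: "prob {\<omega>\<in>space M. U (Suc n) \<omega> \<in> cball y (\<rho> * (s + \<tau>) + \<tau>)} \<le>
      measure \<mu> (cball y (\<rho>' * s)) + \<kappa> / 4" by simp
  have slack: "u < v" if "w - k / 4 \<le> d + e" "d \<le> v + k / 4" "e \<le> k / 4" "k = w - u" "0 < k" for u v w d e k :: real
    using that by linarith
  have "p < measure \<mu> (cball y (\<rho>' * s))" by (rule slack[OF 1 2 n(5) \<kappa>_def \<kappa>])
  then show ?thesis ..
qed

text \<open>Otherwise \<open>\<mu>\<close> could be contracted by a fixed factor over and over without losing concentration,
  and would be a point mass.\<close>

lemma norming_ratio:
  assumes \<rho>: "0 < \<rho>" "\<rho> < 1"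
  shows "eventually (\<lambda>n. \<rho> * a n < a (Suc n)) sequentially"
proof (rule ccontr)
  assume "\<not> ?thesis"
  then have fr: "frequently (\<lambda>n. a (Suc n) \<le> \<rho> * a n) sequentially" by (simp add: frequently_def not_le)
  interpret \<mu>: prob_space \<mu> using borel_probD[OF \<mu>] by auto
  define \<rho>' where "\<rho>' = (1 + \<rho>) / 2"
  have \<rho>': "\<rho> < \<rho>'" "0 < \<rho>'" "\<rho>' < 1" using \<rho> by (auto simp: \<rho>'_def)
  obtain t p where t: "0 < t" and p: "p < 1" and tp: "\<And>y. measure \<mu> (cball y t) \<le> p"
    using not_concentrated by blast
  obtain s where s: "0 < s" "p < measure \<mu> (cball 0 s)" using measure_cball_tendsto_1[OF \<mu> p] by blast
  have it: "\<exists>y. p < measure \<mu> (cball y (\<rho>' ^ k * s))" for k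
  proof (induction k)
    case 0 show ?case using s by auto
  next
    case (Suc k)
    then obtain y where "p < measure \<mu> (cball y (\<rho>' ^ k * s))" by blast
    from contraction_of_concentration[OF fr \<rho>(1) \<rho>'(1) _ this] show ?case
      using s \<rho>' by (simp add: mult.assoc)
  qed
  obtain k where "\<rho>' ^ k < t / s" using real_arch_pow_inv[of "t/s" \<rho>'] t s \<rho>' by auto
  then have "\<rho>' ^ k * s \<le> t" using s by (simp add: field_simps)
  then have "measure \<mu> (cball y (\<rho>' ^ k * s)) \<le> measure \<mu> (cball y t)" for y
    using borel_probD[OF \<mu>] by (intro \<mu>.finite_measure_mono subset_cball) auto
  then show False using it[of k] tp by (meson leD order_trans)
qed

text \<open>Given \<open>m\<close>, take for \<open>n\<close> the last index at which \<open>a n \<ge> c * a m\<close>.\<close>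

lemma index_pairs:
  assumes c: "0 < c" "c < 1" and \<theta>: "1 < \<theta>"
  shows "\<exists>m n. N \<le> m \<and> 1 \<le> m \<and> m + q \<le> n \<and> c * a m \<le> a n \<and> a n \<le> \<theta> * (c * a m)"
proof -
  \<comment> \<open>By Bernoulli's inequality the first entry gives
    \<open>c \<le> \<rho> ^ q\<close>, so \<open>m + q\<close> still qualifies as an index. The
    second bounds the overshoot at the last qualifying index by the factor
    \<open>\<theta>\<close>.\<close>
  define \<rho> where "\<rho> = max (1 - (1 - c) / (real q + 1)) (1 / \<theta>)"
  have \<rho>: "0 < \<rho>" "\<rho> < 1" "1 / \<theta> \<le> \<rho>" using c \<theta> by (auto simp: \<rho>_def less_max_iff_disj)
  have \<rho>q: "c \<le> \<rho> ^ q"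
  proof -
    have q: "real q * ((1 - c) / (real q + 1)) \<le> 1 - c"
    proof -
      have "real q / (real q + 1) * (1 - c) \<le> 1 * (1 - c)" using c by (intro mult_right_mono) auto
      then show ?thesis by simp
    qed
    have d: "(1 - c) / (real q + 1) \<le> 1" using c by (subst divide_le_eq_1_pos) auto
    have "c \<le> 1 + real q * (- ((1 - c) / (real q + 1)))" using q by simp
    also have "\<dots> \<le> (1 + (- ((1 - c) / (real q + 1)))) ^ q"
      by (rule Bernoulli_inequality) (use d in simp)
    also have "\<dots> \<le> \<rho> ^ q" by (rule power_mono) (use d in \<open>auto simp: \<rho>_def\<close>)
    finally show ?thesis .
  qed
  obtain N1 where N1: "\<And>n. N1 \<le> n \<Longrightarrow> \<rho> * a n < a (Suc n)"
    using norming_ratio[OF \<rho>(1,2)] by (auto simp: eventually_sequentially)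
  define m where "m = max N (max N1 1)"
  have m: "N \<le> m" "N1 \<le> m" "1 \<le> m" by (auto simp: m_def)
  have am: "0 < a m" using a_pos m by auto
  have pow: "\<rho> ^ i * a m \<le> a (m + i)" for i
  proof (induction i)
    case (Suc i)
    have "\<rho> ^ Suc i * a m = \<rho> * (\<rho> ^ i * a m)" by simp
    also have "\<dots> \<le> \<rho> * a (m + i)" using Suc \<rho> by (intro mult_left_mono) auto
    also have "\<dots> \<le> a (m + Suc i)" using N1[of "m + i"] m by simp
    finally show ?case .
  qed simp
  define S where "S = {n. m \<le> n \<and> c * a m \<le> a n}"
  have "eventually (\<lambda>n. a n < c * a m) sequentially"
    using a_tendsto_0 c am by (intro order_tendstoD(2)) auto
  then obtain N2 where N2: "\<And>n. N2 \<le> n \<Longrightarrow> a n < c * a m" by (auto simp: eventually_sequentially)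
  \<comment> \<open>The last index exists because \<open>a\<close> tends to 0.\<close>
  have "S \<subseteq> {..N2}" using N2 by (auto simp: S_def) (meson not_le nat_le_linear)
  then have fin: "finite S" by (rule finite_subset) simp
  have "c * a m \<le> \<rho> ^ q * a m" using \<rho>q am by (intro mult_right_mono) auto
  then have inS: "m + q \<in> S" using pow[of q] by (simp add: S_def)
  define n where "n = Max S"
  have nS: "n \<in> S" unfolding n_def using fin inS by (intro Max_in) auto
  have mq: "m + q \<le> n" unfolding n_def using fin inS by (rule Max_ge)
  have "Suc n \<notin> S" using Max_ge[OF fin, of "Suc n"] by (auto simp: n_def)
  then have "a (Suc n) < c * a m" using nS by (simp add: S_def)
  then have "\<rho> * a n < c * a m" using N1[of n] m mq by linarith
  then have "\<theta> * (\<rho> * a n) \<le> \<theta> * (c * a m)" using \<theta> by (intro mult_left_mono) auto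
  moreover have "1 * a n \<le> \<theta> * \<rho> * a n"
    using \<rho> \<theta> a_pos[of n] m mq by (intro mult_right_mono) (auto simp: pos_divide_le_eq mult.commute)
  ultimately have "a n \<le> \<theta> * (c * a m)" by (simp add: mult.assoc)
  then show ?thesis using m mq nS by (auto simp: S_def)
qed

section \<open>Splitting the normed sum at a gap\<close>

lemma gap_small:
  assumes "0 < \<delta>"
  shows "eventually (\<lambda>n. \<forall>m. m + q \<le> n \<longrightarrow>
    prob {\<omega>\<in>space M. \<delta> < norm (a n *\<^sub>R (\<Sum>k\<in>{m+1..<m+q}. X k \<omega>))} \<le> \<delta>) sequentially"
proof -
  \<comment> \<open>A union bound over fewer than \<open>Suc q\<close> terms. Infinitesimality
    treats all \<open>k \<le> n\<close> at once, hence the uniformity in \<open>m\<close>.\<close>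
  have "eventually (\<lambda>n. \<forall>k\<in>{1..n}. prob {\<omega>\<in>space M. \<delta> / real (Suc q) < a n * norm (X k \<omega>)} \<le> \<delta> / real (Suc q)) sequentially"
    using assms by (intro small_terms) auto
  with eventually_ge_at_top[of 1] show ?thesis
  proof eventually_elim
    case (elim n)
    show ?case
    proof (intro allI impI)
      fix m assume mq: "m + q \<le> n"
      let ?B = "\<lambda>k. {\<omega>\<in>space M. \<delta> / real (Suc q) < a n * norm (X k \<omega>)}"
      have an: "0 < a n" using a_pos elim by auto
      have "(\<Sum>k\<in>{m+1..<m+q}. \<delta> / real (Suc q)) = real (q - 1) * (\<delta> / real (Suc q))" by simp
      also have "\<dots> \<le> real (Suc q) * (\<delta> / real (Suc q))" using assms by (intro mult_right_mono) auto
      finally have cnt: "(\<Sum>k\<in>{m+1..<m+q}. \<delta> / real (Suc q)) \<le> \<delta>" by simp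
      have Bs: "?B k \<in> events" if "k \<in> {m+1..<m+q}" for k
      proof -
        have [measurable]: "X k \<in> borel_measurable M" using that by (intro X) auto
        show ?thesis by measurable
      qed
      have "{\<omega>\<in>space M. \<delta> < norm (a n *\<^sub>R (\<Sum>k\<in>{m+1..<m+q}. X k \<omega>))} \<subseteq> (\<Union>k\<in>{m+1..<m+q}. ?B k)"
      proof (rule subsetI, rule ccontr)
        fix \<omega> assume \<omega>: "\<omega> \<in> {\<omega>\<in>space M. \<delta> < norm (a n *\<^sub>R (\<Sum>k\<in>{m+1..<m+q}. X k \<omega>))}"
          "\<omega> \<notin> (\<Union>k\<in>{m+1..<m+q}. ?B k)"
        have "norm (a n *\<^sub>R (\<Sum>k\<in>{m+1..<m+q}. X k \<omega>)) \<le> (\<Sum>k\<in>{m+1..<m+q}. a n * norm (X k \<omega>))"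
          unfolding scaleR_sum_right using an by (intro order_trans[OF norm_sum]) simp
        also have "\<dots> \<le> (\<Sum>k\<in>{m+1..<m+q}. \<delta> / real (Suc q))"
          using \<omega> by (intro sum_mono) (auto simp: not_less simp del: of_nat_Suc)
        also note cnt
        finally show False using \<omega>(1) by simp
      qed
      then have "prob {\<omega>\<in>space M. \<delta> < norm (a n *\<^sub>R (\<Sum>k\<in>{m+1..<m+q}. X k \<omega>))} \<le> prob (\<Union>k\<in>{m+1..<m+q}. ?B k)"
        using Bs by (intro finite_measure_mono) auto
      also have "\<dots> \<le> (\<Sum>k\<in>{m+1..<m+q}. prob (?B k))"
        using Bs by (intro finite_measure_subadditive_finite) auto
      also have "\<dots> \<le> (\<Sum>k\<in>{m+1..<m+q}. \<delta> / real (Suc q))"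
        using elim mq by (intro sum_mono) auto
      also note cnt
      finally show "prob {\<omega>\<in>space M. \<delta> < norm (a n *\<^sub>R (\<Sum>k\<in>{m+1..<m+q}. X k \<omega>))} \<le> \<delta>" .
    qed
  qed
qed

lemma trunc_moment_small:
  assumes "0 < \<delta>"
  shows "\<exists>t>0. \<forall>s. 0 \<le> s \<longrightarrow> s \<le> t \<longrightarrow> trunc_moment \<mu> s \<le> \<delta>"
proof -
  have "(\<lambda>j. trunc_moment \<mu> (1 / real (Suc j))) \<longlonglongrightarrow> 0"
  proof (rule trunc_moment_tendsto_0[OF \<mu>])
    show "(\<lambda>j. 1 / real (Suc j)) \<longlonglongrightarrow> 0" by real_asymp
  qed simp
  then have "eventually (\<lambda>j. trunc_moment \<mu> (1 / real (Suc j)) < \<delta>) sequentially"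
    using assms by (rule order_tendstoD)
  then obtain j where j: "trunc_moment \<mu> (1 / real (Suc j)) < \<delta>"
    using eventually_happens'[OF sequentially_bot] by blast
  have "trunc_moment \<mu> s \<le> trunc_moment \<mu> (1 / real (Suc j))" if "0 \<le> s" "s \<le> 1 / real (Suc j)" for s
    unfolding trunc_moment_def using that
    by (intro integral_mono integrable_trunc[OF \<mu>] min.mono mult_right_mono) auto
  then show ?thesis using j by (intro exI[of _ "1 / real (Suc j)"]) (fastforce simp del: of_nat_Suc)
qed

lemma approx_decomposable:
  assumes mixing: "strongly_mixing M X" and c: "0 < c" "c < 1" and \<epsilon>: "0 < \<epsilon>"
  shows "\<exists>\<nu>. borel_prob \<nu> \<and> bl_close \<mu> (conv c \<mu> \<nu>) \<epsilon>"
proof -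
  interpret \<mu>: prob_space \<mu> using borel_probD[OF \<mu>] by auto
  \<comment> \<open>The five comparisons numbered below cost 1, 3, 7, 1 and 1 times
    \<open>\<delta>\<close>.\<close>
  define \<delta> where "\<delta> = \<epsilon> / 13"
  have \<delta>: "0 < \<delta>" using \<epsilon> by (simp add: \<delta>_def)
  obtain N :: nat and x w L where L: "1 \<le> L" and wBL: "\<And>i. BL L (w i)" and w0: "\<And>i y. 0 \<le> w i y"
    and w1: "\<And>y. (\<Sum>i<N. w i y) \<le> 1" and ws: "\<And>i y. w i y \<noteq> 0 \<Longrightarrow> dist y (x i) \<le> \<delta>"
    and wi: "1 - \<delta> \<le> (\<integral>y. (\<Sum>i<N. w i y) \<partial>\<mu>)"
    by (rule lipschitz_partition[OF \<mu> \<delta>], rule that, assumption+)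
  have w_m [measurable]: "w i \<in> borel_measurable borel" for i using BL_measurable[OF wBL] by simp
  have wb: "w i y \<le> 1" for i y using BL_abs[OF wBL, of i y] by simp
  \<comment> \<open>Finer than \<open>\<delta>\<close> because \<open>N\<close> weights with
    Lipschitz constant \<open>L\<close> are transferred from \<open>\<mu>\<close> to
    \<open>law m\<close> at total cost \<open>\<delta>\<close>.\<close>
  define \<delta>' where "\<delta>' = \<delta> / (real N * L + 1)"
  have \<delta>': "0 < \<delta>'" "\<delta>' \<le> \<delta>" "real N * (L * \<delta>') \<le> \<delta>"
  proof -
    have "0 \<le> real N * L" "0 \<le> \<delta> * (real N * L)" using L \<delta> by simp_all
    then show "0 < \<delta>'" "\<delta>' \<le> \<delta>" "real N * (L * \<delta>') \<le> \<delta>"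
      using \<delta> by (simp_all add: \<delta>'_def field_simps)
  qed
  have "eventually (\<lambda>q. alpha_mix M X q < \<delta> / (2 * real N + 1)) sequentially"
    using mixing \<delta> unfolding strongly_mixing_def by (intro order_tendstoD(2)) auto
  from eventually_conj[OF this eventually_ge_at_top[of 1]]
  obtain q where q: "alpha_mix M X q < \<delta> / (2 * real N + 1)" "1 \<le> q"
    using eventually_happens'[OF sequentially_bot] by blast
  have \<alpha>: "2 * real N * alpha_mix M X q \<le> \<delta>"
  proof -
    have "2 * real N * alpha_mix M X q \<le> 2 * real N * (\<delta> / (2 * real N + 1))"
      using q(1) by (intro mult_left_mono) auto
    also have "\<dots> \<le> \<delta>" using \<delta> by (simp add: field_simps)
    finally show ?thesis .
  qed
  obtain t where t: "0 < t" "\<And>s. 0 \<le> s \<Longrightarrow> s \<le> t \<Longrightarrow> trunc_moment \<mu> s \<le> \<delta>"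
    using trunc_moment_small[OF \<delta>] by blast
  \<comment> \<open>Keeps the actual ratio \<open>c'\<close> within \<open>t\<close> of
    \<open>c\<close>, so that changing the scale costs at most \<open>\<delta>\<close>, and at most
    1, so that scaling by \<open>c'\<close> preserves \<open>BL 1\<close>.\<close>
  define \<theta> where "\<theta> = 1 + min t (1 - c)"
  have \<theta>: "1 < \<theta>" using t c by (simp add: \<theta>_def)
  have \<theta>c: "\<theta> * c \<le> c + t" "\<theta> * c \<le> 1"
  proof -
    have "min t (1 - c) * c \<le> min t (1 - c) * 1" using t c by (intro mult_left_mono) auto
    then show "\<theta> * c \<le> c + t" "\<theta> * c \<le> 1" by (auto simp: \<theta>_def algebra_simps)
  qed
  have "eventually (\<lambda>n. bl_close \<mu> (law n) \<delta>' \<and> (\<forall>m. m + q \<le> n \<longrightarrow>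
    prob {\<omega>\<in>space M. \<delta> < norm (a n *\<^sub>R (\<Sum>k\<in>{m+1..<m+q}. X k \<omega>))} \<le> \<delta>)) sequentially"
    by (rule eventually_conj[OF law_close[OF \<delta>'(1)] gap_small[OF \<delta>]])
  then obtain N0 where N0: "\<And>n. N0 \<le> n \<Longrightarrow> bl_close \<mu> (law n) \<delta>'"
    "\<And>n m. N0 \<le> n \<Longrightarrow> m + q \<le> n \<Longrightarrow> prob {\<omega>\<in>space M. \<delta> < norm (a n *\<^sub>R (\<Sum>k\<in>{m+1..<m+q}. X k \<omega>))} \<le> \<delta>"
    unfolding eventually_sequentially by blast
  obtain m n where mn: "N0 \<le> m" "1 \<le> m" "m + q \<le> n" "c * a m \<le> a n" "a n \<le> \<theta> * (c * a m)"
    using index_pairs[OF c \<theta>, of N0 q] by blast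
  have am: "0 < a m" "0 < a n" using a_pos mn by auto
  define c' where "c' = a n / a m"
  have c': "c \<le> c'" "c' \<le> \<theta> * c" using mn am by (auto simp: c'_def field_simps)
  have c'1: "\<bar>c'\<bar> \<le> 1" using c' c \<theta>c by auto
  define G where "G \<omega> = a n *\<^sub>R (\<Sum>k\<in>{m+1..<m+q}. X k \<omega>)" for \<omega>
  \<comment> \<open>The \<open>q - 1\<close> terms strictly between the blocks form
    \<open>G\<close>. The second block starts at \<open>m + q\<close>, the first index covered by
    the mixing coefficient at distance \<open>q\<close>, and \<open>V\<close> also absorbs the
    centring.\<close>
  define V where "V \<omega> = a n *\<^sub>R (\<Sum>k\<in>{m+q..n}. X k \<omega>) + (b n - c' *\<^sub>R b m)" for \<omega>
  have G_m [measurable]: "G \<in> borel_measurable M"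
    unfolding G_def by (intro borel_measurable_scaleR borel_measurable_sum borel_measurable_const X) auto
  have V_m [measurable]: "V \<in> borel_measurable M"
    unfolding V_def using mn by (intro borel_measurable_add borel_measurable_scaleR borel_measurable_sum borel_measurable_const X) auto
  have split: "U n \<omega> = c' *\<^sub>R U m \<omega> + V \<omega> + G \<omega>" for \<omega>
  proof -
    have "{1..n} = {1..m} \<union> ({m+1..<m+q} \<union> {m+q..n})" using mn q by auto
    then have "(\<Sum>k=1..n. X k \<omega>) = (\<Sum>k=1..m. X k \<omega>) + ((\<Sum>k\<in>{m+1..<m+q}. X k \<omega>) + (\<Sum>k\<in>{m+q..n}. X k \<omega>))"
      using mn q by (simp only:) (subst sum.union_disjoint, auto)+
    moreover have "c' * a m = a n" using am by (simp add: c'_def)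
    ultimately show ?thesis by (simp add: U_def V_def G_def scaleR_add_right)
  qed
  define \<nu> where "\<nu> = distr M borel V"
  have \<nu>: "borel_prob \<nu>" unfolding \<nu>_def by (rule borel_prob_distr[OF prob_space_axioms V_m])
  have cov: "\<bar>expectation (\<lambda>\<omega>. w i (U m \<omega>) * h (V \<omega>)) - expectation (\<lambda>\<omega>. w i (U m \<omega>)) * expectation (\<lambda>\<omega>. h (V \<omega>))\<bar> \<le> alpha_mix M X q"
    if h [measurable]: "h \<in> borel_measurable borel" and h01: "\<And>y. 0 \<le> h y" "\<And>y. h y \<le> 1" for i h
  proof (rule covariance_le_mixing)
    let ?S = "\<lambda>K. sigma (space M) (\<Union>k\<in>K. {X k -` B \<inter> space M | B. B \<in> sets borel})"
    have "U m \<in> borel_measurable (?S {1..m})"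
      unfolding U_def by (intro borel_measurable_add borel_measurable_scaleR borel_measurable_sum
        borel_measurable_const measurable_sigma_generator)
    then have A: "{\<omega>\<in>space M. s \<le> w i (U m \<omega>)} \<in> sigma_gen M X {1..m}" for s
      by (intro sigma_gen_measurable measurable_compose[OF _ w_m])
    have "V \<in> borel_measurable (?S {m + q..})"
      unfolding V_def by (intro borel_measurable_add borel_measurable_scaleR borel_measurable_sum
        borel_measurable_const measurable_sigma_generator) auto
    then have B: "{\<omega>\<in>space M. s \<le> h (V \<omega>)} \<in> sigma_gen M X {m + q..}" for s
      by (intro sigma_gen_measurable measurable_compose[OF _ h])
    show "\<bar>prob ({\<omega>\<in>space M. s \<le> w i (U m \<omega>)} \<inter> {\<omega>\<in>space M. s' \<le> h (V \<omega>)}) -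
        prob {\<omega>\<in>space M. s \<le> w i (U m \<omega>)} * prob {\<omega>\<in>space M. s' \<le> h (V \<omega>)}\<bar> \<le> alpha_mix M X q" for s s'
      by (rule alpha_mix_bound[OF X mn(2) q(2) A B])
  qed (use w0 wb h01 in auto)
  \<comment> \<open>One \<open>\<delta>\<close> is the mass missed by the partition under
    \<open>\<mu>\<close>, the other the passage from \<open>\<mu>\<close> to
    \<open>law m\<close>.\<close>
  have tail: "1 - 2 * \<delta> \<le> expectation (\<lambda>\<omega>. \<Sum>i<N. w i (U m \<omega>))"
  proof -
    have int: "integrable \<rho> (w i)" if "borel_prob \<rho>" for \<rho> i by (rule BL_integrable[OF wBL that])
    have "expectation (\<lambda>\<omega>. \<Sum>i<N. w i (U m \<omega>)) = (\<integral>y. (\<Sum>i<N. w i y) \<partial>law m)"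
      unfolding law_def by (rule integral_distr[symmetric]) measurable
    also have "\<dots> = (\<Sum>i<N. integral\<^sup>L (law m) (w i))" using int[OF borel_prob_law] by simp
    finally have "(\<integral>y. (\<Sum>i<N. w i y) \<partial>\<mu>) - expectation (\<lambda>\<omega>. \<Sum>i<N. w i (U m \<omega>)) =
        (\<Sum>i<N. integral\<^sup>L \<mu> (w i) - integral\<^sup>L (law m) (w i))"
      using int[OF \<mu>] by (simp add: sum_subtractf)
    also have "\<dots> \<le> (\<Sum>i<N. L * \<delta>')"
    proof (rule sum_mono)
      fix i
      show "integral\<^sup>L \<mu> (w i) - integral\<^sup>L (law m) (w i) \<le> L * \<delta>'"
        using bl_close_BL[OF N0(1)[OF mn(1)] wBL L, of i] by linarith
    qed
    also have "\<dots> \<le> \<delta>" using \<delta>'(3) by simp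
    finally show ?thesis using wi by linarith
  qed
  have "bl_close \<mu> (conv c \<mu> \<nu>) \<epsilon>"
    unfolding bl_close_def
  proof (intro allI impI)
    fix F :: "'a \<Rightarrow> real" assume F: "BL 1 F"
    have [measurable]: "F \<in> borel_measurable borel" using BL_measurable[OF F] by simp
    have "\<bar>integral\<^sup>L \<mu> F - integral\<^sup>L (law n) F\<bar> \<le> \<delta>'"
      using N0(1)[of n] mn F unfolding bl_close_def by simp
    then have 1: "\<bar>integral\<^sup>L \<mu> F - expectation (\<lambda>\<omega>. F (U n \<omega>))\<bar> \<le> \<delta>"
      using \<delta>' unfolding law_def by (subst (asm) integral_distr) auto
    have "\<bar>expectation (\<lambda>\<omega>. F (U n \<omega>)) - expectation (\<lambda>\<omega>. F (c' *\<^sub>R U m \<omega> + V \<omega>))\<bar>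
        \<le> expectation (\<lambda>\<omega>. \<delta> + 2 * indicator {\<omega>\<in>space M. \<delta> < norm (G \<omega>)} \<omega>)"
    proof (rule abs_integral_diff_le)
      show "integrable M (\<lambda>\<omega>. F (U n \<omega>))" "integrable M (\<lambda>\<omega>. F (c' *\<^sub>R U m \<omega> + V \<omega>))"
        by (rule integrable_bounded_prob[OF prob_space_axioms _ BL_abs[OF F]], measurable)+
      show "integrable M (\<lambda>\<omega>. \<delta> + 2 * indicator {\<omega>\<in>space M. \<delta> < norm (G \<omega>)} \<omega>)"
        by (rule integrable_bounded_prob[OF prob_space_axioms, where B = "\<delta> + 2"])
          (use \<delta> in \<open>auto simp: indicator_def\<close>)
      fix \<omega> assume \<omega>: "\<omega> \<in> space M"
      have "\<bar>F (U n \<omega>) - F (c' *\<^sub>R U m \<omega> + V \<omega>)\<bar> \<le> min 2 (norm (G \<omega>))"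
        by (rule BL_diff_trunc[OF F]) (simp add: split dist_norm)
      also have "\<dots> \<le> \<delta> + 2 * indicator {\<omega>\<in>space M. \<delta> < norm (G \<omega>)} \<omega>"
        using \<omega> \<delta> by (auto simp: indicator_def)
      finally show "\<bar>F (U n \<omega>) - F (c' *\<^sub>R U m \<omega> + V \<omega>)\<bar> \<le> \<delta> + 2 * indicator {\<omega>\<in>space M. \<delta> < norm (G \<omega>)} \<omega>" .
    qed
    also have "\<dots> = \<delta> + 2 * prob {\<omega>\<in>space M. \<delta> < norm (G \<omega>)}"
      by (subst Bochner_Integration.integral_add) (auto simp: prob_space emeasure_finite less_top[symmetric])
    also have "\<dots> \<le> 3 * \<delta>" using N0(2)[of n m] mn by (simp add: G_def)
    finally have 2: "\<bar>expectation (\<lambda>\<omega>. F (U n \<omega>)) - expectation (\<lambda>\<omega>. F (c' *\<^sub>R U m \<omega> + V \<omega>))\<bar> \<le> 3 * \<delta>" .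
    have "\<bar>expectation (\<lambda>\<omega>. F (c' *\<^sub>R U m \<omega> + V \<omega>)) - integral\<^sup>L (conv c' (law m) \<nu>) F\<bar>
        \<le> 2 * (\<delta> + 2 * \<delta>) + 2 * real N * alpha_mix M X q"
      unfolding law_def \<nu>_def
      by (rule conv_approx_mixing[where w = w, OF U_measurable V_m w_m w0 w1 wb ws _ tail cov c'1 F]) (use \<delta> in auto)
    also have "\<dots> \<le> 2 * (\<delta> + 2 * \<delta>) + \<delta>" by (rule add_left_mono[OF \<alpha>])
    finally have 3: "\<bar>expectation (\<lambda>\<omega>. F (c' *\<^sub>R U m \<omega> + V \<omega>)) - integral\<^sup>L (conv c' (law m) \<nu>) F\<bar> \<le> 7 * \<delta>"
      by simp
    have "\<bar>integral\<^sup>L (conv c' \<mu> \<nu>) F - integral\<^sup>L (conv c' (law m) \<nu>) F\<bar> \<le> \<delta>'"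
      using bl_close_conv_left[OF \<mu> borel_prob_law \<nu> N0(1)[OF mn(1)] c'1] F unfolding bl_close_def by blast
    then have 4: "\<bar>integral\<^sup>L (conv c' \<mu> \<nu>) F - integral\<^sup>L (conv c' (law m) \<nu>) F\<bar> \<le> \<delta>" using \<delta>'(2) by linarith
    have "\<bar>integral\<^sup>L (conv c' \<mu> \<nu>) F - integral\<^sup>L (conv c \<mu> \<nu>) F\<bar> \<le> trunc_moment \<mu> \<bar>c' - c\<bar>"
      using bl_close_conv_scale[OF \<mu> \<nu>] F unfolding bl_close_def by blast
    also have "\<dots> \<le> \<delta>" using c' \<theta>c by (intro t(2)) auto
    finally have 5: "\<bar>integral\<^sup>L (conv c' \<mu> \<nu>) F - integral\<^sup>L (conv c \<mu> \<nu>) F\<bar> \<le> \<delta>" .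
    show "\<bar>integral\<^sup>L \<mu> F - integral\<^sup>L (conv c \<mu> \<nu>) F\<bar> \<le> \<epsilon>"
      using 1 2 3 4 5 unfolding \<delta>_def by linarith
  qed
  with \<nu> show ?thesis by blast
qed

end

theorem theorem1:
  fixes M :: "'w measure"
    and X :: "nat \<Rightarrow> 'w \<Rightarrow> 'a::{banach, second_countable_topology}"
    and a :: "nat \<Rightarrow> real"
    and b :: "nat \<Rightarrow> 'a"
    and \<mu> :: "'a measure"
  assumes "prob_space M"
    and "\<And>k. k \<ge> 1 \<Longrightarrow> X k \<in> borel_measurable M"
    and "strongly_mixing M X"
    and "\<And>n. n \<ge> 1 \<Longrightarrow> a n > 0"
    and "infinitesimal_array M a X"
    and "borel_prob \<mu>"
    and "nondegenerate \<mu>"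
    and "weak_conv_borel (\<lambda>n. distr M borel (\<lambda>\<omega>. a n *\<^sub>R (\<Sum>k=1..n. X k \<omega>) + b n)) \<mu>"
  shows "selfdecomposable \<mu>"
proof -
  interpret normed_sums M X a b \<mu>
    using assms by (intro normed_sums.intro normed_sums_axioms.intro) auto
  show ?thesis
    by (rule selfdecomposable_if_approx_decomposable[OF \<mu> approx_decomposable[OF assms(3)]])
qed

end
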